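(* Let $a,b,c\in\mathbb{R}$ and $1\leq r<p<\infty$ be given ($1\leq p<\infty$ and $0<r<p$ if $N=1$). Then $\widetilde{W}_{\{a,b\}}^{1,(\infty,p)}\hookrightarrow L^r(\mathbb{R}^N;|x|^c dx)$ if and only if $a\neq 0$ and one of the following two conditions holds: (i) $ap-N\neq b-p$ are on the same side of $-N$ (including $b-p=-N$) and $c$ is in the open interval with endpoints $c^0$ and $c^1$. (ii) $ap-N$ and $b-p$ are strictly on opposite sides of $-N$ and $c$ is in the open interval with endpoints $c^0$ and $-N$.
   Context: $N\geq 1$ is an integer and $\mathbb{R}_*^N:=\mathbb{R}^N\setminus\{0\}$. For $d\in\mathbb{R}$, $|x|^d dx$ is regarded as a measure on $\mathbb{R}^N$ for which $\{0\}$ has measure $0$. For $0<s<\infty$, $L^s(\mathbb{R}^N;|x|^d dx)$ is the space of Lebesgue measurable functions $u$ such that $|x|^{d/s}u\in L^s(\mathbb{R}^N)$, with norm (quasi-norm if $s<1$) $\|u\|_{d,s}:=\|\,|x|^{d/s}u\|_s$. For a distribution $u$ on $\mathbb{R}_*^N$, $\partial_\rho u:=\nabla u\cdot\frac{x}{|x|}$ is its radial derivative. For $a,b\in\mathbb{R}$ and $1\leq p<\infty$, $$\widetilde{W}_{\{a,b\}}^{1,(\infty,p)}:=\{u\in L^1_{loc}(\mathbb{R}_*^N): |x|^a u\in L^\infty(\mathbb{R}^N),\ \partial_\rho u\in L^p(\mathbb{R}^N;|x|^b dx)\},$$ with norm $\|\,|x|^a u\|_\infty+\|\partial_\rho u\|_{b,p}$.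 The symbol $\hookrightarrow$ denotes continuous embedding. Given $a,b,p,r$, set $c^0:=ar-N$ and $c^1:=\frac{r(b-p+N)}{p}-N$. The interval with two given endpoints is meant irrespective of which endpoint is larger. "On the same side of $-N$ (including $b-p=-N$)" means that both numbers are $\geq -N$ or both are $\leq -N$; equivalently $a(b-p+N)\geq 0$. "Strictly on opposite sides of $-N$" means one number is $<-N$ and the other is $>-N$; equivalently $a(b-p+N)<0$. *)

theory Defs
  imports "HOL-Analysis.Analysis" "HOL-Probability.Essential_Supremum"
begin

text \<open>
  Functions are real-valued, total on the whole space, and identified by their values off a
  Lebesgue null set; in particular the value at the origin never matters, and the Isabelle
  convention \<^term>\<open>0 powr d = 0\<close> in the weights is harmless.
\<close>

definition Lp_space :: "real \<Rightarrow> ('a::euclidean_space \<Rightarrow> real) set" where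
  "Lp_space s = {f \<in> borel_measurable lebesgue. integrable lebesgue (\<lambda>x. \<bar>f x\<bar> powr s)}"

definition Lp_norm :: "real \<Rightarrow> ('a::euclidean_space \<Rightarrow> real) \<Rightarrow> real" where
  "Lp_norm s f = (\<integral>x. \<bar>f x\<bar> powr s \<partial>lebesgue) powr (1 / s)"

definition Linf_space :: "('a::euclidean_space \<Rightarrow> real) set" where
  "Linf_space = {f \<in> borel_measurable lebesgue. esssup lebesgue (\<lambda>x. ereal \<bar>f x\<bar>) < \<infinity>}"

definition Linf_norm :: "('a::euclidean_space \<Rightarrow> real) \<Rightarrow> real" where
  "Linf_norm f = real_of_ereal (esssup lebesgue (\<lambda>x. ereal \<bar>f x\<bar>))"

definition weighted_Lp_space :: "real \<Rightarrow> real \<Rightarrow> ('a::euclidean_space \<Rightarrow> real) set" where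
  "weighted_Lp_space d s =
     {u \<in> borel_measurable lebesgue. (\<lambda>x. norm x powr (d / s) * u x) \<in> Lp_space s}"

definition weighted_Lp_norm :: "real \<Rightarrow> real \<Rightarrow> ('a::euclidean_space \<Rightarrow> real) \<Rightarrow> real" where
  "weighted_Lp_norm d s u = Lp_norm s (\<lambda>x. norm x powr (d / s) * u x)"

definition L1loc_punctured :: "('a::euclidean_space \<Rightarrow> real) set" where
  "L1loc_punctured = {u. \<forall>K. compact K \<and> 0 \<notin> K \<longrightarrow> set_integrable lebesgue K u}"

fun C_diff :: "nat \<Rightarrow> ('a::euclidean_space \<Rightarrow> real) \<Rightarrow> bool" where
  "C_diff 0 f \<longleftrightarrow> continuous_on UNIV f"
| "C_diff (Suc k) f \<longleftrightarrow> (\<forall>x. f differentiable (at x)) \<and>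
     (\<forall>i\<in>Basis. C_diff k (\<lambda>x. frechet_derivative f (at x) i))"

definition test_function_punctured :: "('a::euclidean_space \<Rightarrow> real) \<Rightarrow> bool" where
  "test_function_punctured \<phi> \<longleftrightarrow>
     (\<forall>k. C_diff k \<phi>) \<and> compact (closure {x. \<phi> x \<noteq> 0}) \<and> 0 \<notin> closure {x. \<phi> x \<noteq> 0}"

text \<open>
  The distribution \<open>\<nabla>u \<cdot> x/|x| = \<Sum>\<^sub>i (x\<^sub>i/|x|) \<partial>\<^sub>i u\<close>: the factor \<open>x\<^sub>i/|x|\<close> is smooth off the origin, so it
  moves to the test function, and the distributional \<open>\<partial>\<^sub>i\<close> then produces the minus sign.
\<close>

definition radial_deriv_distr ::
    "('a::euclidean_space \<Rightarrow> real) \<Rightarrow> ('a \<Rightarrow> real) \<Rightarrow> real" where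
  "radial_deriv_distr u \<phi> =
     (\<Sum>i\<in>Basis. - (\<integral>x. u x * frechet_derivative (\<lambda>y. \<phi> y * ((y \<bullet> i) / norm y)) (at x) i \<partial>lebesgue))"

definition has_radial_deriv ::
    "('a::euclidean_space \<Rightarrow> real) \<Rightarrow> ('a \<Rightarrow> real) \<Rightarrow> bool" where
  "has_radial_deriv u g \<longleftrightarrow> u \<in> L1loc_punctured \<and> g \<in> L1loc_punctured \<and>
     (\<forall>\<phi>. test_function_punctured \<phi> \<longrightarrow> radial_deriv_distr u \<phi> = (\<integral>x. g x * \<phi> x \<partial>lebesgue))"

text \<open>The choice is immaterial: \<open>g\<close> in \<^const>\<open>has_radial_deriv\<close> is unique up to a null set.\<close>

definition radial_deriv :: "('a::euclidean_space \<Rightarrow> real) \<Rightarrow> 'a \<Rightarrow> real" where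
  "radial_deriv u = (SOME g. has_radial_deriv u g)"

text \<open>
  For \<open>p \<ge> 1\<close>, Hoelder's inequality puts \<open>L\<^sup>p(|x|\<^sup>b dx)\<close> inside \<open>L\<^sup>1\<^sub>l\<^sub>o\<^sub>c\<close> of the punctured space, so the local
  integrability of \<open>g\<close> demanded by \<^const>\<open>has_radial_deriv\<close> is no extra condition here.
\<close>

definition W_space :: "real \<Rightarrow> real \<Rightarrow> real \<Rightarrow> ('a::euclidean_space \<Rightarrow> real) set" where
  "W_space a b p =
     {u \<in> L1loc_punctured. (\<lambda>x. norm x powr a * u x) \<in> Linf_space \<and>
        (\<exists>g \<in> weighted_Lp_space b p. has_radial_deriv u g)}"

definition W_norm :: "real \<Rightarrow> real \<Rightarrow> real \<Rightarrow> ('a::euclidean_space \<Rightarrow> real) \<Rightarrow> real" where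
  "W_norm a b p u =
     Linf_norm (\<lambda>x. norm x powr a * u x) + weighted_Lp_norm b p (radial_deriv u)"

text \<open>
  \<open>X \<hookrightarrow> Y\<close> for (quasi-)normed function spaces: the linear inclusion is defined and bounded.
\<close>

definition continuously_embedded ::
    "'f set \<Rightarrow> ('f \<Rightarrow> real) \<Rightarrow> 'f set \<Rightarrow> ('f \<Rightarrow> real) \<Rightarrow> bool" where
  "continuously_embedded X normX Y normY \<longleftrightarrow>
     X \<subseteq> Y \<and> (\<exists>C. \<forall>u\<in>X. normY u \<le> C * normX u)"

definition open_interval_between :: "real \<Rightarrow> real \<Rightarrow> real set" where
  "open_interval_between s t = {min s t <..< max s t}"

definition same_side :: "real \<Rightarrow> real \<Rightarrow> real \<Rightarrow> bool" where
  "same_side m s t \<longleftrightarrow> (s \<ge> m \<and> t \<ge> m) \<or> (s \<le> m \<and> t \<le> m)"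

definition strictly_opposite_sides :: "real \<Rightarrow> real \<Rightarrow> real \<Rightarrow> bool" where
  "strictly_opposite_sides m s t \<longleftrightarrow> (s < m \<and> m < t) \<or> (t < m \<and> m < s)"

end

theory Submission
  imports Defs
begin

text \<open>
  Write \<open>\<alpha> = - a\<close>, \<open>\<beta> = - (b - p + N) / p\<close> and \<open>\<gamma> = - (c + N) / r\<close>. These are the exponents of the powers of \<open>|x|\<close>
  that are borderline for the bound on \<open>u\<close>, for the integral of the radial derivative, and for the
  target space. In these terms the embedding holds iff \<open>\<alpha> \<noteq> 0\<close>, \<open>\<gamma>\<close> lies strictly between \<open>\<alpha>\<close> and \<open>\<beta>\<close>,
  and, when \<open>\<alpha>\<close> and \<open>\<beta>\<close> have opposite signs, \<open>\<gamma>\<close> lies even strictly between \<open>\<alpha>\<close> and \<open>0\<close>.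

  Polar coordinates are avoided throughout: their role is played by the dilations \<open>x \<mapsto> t x\<close> and by the
  measure \<open>|x|\<^sup>-\<^sup>N dx\<close>, which is invariant under them.

  Sufficiency. Testing the weak derivative \<open>g\<close> of \<open>u\<close> with the dilated test functions \<open>\<theta> (x / t)\<close>, integrating
  over \<open>1 \<le> t \<le> 2\<close>, and using the fundamental lemma of the calculus of variations, one finds
  \<open>u (2 x) - u x = |x| \<integral>\<^sub>1\<^sup>2 g (t x) dt\<close> for almost every \<open>x\<close> (\<open>dyadic_difference_eq_radial_mean\<close>). Jensen's
  inequality then puts the increments \<open>u (2 x) - u x\<close> into a weighted \<open>L\<^sup>p\<close> space, so no regularity of \<open>u\<close>
  along rays is needed. On one side of the unit sphere the bound on \<open>|x|\<^sup>a |u|\<close> suffices, because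
  \<open>\<gamma> \<noteq> \<alpha>\<close>. On the other one \<open>u\<close> is recovered from its increments (\<open>one_sided_hardy\<close>), starting
  either from \<open>|x| = 1\<close>, or from the far end if \<open>u\<close> tends to zero there; the sign conditions say that one of
  the two is possible. As \<open>r < p\<close> and \<open>\<gamma>\<close> differs strictly from \<open>\<beta>\<close>, the passage from exponent \<open>p\<close> to \<open>r\<close> costs
  only an integrable power of \<open>|x|\<close> (\<open>powr_le_powr_add_exp\<close>).

  Necessity. Already the inclusion of sets fails, for radial functions \<open>H (ln |x|)\<close>, whose integrals reduce to
  the real line (\<open>nn_integral_radial\<close>). If \<open>\<gamma>\<close> is not strictly between \<open>\<alpha>\<close> and \<open>\<beta>\<close>, then in one of the directions
  \<open>|x| \<rightarrow> 0\<close>, \<open>|x| \<rightarrow> \<infinity>\<close> the function \<open>|x|\<^sup>\<gamma> |ln |x||\<^bsup>-1/r\<^esup>\<close> is admissible but not in the target; it is admissible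
  because \<open>r < p\<close> (\<open>critical_counterexample\<close>). The remaining conditions exclude a function that is \<open>1\<close> in one of
  these directions and \<open>0\<close> in the other (\<open>plateau_counterexample\<close>).
\<close>

section \<open>Smooth bump functions\<close>

lemma C_diff_continuous: "C_diff k f \<Longrightarrow> continuous_on UNIV f"
  by (cases k) (auto intro!: continuous_at_imp_continuous_on differentiable_imp_continuous_within)

lemma C_diff_mono_Suc: "C_diff (Suc k) f \<Longrightarrow> C_diff k f"
proof (induction k arbitrary: f)
  case 0
  then show ?case using C_diff_continuous by (metis C_diff.simps(1))
next
  case (Suc k)
  then show ?case by (metis C_diff.simps(2))
qed

lemma frechet_derivative_eq: "(f has_derivative f') (at x) \<Longrightarrow> frechet_derivative f (at x) i = f' i"
  using frechet_derivative_at by metis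

lemma C_diff_SucI:
  assumes "\<And>x. (f has_derivative f' x) (at x)" "\<And>i. i \<in> Basis \<Longrightarrow> C_diff k (\<lambda>x. f' x i)"
  shows "C_diff (Suc k) f"
  using assms by (auto simp: frechet_derivative_eq[OF assms(1)] differentiable_def)

lemma C_diff_SucE:
  assumes "C_diff (Suc k) f"
  obtains f' where "\<And>x. (f has_derivative f' x) (at x)" "\<And>i. i \<in> Basis \<Longrightarrow> C_diff k (\<lambda>x. f' x i)"
  using that[of "\<lambda>x. frechet_derivative f (at x)"] assms by (simp add: frechet_derivative_works)

lemma C_diff_const: "C_diff k (\<lambda>x. c)"
proof (induction k arbitrary: c)
  case (Suc k)
  then show ?case by (intro C_diff_SucI[where f'="\<lambda>_ _. 0"]) auto
qed auto

lemma C_diff_add: "C_diff k f \<Longrightarrow> C_diff k g \<Longrightarrow> C_diff k (\<lambda>x. f x + g x)"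
proof (induction k arbitrary: f g)
  case 0
  then show ?case by (auto intro: continuous_intros)
next
  case (Suc k)
  obtain f' where f': "\<And>x. (f has_derivative f' x) (at x)" "\<And>i. i \<in> Basis \<Longrightarrow> C_diff k (\<lambda>x. f' x i)"
    using C_diff_SucE[OF Suc.prems(1)] by metis
  obtain g' where g': "\<And>x. (g has_derivative g' x) (at x)" "\<And>i. i \<in> Basis \<Longrightarrow> C_diff k (\<lambda>x. g' x i)"
    using C_diff_SucE[OF Suc.prems(2)] by metis
  show ?case
    by (rule C_diff_SucI[where f'="\<lambda>x h. f' x h + g' x h"])
       (auto intro!: has_derivative_add f' g' Suc.IH)
qed

lemma C_diff_mult: "C_diff k f \<Longrightarrow> C_diff k g \<Longrightarrow> C_diff k (\<lambda>x. f x * g x)"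
proof (induction k arbitrary: f g)
  case 0
  then show ?case by (auto intro: continuous_intros)
next
  case (Suc k)
  obtain f' where f': "\<And>x. (f has_derivative f' x) (at x)" "\<And>i. i \<in> Basis \<Longrightarrow> C_diff k (\<lambda>x. f' x i)"
    using C_diff_SucE[OF Suc.prems(1)] by metis
  obtain g' where g': "\<And>x. (g has_derivative g' x) (at x)" "\<And>i. i \<in> Basis \<Longrightarrow> C_diff k (\<lambda>x. g' x i)"
    using C_diff_SucE[OF Suc.prems(2)] by metis
  have "C_diff k f" "C_diff k g" using Suc.prems C_diff_mono_Suc by blast+
  then show ?case
    by (intro C_diff_SucI[where f'="\<lambda>x h. f x * g' x h + f' x h * g x"])
       (auto intro!: has_derivative_mult f' g' Suc.IH C_diff_add)
qed

lemma C_diff_prod: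
  assumes "\<And>i. i \<in> I \<Longrightarrow> C_diff k (f i)"
  shows "C_diff k (\<lambda>x. \<Prod>i\<in>I. f i x)"
  using assms by (induction I rule: infinite_finite_induct) (auto intro: C_diff_const C_diff_mult)

lemma C_diff_dilate: "C_diff k f \<Longrightarrow> C_diff k (\<lambda>x. m * f (c *\<^sub>R x))"
proof (induction k arbitrary: f m)
  case 0
  then show ?case
    by (auto intro!: continuous_intros continuous_on_compose2[of UNIV f])
next
  case (Suc k)
  obtain f' where f': "\<And>x. (f has_derivative f' x) (at x)" "\<And>i. i \<in> Basis \<Longrightarrow> C_diff k (\<lambda>x. f' x i)"
    using C_diff_SucE[OF Suc.prems(1)] by metis
  have lin: "f' x (c *\<^sub>R h) = c * f' x h" for x h
    using has_derivative_linear[OF f'(1)[of x]] by (simp add: linear_cmul)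
  have "((\<lambda>x. m * f (c *\<^sub>R x)) has_derivative (\<lambda>h. (m * c) * f' (c *\<^sub>R x) h)) (at x)" for x
  proof -
    have "((\<lambda>x. f (c *\<^sub>R x)) has_derivative (\<lambda>h. f' (c *\<^sub>R x) (c *\<^sub>R h))) (at x)"
      by (rule has_derivative_compose[of "\<lambda>x. c *\<^sub>R x" "\<lambda>h. c *\<^sub>R h" x UNIV, OF _ f'(1)])
         (auto intro!: derivative_eq_intros)
    from has_derivative_mult_right[OF this, of m] show ?thesis by (simp add: lin mult.assoc)
  qed
  then show ?case
    by (rule C_diff_SucI) (auto intro!: Suc.IH f')
qed

text \<open>
  The functions \<open>P (1/t) exp (- 1/t)\<close>, extended by zero to \<open>t \<le> 0\<close>. The family is closed under
  differentiation, so that the smoothness of all its members follows by one induction.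
\<close>

definition poly_exp :: "real poly \<Rightarrow> real \<Rightarrow> real" where
  "poly_exp P t = (if t > 0 then poly P (1 / t) * exp (- (1 / t)) else 0)"

lemma poly_exp_tendsto_0: "((\<lambda>s::real. poly P s * exp (- s)) \<longlongrightarrow> 0) at_top"
proof -
  have "((\<lambda>s. \<Sum>i\<le>degree P. coeff P i * (s ^ i / exp s)) \<longlongrightarrow> (\<Sum>i\<le>degree P. coeff P i * 0)) at_top"
    by (intro tendsto_intros tendsto_power_div_exp_0)
  then show ?thesis
    by (simp add: poly_altdef sum_distrib_right exp_minus divide_inverse mult.assoc)
qed

lemma poly_exp_deriv:
  "(poly_exp P has_real_derivative poly_exp ([:0, 0, 1:] * (P - pderiv P)) t) (at t)"
proof -
  consider "t > 0" | "t < 0" | "t = 0" by linarith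
  then show ?thesis
  proof cases
    case 1
    have "((\<lambda>t. poly P (1 / t) * exp (- (1 / t))) has_real_derivative
       poly_exp ([:0, 0, 1:] * (P - pderiv P)) t) (at t)"
      using 1 by (auto intro!: derivative_eq_intros poly_DERIV[THEN DERIV_chain2]
          simp: poly_exp_def field_simps power2_eq_square)
    then show ?thesis
      by (rule DERIV_cong_ev[THEN iffD1, rotated -1])
         (use 1 in \<open>auto simp: poly_exp_def intro!: eventually_nhds_in_open[of "{0<..}" t, THEN eventually_mono]\<close>)
  next
    case 2
    have "((\<lambda>t. 0) has_real_derivative poly_exp ([:0, 0, 1:] * (P - pderiv P)) t) (at t)"
      using 2 by (simp add: poly_exp_def)
    then show ?thesis
      by (rule DERIV_cong_ev[THEN iffD1, rotated -1])
         (use 2 in \<open>auto simp: poly_exp_def intro!: eventually_nhds_in_open[of "{..<0}" t, THEN eventually_mono]\<close>)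
  next
    case 3
    have r: "((\<lambda>h. poly_exp P h / h) \<longlongrightarrow> 0) (at_right 0)"
    proof -
      have "((\<lambda>h::real. poly (pCons 0 P) (1 / h) * exp (- (1 / h))) \<longlongrightarrow> 0) (at_right 0)"
        using filterlim_compose[OF poly_exp_tendsto_0 filterlim_inverse_at_top_right, of "pCons 0 P"]
        by (simp add: inverse_eq_divide)
      then show ?thesis
        by (rule Lim_transform_eventually)
           (auto simp: poly_exp_def eventually_at_right_less intro!: eventually_mono[OF eventually_at_right_less])
    qed
    have l: "((\<lambda>h. poly_exp P h / h) \<longlongrightarrow> 0) (at_left 0)"
      by (rule Lim_transform_eventually[of "\<lambda>_. 0"])
         (auto simp: poly_exp_def eventually_at_filter)
    have "((\<lambda>h. poly_exp P h / h) \<longlongrightarrow> 0) (at 0)"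
      using l r by (simp add: filterlim_at_split)
    then show ?thesis using 3 by (simp add: DERIV_def poly_exp_def)
  qed
qed

lemma C_diff_poly_exp: "C_diff k (\<lambda>x::'a::euclidean_space. m * poly_exp P (c * (x \<bullet> j) + d))"
proof (induction k arbitrary: m P)
  case 0
  have "continuous_on UNIV (poly_exp P)"
    by (meson poly_exp_deriv DERIV_continuous continuous_at_imp_continuous_on)
  then show ?case
    by (auto intro!: continuous_intros continuous_on_compose2[of UNIV "poly_exp P"])
next
  case (Suc k)
  let ?Q = "[:0, 0, 1:] * (P - pderiv P)"
  have "((\<lambda>x. m * poly_exp P (c * (x \<bullet> j) + d)) has_derivative
       (\<lambda>h. (m * c * (h \<bullet> j)) * poly_exp ?Q (c * (x \<bullet> j) + d))) (at x)" for x :: 'a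
  proof -
    have "((\<lambda>x. poly_exp P (c * (x \<bullet> j) + d)) has_derivative
        (\<lambda>h. poly_exp ?Q (c * (x \<bullet> j) + d) * (c * (h \<bullet> j)))) (at x)"
      by (rule has_derivative_compose[of "\<lambda>x. c * (x \<bullet> j) + d" "\<lambda>h. c * (h \<bullet> j)" x UNIV,
            OF _ poly_exp_deriv[unfolded has_field_derivative_def]])
         (auto intro!: derivative_eq_intros)
    from has_derivative_mult_right[OF this, of m] show ?thesis by (simp add: mult_ac)
  qed
  then show ?case
    by (rule C_diff_SucI) (rule Suc.IH)
qed

lemma test_function_dilate:
  assumes "test_function_punctured \<theta>" "c > 0"
  shows "test_function_punctured (\<lambda>x. \<theta> (c *\<^sub>R x))"
proof -
  have "(*\<^sub>R) (inverse c) ` closure {x. \<theta> x \<noteq> 0} = closure ((*\<^sub>R) (inverse c) ` {x. \<theta> x \<noteq> 0})"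
    by (rule closure_scaleR)
  moreover have "(*\<^sub>R) (inverse c) ` {x. \<theta> x \<noteq> 0} = {x. \<theta> (c *\<^sub>R x) \<noteq> 0}"
    using assms(2) by (force simp: image_iff intro: exI[of _ "c *\<^sub>R x" for x])
  ultimately have eq: "closure {x. \<theta> (c *\<^sub>R x) \<noteq> 0} = (*\<^sub>R) (inverse c) ` closure {x. \<theta> x \<noteq> 0}"
    by simp
  have "compact (closure {x. \<theta> (c *\<^sub>R x) \<noteq> 0})"
    unfolding eq using assms(1) by (intro compact_scaling) (auto simp: test_function_punctured_def)
  moreover have "0 \<notin> closure {x. \<theta> (c *\<^sub>R x) \<noteq> 0}"
    unfolding eq using assms by (auto simp: test_function_punctured_def)
  moreover have "C_diff k (\<lambda>x. \<theta> (c *\<^sub>R x))" for k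
    using C_diff_dilate[of k \<theta> 1 c] assms(1) by (auto simp: test_function_punctured_def)
  ultimately show ?thesis by (auto simp: test_function_punctured_def)
qed

text \<open>
  For \<open>n > 0\<close>, a smooth function that is positive exactly on the open box between \<open>l\<close> and \<open>u\<close>: the product over
  all coordinates of \<open>exp (- 1 / (n (x\<^sub>j - l\<^sub>j))) exp (- 1 / (n (u\<^sub>j - x\<^sub>j)))\<close>. As \<open>n \<rightarrow> \<infinity>\<close> it tends to the
  indicator of the box. The arguments are written out as affine functions of \<open>x\<^sub>j\<close> to match \<open>C_diff_poly_exp\<close>.
\<close>

definition box_bump :: "'a::euclidean_space \<Rightarrow> 'a \<Rightarrow> nat \<Rightarrow> 'a \<Rightarrow> real" where
  "box_bump l u n x = (\<Prod>j\<in>Basis. poly_exp 1 (real n * (x \<bullet> j) + (- real n * (l \<bullet> j))) *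
                                  poly_exp 1 ((- real n) * (x \<bullet> j) + real n * (u \<bullet> j)))"

lemma poly_exp_1_bounds: "0 \<le> poly_exp 1 t" "poly_exp 1 t \<le> 1" "poly_exp 1 t \<noteq> 0 \<longleftrightarrow> t > 0"
  by (auto simp: poly_exp_def)

lemma box_bump_le_1: "\<bar>box_bump l u n x\<bar> \<le> 1"
  unfolding box_bump_def abs_prod
  by (intro prod_le_1) (auto simp: abs_mult poly_exp_1_bounds intro!: mult_le_one)

lemma box_bump_eq_0:
  assumes "x \<notin> box l u" shows "box_bump l u n x = 0"
proof -
  obtain j where j: "j \<in> Basis" "x \<bullet> j \<le> l \<bullet> j \<or> u \<bullet> j \<le> x \<bullet> j"
    using assms by (force simp: mem_box)
  have "poly_exp 1 (real n * (x \<bullet> j) + (- real n * (l \<bullet> j))) * 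
      poly_exp 1 ((- real n) * (x \<bullet> j) + real n * (u \<bullet> j)) = 0"
    using j(2) by (auto simp: poly_exp_def mult_less_cancel_left) 
  then show ?thesis using j(1) by (auto simp: box_bump_def prod_zero_iff)
qed

lemma box_bump_tendsto: "(\<lambda>n. box_bump l u n x) \<longlonglongrightarrow> indicator (box l u) x"
proof (cases "x \<in> box l u")
  case False
  then show ?thesis by (simp add: box_bump_eq_0)
next
  case True
  have *: "(\<lambda>n. poly_exp 1 (real n * d)) \<longlonglongrightarrow> 1" if "d > 0" for d
  proof -
    have "(\<lambda>n. exp (- (1 / (real n * d)))) \<longlonglongrightarrow> exp (- 0)"
    proof (intro tendsto_intros)
      have "(\<lambda>n. (1 / d) * (1 / real n)) \<longlonglongrightarrow> (1 / d) * 0"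
        by (intro tendsto_intros lim_1_over_n)
      then show "(\<lambda>n. 1 / (real n * d)) \<longlonglongrightarrow> 0" by (simp add: field_simps)
    qed
    then have "(\<lambda>n. exp (- (1 / (real n * d)))) \<longlonglongrightarrow> 1" by simp
    then show ?thesis
      by (rule Lim_transform_eventually)
         (use that in \<open>auto simp: poly_exp_def intro!: eventually_mono[OF eventually_gt_at_top[of 0]]\<close>)
  qed
  have "(\<lambda>n. box_bump l u n x) \<longlonglongrightarrow> (\<Prod>j\<in>(Basis::'a set). 1 * 1)"
    unfolding box_bump_def
  proof (intro tendsto_prod tendsto_mult)
    fix j :: 'a assume "j \<in> Basis"
    then have "l \<bullet> j < x \<bullet> j" "x \<bullet> j < u \<bullet> j" using True by (auto simp: mem_box)
    then show "(\<lambda>n. poly_exp 1 (real n * (x \<bullet> j) + (- real n * (l \<bullet> j)))) \<longlonglongrightarrow> 1"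
       "(\<lambda>n. poly_exp 1 ((- real n) * (x \<bullet> j) + real n * (u \<bullet> j))) \<longlonglongrightarrow> 1"
      using *[of "x \<bullet> j - l \<bullet> j"] *[of "u \<bullet> j - x \<bullet> j"] by (simp_all add: algebra_simps)
  qed
  then show ?thesis using True by simp
qed

lemma box_bump_test_function:
  assumes "0 \<notin> cbox l u"
  shows "test_function_punctured (box_bump l u n)"
proof -
  have sub: "closure {x. box_bump l u n x \<noteq> 0} \<subseteq> cbox l u"
    by (rule closure_minimal) (use box_bump_eq_0 box_subset_cbox in \<open>blast+\<close>)
  have "C_diff k (box_bump l u n)" for k
    unfolding box_bump_def
    by (intro C_diff_prod C_diff_mult C_diff_poly_exp[where m=1, unfolded mult_1_left])
  moreover have "compact (closure {x. box_bump l u n x \<noteq> 0})"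
    using sub by (meson compact_cbox bounded_subset bounded_cbox closed_closure compact_eq_bounded_closed)
  ultimately show ?thesis
    using sub assms unfolding test_function_punctured_def by blast
qed

section \<open>The fundamental lemma on the punctured space\<close>

text \<open>
  Closed spherical shells. Those with \<open>m > 0\<close> are compact and avoid the origin, and every compact set
  that avoids the origin lies in one of them; so local integrability on the punctured space amounts to
  integrability on all shells with \<open>m > 0\<close>.
\<close>

definition shell :: "real \<Rightarrow> real \<Rightarrow> 'a::euclidean_space set" where
  "shell m M = {x. m \<le> norm x \<and> norm x \<le> M}"

lemma shell_measurable [measurable]: "shell m M \<in> sets borel"
  unfolding shell_def by measurable

lemma compact_shell: "compact (shell m M :: 'a::euclidean_space set)"
proof -
  have "closed (shell m M :: 'a set)" unfolding shell_def
    by (intro closed_Collect_conj closed_Collect_le continuous_intros)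
  moreover have "shell m M \<subseteq> (cball 0 M :: 'a set)" by (auto simp: shell_def)
  ultimately show ?thesis
    by (meson bounded_cball bounded_subset compact_eq_bounded_closed)
qed

lemma compact_subset_shell:
  fixes K :: "'a::euclidean_space set"
  assumes "compact K" "0 \<notin> K"
  obtains m M where "m > 0" "K \<subseteq> shell m M"
proof -
  obtain M where M: "\<And>x. x \<in> K \<Longrightarrow> norm x \<le> M"
    using compact_imp_bounded[OF assms(1)] bounded_iff by metis
  have "open (- K)" using assms(1) by (simp add: compact_imp_closed open_Compl)
  then obtain m where m: "m > 0" "ball 0 m \<subseteq> - K"
    using assms(2) openE[of "- K" 0] by auto
  have "m \<le> norm x" if "x \<in> K" for x
    using m(2) that by (force simp: subset_iff dist_norm)
  then show ?thesis using that[of m M] m M by (auto simp: shell_def)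
qed

text \<open>
  Lebesgue measurable functions are replaced by Borel measurable ones, because only for the latter is
  \<open>(t, x) \<mapsto> u (t x)\<close> measurable on the product space, as Fubini's theorem requires.
\<close>

lemma L1loc_punctured_borel_version:
  fixes u :: "'a::euclidean_space \<Rightarrow> real"
  assumes "u \<in> L1loc_punctured"
  obtains u' where "u \<in> borel_measurable lebesgue" "u' \<in> borel_measurable borel" "AE x in lborel. u x = u' x"
    "\<And>m M. m > 0 \<Longrightarrow> set_integrable lborel (shell m M) u'"
proof -
  have int: "set_integrable lebesgue (shell m M) u" if "m > 0" for m M
    using assms that compact_shell[of m M] by (auto simp: L1loc_punctured_def shell_def)
  define v where "v n x = indicator (shell (1 / real (Suc n)) (real (Suc n))) x * u x" for n x
  have lim: "(\<lambda>n. v n x) \<longlonglongrightarrow> indicator (- {0}) x * u x" for x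
  proof (cases "x = 0")
    case True
    then show ?thesis by (simp add: v_def shell_def indicator_def)
  next
    case False
    obtain n1 where n1: "inverse (real (Suc n1)) < norm x" using False reals_Archimedean[of "norm x"] by auto
    obtain n2 where n2: "norm x \<le> real n2" using real_arch_simple by blast
    have "v n x = indicator (- {0}) x * u x" if "n \<ge> max n1 n2" for n
    proof -
      have "1 / real (Suc n) \<le> inverse (real (Suc n1))" using that by (simp add: field_simps)
      then show ?thesis using n1 n2 that False by (auto simp: v_def shell_def)
    qed
    then show ?thesis by (intro tendsto_eventually) (metis (mono_tags) eventually_at_top_linorder)
  qed
  have vm: "v n \<in> borel_measurable lebesgue" for n
    using borel_measurable_integrable[OF int[of "1 / real (Suc n)" "real (Suc n)", unfolded set_integrable_def]]
    by (simp add: v_def[abs_def])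
  have um: "(\<lambda>x. indicator (- {0}) x * u x) \<in> borel_measurable lebesgue"
    by (rule borel_measurable_LIMSEQ_real[of _ v]) (use lim vm in auto)
  have "(\<lambda>x. indicator (- {0}) x * u x + indicator {0} x * u 0) \<in> borel_measurable lebesgue"
    by (rule borel_measurable_add[OF um measurable_completion]) measurable
  also have "(\<lambda>x. indicator (- {0}) x * u x + indicator {0} x * u 0) = u"
    by (auto simp: indicator_def)
  finally have u_meas: "u \<in> borel_measurable lebesgue" .
  from um obtain u' where u': "u' \<in> borel_measurable lborel" "AE x in lborel. indicator (- {0}) x * u x = u' x"
    using completion_ex_borel_measurable_real by blast
  have "AE x in lborel. x \<noteq> (0::'a)" by (rule AE_lborel_singleton)
  with u'(2) have ae: "AE x in lborel. u x = u' x" by eventually_elim auto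
  have "set_integrable lborel (shell m M) u'" if "m > 0" for m M
  proof -
    have "integrable lebesgue (\<lambda>x. indicator (shell m M) x *\<^sub>R u' x)"
      by (rule integrable_cong_AE_imp[OF int[OF that, unfolded set_integrable_def]])
         (use u'(1) ae in \<open>auto intro!: measurable_completion AE_completion\<close>)
    then show ?thesis using u'(1) by (simp add: set_integrable_def integrable_completion)
  qed
  then show ?thesis using that u_meas u' ae by auto
qed

lemma set_integral_box_eq_0_imp_AE:
  fixes h :: "'a::euclidean_space \<Rightarrow> real"
  assumes h: "integrable lborel h"
    and 0: "\<And>l u. (\<integral>x. indicator (box l u) x * h x \<partial>lborel) = 0"
  shows "AE x in lborel. h x = 0"
proof -
  have hm[measurable]: "h \<in> borel_measurable borel" using h by auto
  have int: "integrable lborel (\<lambda>x. indicator A x * h x)" if "A \<in> sets borel" for A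
    using integrable_mult_indicator[OF _ h, of A] that by simp
  have tot: "(\<integral>x. h x \<partial>lborel) = 0"
  proof -
    have "(\<lambda>n. \<integral>x. indicator (box (- real n *\<^sub>R One) (real n *\<^sub>R One)) x * h x \<partial>lborel) \<longlonglongrightarrow> (\<integral>x. h x \<partial>lborel)"
    proof (rule integral_dominated_convergence[where w="\<lambda>x. \<bar>h x\<bar>"])
      show "AE x in lborel. (\<lambda>n. indicator (box (- real n *\<^sub>R One) (real n *\<^sub>R One)) x * h x) \<longlonglongrightarrow> h x"
      proof (rule AE_I2)
        fix x :: 'a
        obtain n where n: "norm x < real n" using reals_Archimedean2 by blast
        have "x \<in> box (- real k *\<^sub>R One) (real k *\<^sub>R One)" if "k \<ge> n" for k
        proof -
          have "\<bar>x \<bullet> i\<bar> < real k" if "i \<in> Basis" for i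
            using Basis_le_norm[OF that, of x] n \<open>k \<ge> n\<close> by linarith
          then show ?thesis by (simp add: mem_box) (meson abs_less_iff minus_less_iff)
        qed
        then show "(\<lambda>n. indicator (box (- real n *\<^sub>R One) (real n *\<^sub>R One)) x * h x) \<longlonglongrightarrow> h x"
          by (intro tendsto_eventually eventually_at_top_linorderI[of n]) auto
      qed
    qed (use h in \<open>auto simp: indicator_def\<close>)
    then have "(\<lambda>n::nat. 0) \<longlonglongrightarrow> (\<integral>x. h x \<partial>lborel)" by (simp add: 0)
    then show ?thesis using LIMSEQ_unique tendsto_const by metis
  qed
  \<comment> \<open>The open boxes generate the Borel sets and are closed under intersection.\<close>
  have *: "(\<integral>x. indicator A x * h x \<partial>lborel) = 0" if "A \<in> sets borel" for A
  proof -
    have "Int_stable (range (\<lambda>(a, b). box a b :: 'a set))"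
      by (auto simp: Int_stable_def box_Int_box)
    moreover have "range (\<lambda>(a, b). box a b) \<subseteq> Pow (UNIV :: 'a set)" by auto
    moreover have "A \<in> sigma_sets UNIV (range (\<lambda>(a, b). box a b))"
      using that unfolding borel_eq_box by simp
    ultimately show ?thesis
    proof (induction rule: sigma_sets_induct_disjoint)
      case (basic A)
      then show ?case using 0 by auto
    next
      case empty
      then show ?case by simp
    next
      case (compl A)
      have A: "A \<in> sets borel" using compl.hyps by (simp add: borel_eq_box)
      have "(\<integral>x. indicator (UNIV - A) x * h x \<partial>lborel) = (\<integral>x. h x - indicator A x * h x \<partial>lborel)"
        by (intro Bochner_Integration.integral_cong) (auto simp: indicator_def)
      then show ?case using compl.IH tot h int[OF A] by simp
    next
      case (union F)
      have F: "F i \<in> sets borel" for i using union.hyps by (auto simp: borel_eq_box)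
      have "(\<integral>x\<in>(\<Union>i. F i). h x \<partial>lborel) = (\<Sum>i. (\<integral>x\<in>F i. h x \<partial>lborel))"
        using union.hyps(1) F int[of "\<Union>i. F i"]
        by (intro lebesgue_integral_countable_add) (auto simp: set_integrable_def disjoint_family_on_def)
      then show ?case using union.IH by (simp add: set_lebesgue_integral_def)
    qed
  qed
  then show ?thesis
    by (intro density_unique_real[of lborel h "\<lambda>_. 0"]) (use h in \<open>auto simp: set_lebesgue_integral_def\<close>)
qed

lemma punctured_fundamental_lemma:
  fixes h :: "'a::euclidean_space \<Rightarrow> real"
  assumes h[measurable]: "h \<in> borel_measurable borel"
    and int: "\<And>m M. m > 0 \<Longrightarrow> set_integrable lborel (shell m M) h"
    and 0: "\<And>\<theta>. test_function_punctured \<theta> \<Longrightarrow> (\<integral>x. h x * \<theta> x \<partial>lborel) = 0"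
  shows "AE x in lborel. h x = 0"
proof -
  have intc: "integrable lborel (\<lambda>x. indicator (cbox l u) x * h x)" if l: "0 \<notin> cbox l u" for l u
  proof -
    obtain m M where "m > 0" "cbox l u \<subseteq> shell m M"
      using compact_subset_shell[OF compact_cbox l] .
    then have "set_integrable lborel (cbox l u) h"
      by (intro set_integrable_subset[OF int]) auto
    then show ?thesis by (simp add: set_integrable_def)
  qed
  have box0: "(\<integral>x. indicator (box l u) x * h x \<partial>lborel) = 0" if l: "0 \<notin> cbox l u" for l u
  proof -
    have bm[measurable]: "box_bump l u n \<in> borel_measurable borel" for n
      using box_bump_test_function[OF l, of n]
      by (intro borel_measurable_continuous_onI C_diff_continuous[of 0]) (auto simp: test_function_punctured_def)
    have "(\<lambda>n. \<integral>x. h x * box_bump l u n x \<partial>lborel) \<longlonglongrightarrow> (\<integral>x. indicator (box l u) x * h x \<partial>lborel)"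
    proof (rule integral_dominated_convergence[where w="\<lambda>x. \<bar>indicator (cbox l u) x * h x\<bar>"])
      show "AE x in lborel. (\<lambda>n. h x * box_bump l u n x) \<longlonglongrightarrow> indicator (box l u) x * h x"
        using tendsto_mult_left[OF box_bump_tendsto[of l u]] by (auto simp: mult.commute)
      show "AE x in lborel. norm (h x * box_bump l u n x) \<le> \<bar>indicator (cbox l u) x * h x\<bar>" for n
      proof (rule AE_I2)
        fix x show "norm (h x * box_bump l u n x) \<le> \<bar>indicator (cbox l u) x * h x\<bar>"
        proof (cases "x \<in> box l u")
          case True
          then have "x \<in> cbox l u" using box_subset_cbox by blast
          then show ?thesis using box_bump_le_1[of l u n x]
            by (simp add: abs_mult mult_left_le)
        qed (simp add: box_bump_eq_0)
      qed
    qed (use intc[OF l] in auto)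
    then have "(\<lambda>n::nat. 0) \<longlonglongrightarrow> (\<integral>x. indicator (box l u) x * h x \<partial>lborel)"
      using 0 box_bump_test_function[OF l] by simp
    then show ?thesis using LIMSEQ_unique tendsto_const by metis
  qed
  have ae: "AE x in lborel. x \<in> cbox l u \<longrightarrow> h x = 0" if l: "0 \<notin> cbox l u" for l u
  proof -
    have null: "AE x in lborel. x \<in> cbox l u \<longrightarrow> x \<in> box l u"
    proof -
      have "AE x in lebesgue. x \<notin> cbox l u - box l u"
        using negligible_frontier_interval[of l u] by (intro AE_not_in) (simp add: negligible_iff_null_sets)
      then have "AE x in lebesgue. x \<in> cbox l u \<longrightarrow> x \<in> box l u" by eventually_elim auto
      then show ?thesis by (simp only: AE_completion_iff)
    qed
    have "AE x in lborel. indicator (cbox l u) x * h x = 0"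
    proof (rule set_integral_box_eq_0_imp_AE[OF intc[OF l]])
      fix l' u' :: 'a
      obtain l'' u'' where b: "box l' u' \<inter> box l u = box l'' u''" "cbox l' u' \<inter> cbox l u = cbox l'' u''"
        unfolding Int_interval box_Int_box by blast
      have "0 \<notin> cbox l'' u''" using l b(2) by auto
      have "(\<integral>x. indicator (box l' u') x * (indicator (cbox l u) x * h x) \<partial>lborel)
          = (\<integral>x. indicator (box l'' u'') x * h x \<partial>lborel)"
      proof (intro integral_cong_AE)
        show "AE x in lborel. indicator (box l' u') x * (indicator (cbox l u) x * h x)
            = indicator (box l'' u'') x * h x"
          using null
        proof eventually_elim
          case (elim x)
          have "x \<in> box l'' u'' \<longleftrightarrow> x \<in> box l' u' \<and> x \<in> box l u" using b(1) by blast
          moreover have "x \<in> box l u \<Longrightarrow> x \<in> cbox l u" using box_subset_cbox by blast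
          ultimately show ?case using elim by (auto simp: indicator_def)
        qed
      qed auto
      also have "\<dots> = 0" by (rule box0) fact
      finally show "(\<integral>x. indicator (box l' u') x * (indicator (cbox l u) x * h x) \<partial>lborel) = 0" .
    qed
    then show ?thesis by eventually_elim (auto simp: indicator_def)
  qed
  \<comment> \<open>Countably many closed boxes that avoid the origin cover the punctured space.\<close>
  obtain \<D> where D: "countable \<D>" "\<D> \<subseteq> Pow (- {0::'a})" "\<And>X. X \<in> \<D> \<Longrightarrow> \<exists>a b. X = cbox a b" "\<Union>\<D> = - {0}"
    using open_countable_Union_open_cbox[of "- {0::'a}"] by auto
  have "AE x in lborel. \<forall>X\<in>\<D>. x \<in> X \<longrightarrow> h x = 0"
    unfolding AE_ball_countable[OF D(1)]
  proof
    fix X assume X: "X \<in> \<D>"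
    then obtain l u where "X = cbox l u" using D(3) by blast
    then show "AE x in lborel. x \<in> X \<longrightarrow> h x = 0" using ae[of l u] X D(2) by auto
  qed
  moreover have "AE x in lborel. x \<noteq> (0::'a)" by (rule AE_lborel_singleton)
  ultimately show ?thesis
    by eventually_elim (use D(4) in blast)
qed

section \<open>The divergence of a radial test field\<close>

lemma test_functionE:
  fixes \<theta> :: "'a::euclidean_space \<Rightarrow> real"
  assumes "test_function_punctured \<theta>"
  obtains m M B where "m > 0" "B \<ge> 0" "\<And>x. (\<theta> has_derivative frechet_derivative \<theta> (at x)) (at x)"
    "continuous_on UNIV \<theta>"
    "\<And>i. i \<in> Basis \<Longrightarrow> continuous_on UNIV (\<lambda>x. frechet_derivative \<theta> (at x) i)"
    "\<And>x. x \<notin> shell m M \<Longrightarrow> \<theta> x = 0"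
    "\<And>x. x \<notin> shell m M \<Longrightarrow> frechet_derivative \<theta> (at x) = (\<lambda>_. 0)"
    "\<And>x. \<bar>\<theta> x\<bar> \<le> B"
    "\<And>x i. i \<in> Basis \<Longrightarrow> \<bar>frechet_derivative \<theta> (at x) i\<bar> \<le> B"
proof -
  define K where "K = closure {x. \<theta> x \<noteq> 0}"
  have K: "compact K" "0 \<notin> K" and C: "C_diff (Suc 0) \<theta>"
    using assms by (simp_all add: test_function_punctured_def K_def del: C_diff.simps)
  obtain m M where mM: "m > 0" "K \<subseteq> shell m M" using compact_subset_shell[OF K] .
  have d: "(\<theta> has_derivative frechet_derivative \<theta> (at x)) (at x)" for x
    using C by (simp add: frechet_derivative_works)
  have c: "continuous_on UNIV \<theta>" using C by (rule C_diff_continuous)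
  have ci: "continuous_on UNIV (\<lambda>x. frechet_derivative \<theta> (at x) i)" if i: "i \<in> Basis" for i
    using C i by simp
  have z: "\<theta> x = 0" if x: "x \<notin> K" for x using x closure_subset[of "{x. \<theta> x \<noteq> 0}"] unfolding K_def by blast
  have dz: "frechet_derivative \<theta> (at x) = (\<lambda>_. 0)" if x: "x \<notin> K" for x
  proof -
    have "(\<theta> has_derivative (\<lambda>_. 0)) (at x)"
      by (rule has_derivative_transform_within_open[of "\<lambda>_. 0" _ _ _ "- K"]) (use x z K(1) compact_imp_closed in \<open>auto simp: open_Compl\<close>)
    then show ?thesis by (metis frechet_derivative_at)
  qed
  have bdd: "\<exists>B. \<forall>x. \<bar>f x\<bar> \<le> B" if f: "continuous_on UNIV f" "\<And>x. x \<notin> K \<Longrightarrow> f x = 0" for f :: "'a \<Rightarrow> real"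
  proof -
    have "compact (f ` K)"
      by (rule compact_continuous_image[OF continuous_on_subset[OF f(1)] K(1)]) simp
    then obtain B where B: "\<forall>y\<in>f ` K. norm y \<le> B"
      using compact_imp_bounded[of "f ` K"] unfolding bounded_iff by auto
    have "\<bar>f x\<bar> \<le> max B 0" for x
    proof (cases "x \<in> K")
      case True
      then have "norm (f x) \<le> B" using B by blast
      then show ?thesis by simp
    qed (simp add: f(2))
    then show ?thesis by blast
  qed
  obtain B0 where B0: "\<And>x. \<bar>\<theta> x\<bar> \<le> B0" using bdd[OF c z] by blast
  have "\<forall>i\<in>Basis. \<exists>B. \<forall>x. \<bar>frechet_derivative \<theta> (at x) i\<bar> \<le> B"
    by (intro ballI bdd ci) (simp_all add: dz)
  then have "\<exists>Bi. \<forall>i\<in>Basis. \<forall>x. \<bar>frechet_derivative \<theta> (at x) i\<bar> \<le> Bi i" by (rule bchoice)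
  then obtain Bi where Bi: "\<And>i x. i \<in> Basis \<Longrightarrow> \<bar>frechet_derivative \<theta> (at x) i\<bar> \<le> Bi i" by blast
  define B where "B = B0 + (\<Sum>i\<in>Basis. \<bar>Bi i\<bar>)"
  have "B0 \<ge> 0" using B0[of 0] by linarith
  have Bi': "Bi i \<le> B" if i: "i \<in> Basis" for i
    using member_le_sum[of i Basis "\<lambda>i. \<bar>Bi i\<bar>"] i \<open>B0 \<ge> 0\<close> by (auto simp: B_def)
  have "B \<ge> 0" "B0 \<le> B" using \<open>B0 \<ge> 0\<close> by (auto simp: B_def sum_nonneg)
  show ?thesis
  proof (rule that[of m B M, OF mM(1) \<open>B \<ge> 0\<close> d c ci])
    show "\<bar>\<theta> x\<bar> \<le> B" for x using B0[of x] \<open>B0 \<le> B\<close> by linarith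
    show "\<bar>frechet_derivative \<theta> (at x) i\<bar> \<le> B" if i: "i \<in> Basis" for x i
      using Bi[OF i, of x] Bi'[OF i] by linarith
  qed (use z dz mM(2) in blast)+
qed

text \<open>The partial derivative in direction \<open>i\<close> of the \<open>i\<close>-th component of the field \<open>\<theta> x/|x|\<close>.\<close>

abbreviation radial_partial :: "('a::euclidean_space \<Rightarrow> real) \<Rightarrow> 'a \<Rightarrow> 'a \<Rightarrow> real" where
  "radial_partial \<theta> i x \<equiv> frechet_derivative (\<lambda>y. \<theta> y * ((y \<bullet> i) / norm y)) (at x) i"

text \<open>The divergence of \<open>\<theta> x/|x|\<close>; see \<open>sum_radial_partial\<close>.\<close>

definition radial_div :: "('a::euclidean_space \<Rightarrow> real) \<Rightarrow> 'a \<Rightarrow> real" where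
  "radial_div \<theta> x = ((real DIM('a) - 1) * \<theta> x + frechet_derivative \<theta> (at x) x) / norm x"

text \<open>
  At the origin the formula is right as well: \<open>\<theta>\<close> vanishes near it, and so does every term, by the
  convention \<open>t / 0 = 0\<close>.
\<close>

lemma has_derivative_radial_component:
  fixes \<theta> :: "'a::euclidean_space \<Rightarrow> real"
  assumes "test_function_punctured \<theta>"
  shows "((\<lambda>y. \<theta> y * ((y \<bullet> i) / norm y)) has_derivative
     (\<lambda>h. frechet_derivative \<theta> (at x) h * ((x \<bullet> i) / norm x) +
        \<theta> x * ((h \<bullet> i) / norm x - (x \<bullet> i) * (x \<bullet> h) / norm x ^ 3))) (at x)"
proof -
  obtain m M B where \<theta>: "m > 0" "\<And>x. (\<theta> has_derivative frechet_derivative \<theta> (at x)) (at x)"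
    "\<And>x. x \<notin> shell m M \<Longrightarrow> \<theta> x = 0"
    "\<And>x. x \<notin> shell m M \<Longrightarrow> frechet_derivative \<theta> (at x) = (\<lambda>_. 0)"
    using test_functionE[OF assms] by metis
  show ?thesis
  proof (cases "x = 0")
    case True
    have "((\<lambda>y. \<theta> y * ((y \<bullet> i) / norm y)) has_derivative (\<lambda>h. 0)) (at x)"
      by (rule has_derivative_transform_within_open[of "\<lambda>_. 0" _ _ _ "ball 0 m"])
         (use True \<theta>(1,3) in \<open>auto simp: shell_def\<close>)
    then show ?thesis using True \<theta>(1,3) by (simp add: shell_def)
  next
    case False
    have n: "((\<lambda>y. (y \<bullet> i) / norm y) has_derivative (\<lambda>h. (h \<bullet> i) / norm x - (x \<bullet> i) * (x \<bullet> h) / norm x ^ 3)) (at x)"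
      by (rule has_derivative_eq_rhs[OF has_derivative_divide[OF _ has_derivative_norm[OF False]]])
         (use False in \<open>auto intro!: derivative_eq_intros simp: sgn_div_norm field_simps power3_eq_cube inner_commute\<close>)
    from has_derivative_mult[OF \<theta>(2)[of x] n] show ?thesis
      by (rule has_derivative_eq_rhs) (auto simp: algebra_simps)
  qed
qed

lemma sum_radial_partial:
  fixes \<theta> :: "'a::euclidean_space \<Rightarrow> real"
  assumes "test_function_punctured \<theta>"
  shows "(\<Sum>i\<in>Basis. radial_partial \<theta> i x) = radial_div \<theta> x"
proof (cases "x = 0")
  case True
  have "\<theta> 0 = 0" by (rule test_functionE[OF assms]) (simp add: shell_def)
  then show ?thesis using True
    unfolding frechet_derivative_eq[OF has_derivative_radial_component[OF assms]]
    by (simp add: radial_div_def)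
next
  case False
  have lin: "linear (frechet_derivative \<theta> (at x))"
    by (rule test_functionE[OF assms]) (use has_derivative_linear in blast)
  have "(\<Sum>i\<in>Basis. radial_partial \<theta> i x)
     = (\<Sum>i\<in>Basis. frechet_derivative \<theta> (at x) i * (x \<bullet> i)) / norm x
       + \<theta> x * (real DIM('a) / norm x - (\<Sum>i\<in>Basis. (x \<bullet> i) * (x \<bullet> i)) / norm x ^ 3)"
    unfolding frechet_derivative_eq[OF has_derivative_radial_component[OF assms]]
    by (simp add: sum.distrib sum_subtractf sum_distrib_left[symmetric] sum_divide_distrib)
  also have "(\<Sum>i\<in>Basis. (x \<bullet> i) * (x \<bullet> i)) = norm x ^ 2"
    by (metis euclidean_inner power2_norm_eq_inner)
  also have "(\<Sum>i\<in>Basis. frechet_derivative \<theta> (at x) i * (x \<bullet> i)) = frechet_derivative \<theta> (at x) x"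
    using linear_sum[OF lin, of "\<lambda>i. (x \<bullet> i) *\<^sub>R i" Basis] 
    by (simp add: linear_cmul[OF lin] euclidean_representation mult.commute)
  finally show ?thesis using False
    by (simp add: radial_div_def field_simps power2_eq_square power3_eq_cube)
qed

section \<open>Dilations of Lebesgue measure\<close>

lemma nn_integral_dilate:
  fixes f :: "'a::euclidean_space \<Rightarrow> ennreal"
  assumes [measurable]: "f \<in> borel_measurable borel" and c: "c \<noteq> 0"
  shows "(\<integral>\<^sup>+x. f x \<partial>lborel) = ennreal (\<bar>c\<bar> ^ DIM('a)) * (\<integral>\<^sup>+x. f (c *\<^sub>R x) \<partial>lborel)"
  by (subst lborel_affine[OF c, of 0])
     (simp add: nn_integral_density nn_integral_distr nn_integral_cmult)

lemma integrable_dilate: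
  fixes f :: "'a::euclidean_space \<Rightarrow> real"
  assumes f: "integrable lborel f" and c: "c \<noteq> 0"
  shows "integrable lborel (\<lambda>x. f (c *\<^sub>R x))"
proof -
  have [measurable]: "f \<in> borel_measurable borel" using f by auto
  have "ennreal (\<bar>c\<bar> ^ DIM('a)) * (\<integral>\<^sup>+x. ennreal (norm (f (c *\<^sub>R x))) \<partial>lborel) < \<infinity>"
    using f c by (subst nn_integral_dilate[symmetric]) (auto simp: integrable_iff_bounded)
  then show ?thesis
    using c by (auto simp: integrable_iff_bounded ennreal_mult_less_top)
qed

lemma integral_dilate:
  fixes f :: "'a::euclidean_space \<Rightarrow> real"
  assumes f[measurable]: "f \<in> borel_measurable borel" and c: "c \<noteq> 0"
  shows "(\<integral>x. f x \<partial>lborel) = \<bar>c\<bar> ^ DIM('a) * (\<integral>x. f (c *\<^sub>R x) \<partial>lborel)"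
  by (subst lborel_affine[OF c, of 0])
     (simp add: integral_density integral_distr)

section \<open>The weak radial derivative as a divergence identity\<close>

lemma set_integrable_mult_bounded:
  fixes u f :: "'a::euclidean_space \<Rightarrow> real"
  assumes [measurable]: "u \<in> borel_measurable borel" "f \<in> borel_measurable borel"
    and u: "set_integrable lborel (shell m M) u"
    and "\<And>x. x \<in> shell m M \<Longrightarrow> \<bar>f x\<bar> \<le> C" "\<And>x. x \<notin> shell m M \<Longrightarrow> f x = 0"
  shows "integrable lborel (\<lambda>x. u x * f x)"
proof (rule Bochner_Integration.integrable_bound)
  show "integrable lborel (\<lambda>x. C * (indicator (shell m M) x *\<^sub>R u x))"
    using u by (simp add: set_integrable_def)
  show "AE x in lborel. norm (u x * f x) \<le> norm (C * (indicator (shell m M) x *\<^sub>R u x))"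
  proof (rule AE_I2)
    fix x show "norm (u x * f x) \<le> norm (C * (indicator (shell m M) x *\<^sub>R u x))"
    proof (cases "x \<in> shell m M")
      case True
      then have "\<bar>u x\<bar> * \<bar>f x\<bar> \<le> \<bar>u x\<bar> * \<bar>C\<bar>"
        using assms(4)[OF True] by (intro mult_left_mono) auto
      then show ?thesis using True by (simp add: abs_mult mult.commute)
    qed (simp add: assms(5))
  qed
qed auto

lemma frechet_derivative_self_eq_sum:
  fixes \<theta> :: "'a::euclidean_space \<Rightarrow> real"
  assumes "test_function_punctured \<theta>"
  shows "frechet_derivative \<theta> (at x) y = (\<Sum>i\<in>Basis. (y \<bullet> i) * frechet_derivative \<theta> (at x) i)"
proof -
  have lin: "linear (frechet_derivative \<theta> (at x))"
    by (rule test_functionE[OF assms]) (use has_derivative_linear in blast)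
  show ?thesis
    using linear_sum[OF lin, of "\<lambda>i. (y \<bullet> i) *\<^sub>R i" Basis]
    by (simp add: linear_cmul[OF lin] euclidean_representation)
qed

lemma test_function_measurable [measurable_dest]:
  "test_function_punctured \<theta> \<Longrightarrow> \<theta> \<in> borel_measurable borel"
  by (erule test_functionE) (auto intro: borel_measurable_continuous_onI)

lemma frechet_derivative_test_measurable:
  assumes "test_function_punctured \<theta>" "i \<in> Basis"
  shows "(\<lambda>x. frechet_derivative \<theta> (at x) i) \<in> borel_measurable borel"
  by (rule test_functionE[OF assms(1)]) (auto intro: borel_measurable_continuous_onI assms(2))

lemma radial_numerator_continuous:
  fixes \<theta> :: "'a::euclidean_space \<Rightarrow> real"
  assumes "test_function_punctured \<theta>"
  shows "continuous_on UNIV (\<lambda>x. (real DIM('a) - 1) * \<theta> x + frechet_derivative \<theta> (at x) x)"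
proof -
  have "frechet_derivative \<theta> (at x) x = (\<Sum>i\<in>Basis. (x \<bullet> i) * frechet_derivative \<theta> (at x) i)" for x
    by (rule frechet_derivative_self_eq_sum[OF assms])
  then have "(\<lambda>x. (real DIM('a) - 1) * \<theta> x + frechet_derivative \<theta> (at x) x) =
     (\<lambda>x. (real DIM('a) - 1) * \<theta> x + (\<Sum>i\<in>Basis. (x \<bullet> i) * frechet_derivative \<theta> (at x) i))"
    by (simp add: fun_eq_iff)
  moreover have "continuous_on UNIV \<dots>"
    by (rule test_functionE[OF assms]) (intro continuous_intros; blast)
  ultimately show ?thesis by (simp only:)
qed

lemma radial_div_measurable:
  fixes \<theta> :: "'a::euclidean_space \<Rightarrow> real"
  assumes "test_function_punctured \<theta>"
  shows "radial_div \<theta> \<in> borel_measurable borel"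
  unfolding radial_div_def[abs_def]
  by (intro borel_measurable_divide borel_measurable_continuous_onI radial_numerator_continuous assms
      continuous_intros)

lemma radial_partial_eq:
  assumes "test_function_punctured \<theta>"
  shows "radial_partial \<theta> i x = frechet_derivative \<theta> (at x) i * ((x \<bullet> i) / norm x) +
        \<theta> x * ((i \<bullet> i) / norm x - (x \<bullet> i) * (x \<bullet> i) / norm x ^ 3)"
  by (rule frechet_derivative_eq[OF has_derivative_radial_component[OF assms]])

lemma radial_partial_measurable:
  assumes "test_function_punctured \<theta>" "i \<in> Basis"
  shows "radial_partial \<theta> i \<in> borel_measurable borel"
  using test_function_measurable[OF assms(1)] frechet_derivative_test_measurable[OF assms]
  unfolding radial_partial_eq[OF assms(1)] by measurable

lemma radial_partial_bounds:
  fixes \<theta> :: "'a::euclidean_space \<Rightarrow> real"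
  assumes \<theta>: "test_function_punctured \<theta>"
  obtains m M C where "m > 0" "\<And>x. x \<notin> shell m M \<Longrightarrow> \<theta> x = 0" "\<And>x. \<bar>\<theta> x\<bar> \<le> C"
    "\<And>i x. i \<in> Basis \<Longrightarrow> x \<notin> shell m M \<Longrightarrow> radial_partial \<theta> i x = 0"
    "\<And>i x. i \<in> Basis \<Longrightarrow> \<bar>radial_partial \<theta> i x\<bar> \<le> C"
proof -
  obtain m M B where mMB: "m > 0" "B \<ge> 0"
    and "\<And>x. (\<theta> has_derivative frechet_derivative \<theta> (at x)) (at x)"
    "continuous_on UNIV \<theta>"
    "\<And>i. i \<in> Basis \<Longrightarrow> continuous_on UNIV (\<lambda>x. frechet_derivative \<theta> (at x) i)"
    and \<theta>0: "\<And>x. x \<notin> shell m M \<Longrightarrow> \<theta> x = 0" "\<And>x. x \<notin> shell m M \<Longrightarrow> frechet_derivative \<theta> (at x) = (\<lambda>_. 0)"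
    and \<theta>B: "\<And>x. \<bar>\<theta> x\<bar> \<le> B" "\<And>x i. i \<in> Basis \<Longrightarrow> \<bar>frechet_derivative \<theta> (at x) i\<bar> \<le> B"
    by (rule test_functionE[OF \<theta>]) (rule that; assumption)
  define C where "C = B + B * (2 / m)"
  have D0: "radial_partial \<theta> i x = 0" if "x \<notin> shell m M" for i x
    unfolding radial_partial_eq[OF \<theta>] using \<theta>0[OF that] by simp
  have DC: "\<bar>radial_partial \<theta> i x\<bar> \<le> C" if i: "i \<in> Basis" for i x
  proof (cases "x \<in> shell m M")
    case True
    then have x: "m \<le> norm x" "norm x > 0" using mMB(1) by (auto simp: shell_def)
    have xi: "\<bar>x \<bullet> i\<bar> \<le> norm x" using Basis_le_norm[OF i] .
    have "\<bar>frechet_derivative \<theta> (at x) i * ((x \<bullet> i) / norm x)\<bar> \<le> B * 1"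
      unfolding abs_mult using xi x by (intro mult_mono \<theta>B(2) i) (auto simp: abs_divide mMB(2))
    moreover have "\<bar>\<theta> x * ((i \<bullet> i) / norm x - (x \<bullet> i) * (x \<bullet> i) / norm x ^ 3)\<bar> \<le> B * (2 / m)"
      unfolding abs_mult
    proof (intro mult_mono \<theta>B(1))
      have "\<bar>(x \<bullet> i) * (x \<bullet> i)\<bar> \<le> norm x * norm x" unfolding abs_mult using xi by (intro mult_mono) auto
      then have "\<bar>(x \<bullet> i) * (x \<bullet> i) / norm x ^ 3\<bar> \<le> 1 / norm x"
        using x by (simp add: field_simps power3_eq_cube)
      moreover have "1 / norm x \<le> 1 / m" using x mMB(1) by (simp add: frac_le)
      moreover have "\<bar>(i \<bullet> i) / norm x\<bar> = 1 / norm x" using i by (simp add: inner_same_Basis)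
      moreover have "2 / m = 1 / m + 1 / m" by simp
      ultimately show "\<bar>(i \<bullet> i) / norm x - (x \<bullet> i) * (x \<bullet> i) / norm x ^ 3\<bar> \<le> 2 / m"
        using abs_triangle_ineq4[of "(i \<bullet> i) / norm x" "(x \<bullet> i) * (x \<bullet> i) / norm x ^ 3"] by linarith
    qed (use mMB in auto)
    ultimately show ?thesis unfolding radial_partial_eq[OF \<theta>] C_def by linarith
  next
    case False
    then show ?thesis unfolding D0[OF False] using mMB(1,2) by (simp add: C_def)
  qed
  have \<theta>C: "\<bar>\<theta> x\<bar> \<le> C" for x using \<theta>B(1)[of x] mMB(1,2) by (simp add: C_def add_increasing2)
  show ?thesis by (rule that[OF mMB(1) \<theta>0(1) \<theta>C D0 DC])
qed

lemma radial_div_bounds: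
  fixes \<theta> :: "'a::euclidean_space \<Rightarrow> real"
  assumes \<theta>: "test_function_punctured \<theta>"
  obtains m M C where "m > 0" "\<And>x. x \<notin> shell m M \<Longrightarrow> \<theta> x = 0" "\<And>x. \<bar>\<theta> x\<bar> \<le> C"
    "\<And>x. x \<notin> shell m M \<Longrightarrow> radial_div \<theta> x = 0" "\<And>x. \<bar>radial_div \<theta> x\<bar> \<le> C"
proof -
  obtain m M C where m: "m > 0" and th: "\<And>x. x \<notin> shell m M \<Longrightarrow> \<theta> x = 0" "\<And>x. \<bar>\<theta> x\<bar> \<le> C"
    and D: "\<And>i x. i \<in> Basis \<Longrightarrow> x \<notin> shell m M \<Longrightarrow> radial_partial \<theta> i x = 0"
    "\<And>i x. i \<in> Basis \<Longrightarrow> \<bar>radial_partial \<theta> i x\<bar> \<le> C"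
    by (rule radial_partial_bounds[OF \<theta>]) (rule that; assumption)
  have C: "C \<ge> 0" using th(2)[of 0] by linarith
  define C' where "C' = C + real DIM('a) * C"
  have "\<bar>radial_div \<theta> x\<bar> \<le> (\<Sum>i\<in>(Basis::'a set). C)" for x
    unfolding sum_radial_partial[OF \<theta>, symmetric]
    by (rule order_trans[OF sum_abs sum_mono]) (rule D(2))
  then have rdC: "\<bar>radial_div \<theta> x\<bar> \<le> C'" for x
    using C by (simp add: C'_def add_increasing)
  have thC: "\<bar>\<theta> x\<bar> \<le> C'" for x
    using th(2)[of x] C by (simp add: C'_def add_increasing2)
  have rd0: "radial_div \<theta> x = 0" if x: "x \<notin> shell m M" for x
    unfolding sum_radial_partial[OF \<theta>, symmetric] by (rule sum.neutral) (rule ballI, rule D(1)[OF _ x])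
  show ?thesis by (rule that[OF m th(1) thC rd0 rdC])
qed

text \<open>
  The defining identity of the weak radial derivative, with the sum over the coordinates contracted to the
  divergence of \<open>\<theta> x/|x|\<close> and all functions replaced by Borel versions.
\<close>

lemma has_radial_derivD:
  fixes u g u' g' :: "'a::euclidean_space \<Rightarrow> real"
  assumes d: "has_radial_deriv u g"
    and [measurable]: "u' \<in> borel_measurable borel" "g' \<in> borel_measurable borel"
    and ae: "AE x in lborel. u x = u' x" "AE x in lborel. g x = g' x"
    and int: "\<And>m M. m > 0 \<Longrightarrow> set_integrable lborel (shell m M) u'"
    and \<theta>: "test_function_punctured \<theta>"
  shows "- (\<integral>x. u' x * radial_div \<theta> x \<partial>lborel) = (\<integral>x. g' x * \<theta> x \<partial>lborel)"
proof -
  obtain m M C where mMC: "m > 0" and "\<And>x. x \<notin> shell m M \<Longrightarrow> \<theta> x = 0" "\<And>x. \<bar>\<theta> x\<bar> \<le> C"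
    and D: "\<And>i x. i \<in> Basis \<Longrightarrow> x \<notin> shell m M \<Longrightarrow> radial_partial \<theta> i x = 0"
      "\<And>i x. i \<in> Basis \<Longrightarrow> \<bar>radial_partial \<theta> i x\<bar> \<le> C"
    by (rule radial_partial_bounds[OF \<theta>]) (rule that; assumption)
  note Dm = radial_partial_measurable[OF \<theta>]
  let ?D = "radial_partial \<theta>"
  have [measurable]: "\<theta> \<in> borel_measurable borel" using test_function_measurable[OF \<theta>] .
  have loc: "u \<in> L1loc_punctured" "g \<in> L1loc_punctured" using d by (auto simp: has_radial_deriv_def)
  have meas: "u \<in> borel_measurable lebesgue" "g \<in> borel_measurable lebesgue"
    by (rule L1loc_punctured_borel_version[OF loc(1)], assumption)
       (rule L1loc_punctured_borel_version[OF loc(2)], assumption)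
  have eq: "(\<integral>x. v x * f x \<partial>lebesgue) = (\<integral>x. v' x * f x \<partial>lborel)"
    if v: "v \<in> borel_measurable lebesgue" "AE x in lborel. v x = v' x"
      and [measurable]: "v' \<in> borel_measurable borel" "f \<in> borel_measurable borel" for f v v' :: "'a \<Rightarrow> real"
  proof -
    have f: "f \<in> borel_measurable lebesgue" "v' \<in> borel_measurable lebesgue"
      by (auto intro!: measurable_completion)
    have "(\<integral>x. v x * f x \<partial>lebesgue) = (\<integral>x. v' x * f x \<partial>lebesgue)"
      by (rule integral_cong_AE) (use v(1) f AE_completion[OF v(2)] in auto)
    then show ?thesis by (simp add: integral_completion)
  qed
  have "- (\<integral>x. u' x * radial_div \<theta> x \<partial>lborel) = - (\<integral>x. (\<Sum>i\<in>Basis. u' x * ?D i x) \<partial>lborel)"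
    unfolding sum_radial_partial[OF \<theta>, symmetric] by (simp only: sum_distrib_left)
  also have "\<dots> = - (\<Sum>i\<in>Basis. (\<integral>x. u' x * ?D i x \<partial>lborel))"
    by (subst Bochner_Integration.integral_sum)
       (use D Dm in \<open>auto intro!: set_integrable_mult_bounded[OF _ _ int[OF mMC(1), of M]]\<close>)
  also have "\<dots> = radial_deriv_distr u \<theta>"
    unfolding radial_deriv_distr_def sum_negf[symmetric]
    by (intro sum.cong refl arg_cong[where f=uminus] eq[symmetric] meas ae Dm) auto
  also have "\<dots> = (\<integral>x. g x * \<theta> x \<partial>lebesgue)"
    using d \<theta> by (auto simp: has_radial_deriv_def)
  also have "\<dots> = (\<integral>x. g' x * \<theta> x \<partial>lborel)"
    by (intro eq meas ae) auto
  finally show ?thesis .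
qed

section \<open>Increments under the dilation by two\<close>

lemma integrable_tensor:
  fixes f :: "real \<Rightarrow> real" and g :: "'a::euclidean_space \<Rightarrow> real"
  assumes f: "integrable lborel f" and g: "integrable lborel g"
  shows "integrable (lborel \<Otimes>\<^sub>M lborel) (\<lambda>(t, x). f t * g x)"
proof -
  have [measurable]: "f \<in> borel_measurable borel" "g \<in> borel_measurable borel" using f g by auto
  have "(\<integral>\<^sup>+p. ennreal (norm (case p of (t, x) \<Rightarrow> f t * g x)) \<partial>(lborel \<Otimes>\<^sub>M lborel))
      = (\<integral>\<^sup>+t. \<integral>\<^sup>+x. ennreal (norm (f t)) * ennreal (norm (g x)) \<partial>lborel \<partial>lborel)"
    by (subst lborel.nn_integral_fst[symmetric]) (simp_all add: abs_mult ennreal_mult)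
  also have "\<dots> = (\<integral>\<^sup>+t. ennreal (norm (f t)) \<partial>lborel) * (\<integral>\<^sup>+x. ennreal (norm (g x)) \<partial>lborel)"
    by (simp add: nn_integral_cmult nn_integral_multc)
  also have "\<dots> < \<infinity>" using f g by (simp add: integrable_iff_bounded ennreal_mult_less_top)
  finally show ?thesis by (intro integrableI_bounded) auto
qed

lemma integrable_shell_dilate:
  fixes g :: "'a::euclidean_space \<Rightarrow> real"
  assumes [measurable]: "g \<in> borel_measurable borel"
    and int: "set_integrable lborel (shell m (2 * M)) g" and m: "m > 0"
  shows "integrable (lborel \<Otimes>\<^sub>M lborel)
    (\<lambda>(t::real, x). indicator {1..2} t * (indicator (shell m M) x * g (t *\<^sub>R x)))"
proof (rule integrableI_bounded)
  let ?G = "\<integral>\<^sup>+x. ennreal (norm (indicator (shell m (2 * M)) x * g x)) \<partial>lborel"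
  have inner: "(\<integral>\<^sup>+x. ennreal (norm (indicator {1..2} t * (indicator (shell m M) x * g (t *\<^sub>R x)))) \<partial>lborel)
        \<le> indicator {1..2} t * ?G" for t :: real
  proof (cases "t \<in> {1..2}")
    case True
    have "(\<integral>\<^sup>+x. ennreal (norm (indicator {1..2} t * (indicator (shell m M) x * g (t *\<^sub>R x)))) \<partial>lborel)
        \<le> (\<integral>\<^sup>+x. ennreal (norm (indicator (shell m (2 * M)) (t *\<^sub>R x) * g (t *\<^sub>R x))) \<partial>lborel)"
    proof (intro nn_integral_mono ennreal_leI)
      fix x :: 'a
      have "m \<le> t * norm x" "t * norm x \<le> 2 * M" if "x \<in> shell m M"
      proof -
        have x: "m \<le> norm x" "norm x \<le> M" using that by (auto simp: shell_def)
        show "m \<le> t * norm x" using mult_right_mono[of 1 t "norm x"] x True by auto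
        show "t * norm x \<le> 2 * M" using True x by (intro mult_mono) auto
      qed
      then show "norm (indicator {1..2} t * (indicator (shell m M) x * g (t *\<^sub>R x)))
          \<le> norm (indicator (shell m (2 * M)) (t *\<^sub>R x) * g (t *\<^sub>R x))"
        using True by (auto simp: indicator_def shell_def)
    qed
    also have "\<dots> \<le> ennreal (\<bar>t\<bar> ^ DIM('a)) * \<dots>"
      using True one_le_power[of t "DIM('a)"] mult_right_mono[of 1 "ennreal (\<bar>t\<bar> ^ DIM('a))"] by auto
    also have "\<dots> = ?G"
      by (rule nn_integral_dilate[symmetric]) (use True in auto)
    finally show ?thesis using True by simp
  qed simp
  have "(\<integral>\<^sup>+p. ennreal (norm (case p of (t::real, x) \<Rightarrow> indicator {1..2} t * (indicator (shell m M) x * g (t *\<^sub>R x)))) \<partial>(lborel \<Otimes>\<^sub>M lborel))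
     = (\<integral>\<^sup>+t. \<integral>\<^sup>+x. ennreal (norm (indicator {1..2} t * (indicator (shell m M) x * g (t *\<^sub>R x)))) \<partial>lborel \<partial>lborel)"
    by (subst lborel.nn_integral_fst[symmetric]) simp_all
  also have "\<dots> \<le> (\<integral>\<^sup>+t. indicator {1..2::real} t * ?G \<partial>lborel)"
    by (rule nn_integral_mono) (rule inner)
  also have "\<dots> = ?G" by (simp add: nn_integral_multc)
  also have "\<dots> < \<infinity>" using int by (simp add: set_integrable_def integrable_iff_bounded)
  finally show "(\<integral>\<^sup>+p. ennreal (norm (case p of (t::real, x) \<Rightarrow> indicator {1..2} t * (indicator (shell m M) x * g (t *\<^sub>R x)))) \<partial>(lborel \<Otimes>\<^sub>M lborel)) < \<infinity>" .
qed measurable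

lemma radial_div_dilate:
  fixes \<theta> :: "'a::euclidean_space \<Rightarrow> real"
  assumes \<theta>: "test_function_punctured \<theta>" and c: "c > 0"
  shows "radial_div (\<lambda>x. \<theta> (c *\<^sub>R x)) x = c * radial_div \<theta> (c *\<^sub>R x)"
proof -
  have d: "(\<theta> has_derivative frechet_derivative \<theta> (at x)) (at x)" for x
    by (rule test_functionE[OF \<theta>]) blast
  have "((\<lambda>x. \<theta> (c *\<^sub>R x)) has_derivative (\<lambda>h. frechet_derivative \<theta> (at (c *\<^sub>R x)) (c *\<^sub>R h))) (at x)"
    by (rule has_derivative_compose[of "\<lambda>x. c *\<^sub>R x" "\<lambda>h. c *\<^sub>R h" x UNIV, OF _ d])
       (auto intro!: derivative_eq_intros)
  from frechet_derivative_eq[OF this] show ?thesis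
    using c by (simp add: radial_div_def)
qed

text \<open>
  The antiderivative is \<open>t\<^bsup>1-N\<^esup> \<theta> (y/t) / |y|\<close>: the divergence of the field \<open>\<theta> x/|x|\<close> describes how the
  dilated densities \<open>t\<^bsup>-N\<^esup> \<phi> (y/t)\<close> with \<open>\<phi> = \<theta>/|x|\<close> change with \<open>t\<close>.
\<close>

lemma integral_radial_div:
  fixes \<theta> :: "'a::euclidean_space \<Rightarrow> real"
  assumes \<theta>: "test_function_punctured \<theta>" and y: "y \<noteq> 0"
  shows "(\<integral>t. (- radial_div \<theta> (inverse t *\<^sub>R y) / t ^ (DIM('a) + 1)) * indicator {1..2} t \<partial>lborel)
     = (\<theta> (inverse 2 *\<^sub>R y) * (2 / 2 ^ DIM('a)) - \<theta> y) / norm y"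
proof -
  let ?N = "DIM('a)"
  define num where "num z = (real ?N - 1) * \<theta> z + frechet_derivative \<theta> (at z) z" for z
  have d: "(\<theta> has_derivative frechet_derivative \<theta> (at x)) (at x)" for x
    by (rule test_functionE[OF \<theta>]) blast
  have num_cont: "isCont num z" for z
    using radial_numerator_continuous[OF \<theta>] unfolding num_def by (simp add: continuous_on_eq_continuous_at)
  have "((\<lambda>t. \<theta> (inverse t *\<^sub>R y) * (t / t ^ ?N) / norm y) has_real_derivative
      (- radial_div \<theta> (inverse t *\<^sub>R y) / t ^ (?N + 1))) (at t)" if t: "1 \<le> t" for t
  proof -
    let ?z = "inverse t *\<^sub>R y"
    have lin: "linear (frechet_derivative \<theta> (at ?z))" using has_derivative_linear[OF d] .
    have a: "((\<lambda>t. \<theta> (inverse t *\<^sub>R y)) has_derivative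
        (\<lambda>h. frechet_derivative \<theta> (at ?z) ((- (inverse t * h * inverse t)) *\<^sub>R y))) (at t)"
      by (rule has_derivative_compose[of "\<lambda>t. inverse t *\<^sub>R y" _ t UNIV, OF _ d])
         (use t in \<open>auto intro!: derivative_eq_intros\<close>)
    have b: "frechet_derivative \<theta> (at ?z) ((- (inverse t * h * inverse t)) *\<^sub>R y)
       = - (frechet_derivative \<theta> (at ?z) ?z / t) * h" for h
      using linear_cmul[OF lin, of "- (inverse t * h)" "?z"] by (simp add: field_simps)
    have 1: "((\<lambda>t. \<theta> (inverse t *\<^sub>R y)) has_real_derivative - (frechet_derivative \<theta> (at ?z) ?z / t)) (at t)"
      unfolding has_field_derivative_def by (rule has_derivative_eq_rhs[OF a]) (simp only: fun_eq_iff b, simp)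
    have 2: "((\<lambda>t. t / t ^ ?N) has_real_derivative ((1 - real ?N) / t ^ ?N)) (at t)"
    proof -
      obtain k where k: "?N = Suc k" using DIM_positive[where 'a='a] gr0_implies_Suc by blast
      have "((\<lambda>t. t / t ^ Suc k) has_real_derivative
          (1 * t ^ Suc k - t * (real (Suc k) * t ^ k)) / (t ^ Suc k * t ^ Suc k)) (at t)"
        using t DERIV_pow[of "Suc k" t] by (intro DERIV_divide DERIV_ident) auto
      moreover have "(1 * t ^ Suc k - t * (real (Suc k) * t ^ k)) / (t ^ Suc k * t ^ Suc k)
          = (1 - real (Suc k)) / t ^ Suc k"
        using t by (simp add: field_simps)
      ultimately show ?thesis unfolding k by simp
    qed
    have "((\<lambda>t. \<theta> (inverse t *\<^sub>R y) * (t / t ^ ?N) / norm y) has_real_derivative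
       (- (frechet_derivative \<theta> (at ?z) ?z / t) * (t / t ^ ?N) + ((1 - real ?N) / t ^ ?N) * \<theta> ?z) / norm y) (at t)"
      by (intro DERIV_cdivide DERIV_mult 1 2)
    moreover have "(- (frechet_derivative \<theta> (at ?z) ?z / t) * (t / t ^ ?N) + ((1 - real ?N) / t ^ ?N) * \<theta> ?z) / norm y
       = - radial_div \<theta> ?z / t ^ (?N + 1)"
      using t y by (simp add: radial_div_def field_simps)
    ultimately show ?thesis by simp
  qed
  note deriv = this
  have cont: "isCont (\<lambda>t. - radial_div \<theta> (inverse t *\<^sub>R y) / t ^ (?N + 1)) t" if "1 \<le> t" for t
    unfolding radial_div_def num_def[symmetric] using that y
    by (intro continuous_intros isCont_o2[OF _ num_cont]) auto
  have "(\<integral>t. (- radial_div \<theta> (inverse t *\<^sub>R y) / t ^ (?N + 1)) * indicator {1..2} t \<partial>lborel)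
    = \<theta> (inverse 2 *\<^sub>R y) * (2 / 2 ^ ?N) / norm y - \<theta> (inverse 1 *\<^sub>R y) * (1 / 1 ^ ?N) / norm y"
    by (rule integral_FTC_Icc_real) (simp_all only: deriv cont one_le_numeral)
  then show ?thesis by (simp add: diff_divide_distrib)
qed

text \<open>The mean of \<open>g\<close> over the segment from \<open>x\<close> to \<open>2 x\<close>.\<close>

definition radial_mean :: "('a::euclidean_space \<Rightarrow> real) \<Rightarrow> 'a \<Rightarrow> real" where
  "radial_mean g x = (\<integral>t. indicator {1..2} t * g (t *\<^sub>R x) \<partial>lborel)"

lemma radial_mean_measurable [measurable]:
  assumes [measurable]: "g \<in> borel_measurable borel"
  shows "radial_mean g \<in> borel_measurable borel"
  unfolding radial_mean_def[abs_def] by measurable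

text \<open>
  A function whose weak radial derivative is locally integrable off the origin satisfies the fundamental theorem of calculus on
  almost every segment from \<open>x\<close> to \<open>2 x\<close>. The proof never restricts \<open>u\<close> to a ray: both sides are integrated
  against \<open>\<theta>\<close>, and the order of integration in \<open>t\<close> and \<open>x\<close> is exchanged on either side of the weak identity.
\<close>

lemma dyadic_difference_eq_radial_mean:
  fixes u g :: "'a::euclidean_space \<Rightarrow> real"
  assumes u[measurable]: "u \<in> borel_measurable borel" and g[measurable]: "g \<in> borel_measurable borel"
    and u_int: "\<And>m M. m > 0 \<Longrightarrow> set_integrable lborel (shell m M) u"
    and g_int: "\<And>m M. m > 0 \<Longrightarrow> set_integrable lborel (shell m M) g"
    and weak: "\<And>\<theta>. test_function_punctured \<theta> \<Longrightarrow>
       - (\<integral>x. u x * radial_div \<theta> x \<partial>lborel) = (\<integral>x. g x * \<theta> x \<partial>lborel)"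
  shows "AE x in lborel. u (2 *\<^sub>R x) - u x = norm x * radial_mean g x"
proof -
  define h where "h x = (u (2 *\<^sub>R x) - u x) / norm x - radial_mean g x" for x
  have [measurable]: "h \<in> borel_measurable borel" unfolding h_def[abs_def] by measurable
  have u2_int: "set_integrable lborel (shell m M) (\<lambda>x. u (2 *\<^sub>R x))" if "m > 0" for m M
    using integrable_dilate[OF u_int[of "2 * m" "2 * M", unfolded set_integrable_def], of 2] that
    by (simp add: set_integrable_def shell_def indicator_def)
  have mean_int: "set_integrable lborel (shell m M) (radial_mean g)" if m: "m > 0" for m M
  proof -
    have "integrable lborel (\<lambda>x. \<integral>t. indicator {1..2} t * (indicator (shell m M) x * g (t *\<^sub>R x)) \<partial>lborel)"
      by (rule lborel_pair.integrable_snd) (use integrable_shell_dilate[OF g g_int[OF m] m] in simp)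
    also have "(\<lambda>x. \<integral>t. indicator {1..2} t * (indicator (shell m M) x * g (t *\<^sub>R x)) \<partial>lborel)
       = (\<lambda>x. indicator (shell m M) x *\<^sub>R radial_mean g x)"
      by (auto simp: radial_mean_def indicator_def fun_eq_iff)
    finally show ?thesis by (simp add: set_integrable_def)
  qed
  have quot: "integrable lborel (\<lambda>x. v x * (f x / norm x))"
    if [measurable]: "v \<in> borel_measurable borel" "f \<in> borel_measurable borel"
      and v: "set_integrable lborel (shell m M) v" and m: "m > 0"
      and f: "\<And>x. \<bar>f x\<bar> \<le> C" "\<And>x. x \<notin> shell m M \<Longrightarrow> f x = 0"
    for v f :: "'a \<Rightarrow> real" and m M C
  proof (rule set_integrable_mult_bounded[OF _ _ v])
    show "\<bar>f x / norm x\<bar> \<le> C / m" if "x \<in> shell m M" for x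
      using that m f(1)[of x] by (auto simp: shell_def abs_divide intro!: frac_le)
  qed (use f(2) in auto)
  have h_int: "set_integrable lborel (shell m M) h" if m: "m > 0" for m M
  proof -
    have "integrable lborel (\<lambda>x. u (2 *\<^sub>R x) * (indicator (shell m M) x / norm x))"
      by (rule quot[OF _ _ u2_int[OF m] m, where C=1]) (auto simp: indicator_def)
    moreover have "integrable lborel (\<lambda>x. u x * (indicator (shell m M) x / norm x))"
      by (rule quot[OF _ _ u_int[OF m] m, where C=1]) (auto simp: indicator_def)
    ultimately have "integrable lborel (\<lambda>x. (u (2 *\<^sub>R x) * (indicator (shell m M) x / norm x)
        - u x * (indicator (shell m M) x / norm x)) - indicator (shell m M) x *\<^sub>R radial_mean g x)"
      using mean_int[OF m, of M] unfolding set_integrable_def by (intro Bochner_Integration.integrable_diff)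
    then show ?thesis unfolding set_integrable_def h_def
      by (rule back_subst[of "integrable lborel"]) (auto simp: fun_eq_iff indicator_def diff_divide_distrib)
  qed
  have "AE x in lborel. h x = 0"
  proof (rule punctured_fundamental_lemma[OF _ h_int])
    fix \<theta> :: "'a \<Rightarrow> real" assume \<theta>: "test_function_punctured \<theta>"
    note [measurable] = test_function_measurable[OF \<theta>] radial_div_measurable[OF \<theta>]
    let ?N = "DIM('a)"
    obtain m M C where m: "m > 0" and th: "\<And>x. x \<notin> shell m M \<Longrightarrow> \<theta> x = 0" "\<And>x. \<bar>\<theta> x\<bar> \<le> C"
      and rd: "\<And>x. x \<notin> shell m M \<Longrightarrow> radial_div \<theta> x = 0" "\<And>x. \<bar>radial_div \<theta> x\<bar> \<le> C"
      by (rule radial_div_bounds[OF \<theta>]) (rule that; assumption)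
    have C: "C \<ge> 0" using th(2)[of 0] by linarith
    define k where "k t y = - radial_div \<theta> (inverse t *\<^sub>R y) / t ^ (?N + 1)" for t y
    have k_meas[measurable]: "(\<lambda>p. k (fst p) (snd p)) \<in> borel_measurable (borel \<Otimes>\<^sub>M borel)"
      unfolding k_def by measurable
    have F1: "integrable (lborel \<Otimes>\<^sub>M lborel) (\<lambda>(t::real, x). indicator {1..2} t * (g (t *\<^sub>R x) * \<theta> x))"
    proof (rule Bochner_Integration.integrable_bound)
      show "integrable (lborel \<Otimes>\<^sub>M lborel)
          (\<lambda>p. C * (case p of (t::real, x) \<Rightarrow> indicator {1..2} t * (indicator (shell m M) x * g (t *\<^sub>R x))))"
        using integrable_shell_dilate[OF g g_int[OF m] m] by simp
      show "AE p in lborel \<Otimes>\<^sub>M lborel. norm (case p of (t::real, x) \<Rightarrow> indicator {1..2} t * (g (t *\<^sub>R x) * \<theta> x))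
         \<le> norm (C * (case p of (t::real, x) \<Rightarrow> indicator {1..2} t * (indicator (shell m M) x * g (t *\<^sub>R x))))"
      proof (rule AE_I2, clarify)
        fix t :: real and x :: 'a
        show "norm (indicator {1..2} t * (g (t *\<^sub>R x) * \<theta> x))
          \<le> norm (C * (indicator {1..2} t * (indicator (shell m M) x * g (t *\<^sub>R x))))"
          using th(1)[of x] th(2)[of x] C
          by (cases "x \<in> shell m M") (auto simp: indicator_def abs_mult mult.commute intro!: mult_right_mono)
      qed
    qed simp
    have F2: "integrable (lborel \<Otimes>\<^sub>M lborel) (\<lambda>(t::real, y). indicator {1..2} t * (u y * k t y))"
    proof (rule Bochner_Integration.integrable_bound)
      have "integrable lborel (\<lambda>y. indicator (shell m (2 * M)) y * u y)"
        using u_int[OF m, of "2 * M"] by (simp add: set_integrable_def)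
      from integrable_tensor[OF _ this, of "\<lambda>t. C * indicator {1..2} t"]
      show "integrable (lborel \<Otimes>\<^sub>M lborel)
          (\<lambda>(t::real, y). C * indicator {1..2} t * (indicator (shell m (2 * M)) y * u y))"
        by simp
      show "AE p in lborel \<Otimes>\<^sub>M lborel. norm (case p of (t::real, y) \<Rightarrow> indicator {1..2} t * (u y * k t y))
         \<le> norm (case p of (t::real, y) \<Rightarrow> C * indicator {1..2} t * (indicator (shell m (2 * M)) y * u y))"
      proof (rule AE_I2, clarify)
        fix t :: real and y :: 'a
        show "norm (indicator {1..2} t * (u y * k t y)) \<le> norm (C * indicator {1..2} t * (indicator (shell m (2 * M)) y * u y))"
        proof (cases "t \<in> {1..2}")
          case True
          have "k t y = 0" if "y \<notin> shell m (2 * M)"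
          proof -
            have "inverse t *\<^sub>R y \<notin> shell m M"
            proof
              assume "inverse t *\<^sub>R y \<in> shell m M"
              then have *: "m \<le> norm y / t" "norm y / t \<le> M" using True by (auto simp: shell_def divide_inverse mult.commute)
              have "t * m \<le> norm y" "norm y \<le> t * M" using * True by (auto simp: field_simps)
              moreover have "m \<le> t * m" using True m by auto
              moreover have "M \<ge> 0" using * m by linarith
              then have "t * M \<le> 2 * M" using True by (intro mult_right_mono) auto
              ultimately show False using that by (auto simp: shell_def)
            qed
            then show ?thesis by (simp add: k_def rd(1))
          qed
          moreover have "\<bar>k t y\<bar> \<le> C"
          proof -
            have "\<bar>k t y\<bar> \<le> C / 1" unfolding k_def abs_divide abs_minus_cancel
              using True one_le_power[of t "?N + 1"] rd(2) C by (intro frac_le) auto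
            then show ?thesis by simp
          qed
          ultimately show ?thesis using True C
            by (auto simp: indicator_def abs_mult mult.commute[of C] intro!: mult_left_mono)
        qed simp
      qed
    qed (simp add: split_beta')
    \<comment> \<open>The weak identity for the test function \<open>\<theta> (x/t)\<close>, rescaled to \<open>\<theta>\<close>.\<close>
    have slice: "(\<integral>x. g (t *\<^sub>R x) * \<theta> x \<partial>lborel) = (\<integral>y. u y * k t y \<partial>lborel)" if t: "t \<in> {1..2}" for t
    proof -
      have t0: "t > 0" using t by auto
      let ?\<theta> = "\<lambda>x. \<theta> (inverse t *\<^sub>R x)"
      have "t ^ ?N * (\<integral>x. g (t *\<^sub>R x) * \<theta> x \<partial>lborel) = (\<integral>x. g x * ?\<theta> x \<partial>lborel)"
        using integral_dilate[of "\<lambda>x. g x * ?\<theta> x" t] t0 by simp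
      also have "\<dots> = - (\<integral>x. u x * radial_div ?\<theta> x \<partial>lborel)"
        using weak[OF test_function_dilate[OF \<theta>, of "inverse t"]] t0 by simp
      also have "\<dots> = (\<integral>x. t ^ ?N * (u x * k t x) \<partial>lborel)"
        unfolding integral_minus[symmetric] using t0
        by (intro Bochner_Integration.integral_cong refl) (simp add: radial_div_dilate[OF \<theta>] k_def field_simps)
      finally show ?thesis using t0 by simp
    qed
    have "(\<integral>x. radial_mean g x * \<theta> x \<partial>lborel) = (\<integral>x. \<integral>t. indicator {1..2} t * (g (t *\<^sub>R x) * \<theta> x) \<partial>lborel \<partial>lborel)"
      unfolding radial_mean_def integral_mult_left_zero[symmetric] by (simp add: mult.assoc)
    also have "\<dots> = (\<integral>t. \<integral>x. indicator {1..2} t * (g (t *\<^sub>R x) * \<theta> x) \<partial>lborel \<partial>lborel)"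
      by (rule lborel_pair.Fubini_integral[OF F1])
    also have "\<dots> = (\<integral>t. \<integral>y. indicator {1..2} t * (u y * k t y) \<partial>lborel \<partial>lborel)"
    proof (rule Bochner_Integration.integral_cong[OF refl])
      fix t :: real
      show "(\<integral>x. indicator {1..2} t * (g (t *\<^sub>R x) * \<theta> x) \<partial>lborel) = (\<integral>y. indicator {1..2} t * (u y * k t y) \<partial>lborel)"
        using slice[of t] by (cases "t \<in> {1..2}") simp_all
    qed
    also have "\<dots> = (\<integral>y. \<integral>t. indicator {1..2} t * (u y * k t y) \<partial>lborel \<partial>lborel)"
      by (rule lborel_pair.Fubini_integral[OF F2, symmetric])
    also have "\<dots> = (\<integral>y. u y * (\<integral>t. k t y * indicator {1..2} t \<partial>lborel) \<partial>lborel)"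
      by (simp add: mult_ac flip: integral_mult_right_zero)
    also have "\<dots> = (\<integral>y. u y * (\<theta> (inverse 2 *\<^sub>R y) * (2 / 2 ^ ?N) / norm y) - u y * (\<theta> y / norm y) \<partial>lborel)"
    proof (intro integral_cong_AE)
      show "AE y in lborel. u y * (\<integral>t. k t y * indicator {1..2} t \<partial>lborel)
          = u y * (\<theta> (inverse 2 *\<^sub>R y) * (2 / 2 ^ ?N) / norm y) - u y * (\<theta> y / norm y)"
        using AE_lborel_singleton[of "0::'a"]
      proof eventually_elim
        case (elim y)
        show ?case unfolding k_def integral_radial_div[OF \<theta> elim]
          by (simp only: right_diff_distrib diff_divide_distrib)
      qed
    qed (unfold k_def, measurable)
    also have "\<dots> = (\<integral>y. u y * (\<theta> (inverse 2 *\<^sub>R y) * (2 / 2 ^ ?N) / norm y) \<partial>lborel) - (\<integral>y. u y * (\<theta> y / norm y) \<partial>lborel)"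
    proof (rule Bochner_Integration.integral_diff)
      have m2: "2 * m > 0" using m by simp
      show "integrable lborel (\<lambda>y. u y * (\<theta> (inverse 2 *\<^sub>R y) * (2 / 2 ^ ?N) / norm y))"
      proof (rule quot[OF _ _ u_int[OF m2, of "2 * M"] m2])
        show "\<bar>\<theta> (inverse 2 *\<^sub>R y) * (2 / 2 ^ ?N)\<bar> \<le> C * (2 / 2 ^ ?N)" for y
          unfolding abs_mult using th(2) by (intro mult_mono) (auto simp: C)
        show "\<theta> (inverse 2 *\<^sub>R y) * (2 / 2 ^ ?N) = 0" if "y \<notin> shell (2 * m) (2 * M)" for y
          using that th(1)[of "inverse 2 *\<^sub>R y"] by (auto simp: shell_def)
      qed measurable
      show "integrable lborel (\<lambda>y. u y * (\<theta> y / norm y))"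
        by (rule quot[OF _ _ u_int[OF m] m th(2) th(1)]) measurable
    qed
    also have "(\<integral>y. u y * (\<theta> (inverse 2 *\<^sub>R y) * (2 / 2 ^ ?N) / norm y) \<partial>lborel)
        = (\<integral>x. u (2 *\<^sub>R x) * (\<theta> x / norm x) \<partial>lborel)"
      by (subst integral_dilate[where c=2]) (auto simp flip: integral_mult_right_zero simp: field_simps)
    finally have mean: "(\<integral>x. radial_mean g x * \<theta> x \<partial>lborel)
       = (\<integral>x. u (2 *\<^sub>R x) * (\<theta> x / norm x) \<partial>lborel) - (\<integral>y. u y * (\<theta> y / norm y) \<partial>lborel)" .
    have i: "integrable lborel (\<lambda>x. u (2 *\<^sub>R x) * (\<theta> x / norm x))"
       "integrable lborel (\<lambda>x. u x * (\<theta> x / norm x))"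
       "integrable lborel (\<lambda>x. radial_mean g x * \<theta> x)"
      by (rule quot[OF _ _ u2_int[OF m] m th(2) th(1)] quot[OF _ _ u_int[OF m] m th(2) th(1)]
            set_integrable_mult_bounded[OF _ _ mean_int[OF m] th(2) th(1)]; measurable)+
    have "(\<integral>x. h x * \<theta> x \<partial>lborel) = (\<integral>x. (u (2 *\<^sub>R x) * (\<theta> x / norm x) - u x * (\<theta> x / norm x)) - radial_mean g x * \<theta> x \<partial>lborel)"
      by (intro Bochner_Integration.integral_cong refl) (simp add: h_def algebra_simps diff_divide_distrib)
    also have "\<dots> = 0" using i mean by simp
    finally show "(\<integral>x. h x * \<theta> x \<partial>lborel) = 0" .
  qed measurable
  moreover have "AE x in lborel. x \<noteq> (0::'a)" by (rule AE_lborel_singleton)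
  ultimately show ?thesis by eventually_elim (simp add: h_def field_simps)
qed

section \<open>The dilation invariant measure\<close>

text \<open>
  The measure \<open>|x|\<^bsup>-N\<^esup> dx\<close>. The origin carries no mass, in accordance with \<open>0 powr d = 0\<close>.
\<close>

definition dilation_measure :: "'a::euclidean_space measure" where
  "dilation_measure = density lborel (\<lambda>x. ennreal (norm x powr - real DIM('a)))"

lemma sets_dilation_measure [simp, measurable_cong]: "sets dilation_measure = sets borel"
  by (simp add: dilation_measure_def)

lemma space_dilation_measure [simp]: "space dilation_measure = UNIV"
  by (simp add: dilation_measure_def)

lemma nn_integral_dilation_measure:
  fixes f :: "'a::euclidean_space \<Rightarrow> ennreal"
  assumes [measurable]: "f \<in> borel_measurable borel"
  shows "(\<integral>\<^sup>+x. f x \<partial>dilation_measure) = (\<integral>\<^sup>+x. ennreal (norm x powr - real DIM('a)) * f x \<partial>lborel)"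
  unfolding dilation_measure_def by (rule nn_integral_density) measurable

lemma AE_dilation_measure:
  fixes P :: "'a::euclidean_space \<Rightarrow> bool"
  assumes "AE x in lborel. P x"
  shows "AE x in dilation_measure. P x"
proof -
  have "AE x in lborel. 0 < ennreal (norm x powr - real DIM('a)) \<longrightarrow> P x"
    using assms by eventually_elim simp
  then show ?thesis unfolding dilation_measure_def by (subst AE_density) auto
qed

lemma AE_dilation_measure_nonzero: "AE x in dilation_measure. x \<noteq> (0::'a::euclidean_space)"
  by (rule AE_dilation_measure) (rule AE_lborel_singleton)

lemma sigma_finite_dilation_measure: "sigma_finite_measure (dilation_measure :: 'a::euclidean_space measure)"
  unfolding dilation_measure_def by (subst sigma_finite_measure.sigma_finite_iff_density_finite[OF sigma_finite_lborel]) auto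

lemma dilation_measure_Fubini:
  fixes f :: "'a::euclidean_space \<Rightarrow> real \<Rightarrow> ennreal"
  assumes "(\<lambda>(x, t). f x t) \<in> borel_measurable (borel \<Otimes>\<^sub>M borel)"
  shows "(\<integral>\<^sup>+x. \<integral>\<^sup>+t. f x t \<partial>lborel \<partial>dilation_measure) = (\<integral>\<^sup>+t. \<integral>\<^sup>+x. f x t \<partial>dilation_measure \<partial>lborel)"
proof -
  interpret pair_sigma_finite "dilation_measure :: 'a measure" "lborel :: real measure"
    using sigma_finite_dilation_measure by (simp add: pair_sigma_finite_def sigma_finite_lborel)
  have "case_prod f \<in> borel_measurable ((dilation_measure :: 'a measure) \<Otimes>\<^sub>M (lborel :: real measure))"
    using assms by (simp add: measurable_cong_sets[OF sets_pair_measure_cong[OF sets_dilation_measure sets_lborel] refl])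
  from Fubini'[OF this] show ?thesis by simp
qed

lemma nn_integral_dilation_measure_dilate:
  fixes f :: "'a::euclidean_space \<Rightarrow> ennreal"
  assumes [measurable]: "f \<in> borel_measurable borel" and c: "c > 0"
  shows "(\<integral>\<^sup>+x. f (c *\<^sub>R x) \<partial>dilation_measure) = (\<integral>\<^sup>+x. f x \<partial>dilation_measure)"
proof -
  have eq: "ennreal (c ^ DIM('a)) * (ennreal (norm (c *\<^sub>R x) powr - real DIM('a)) * f (c *\<^sub>R x))
      = ennreal (norm x powr - real DIM('a)) * f (c *\<^sub>R x)" for x :: 'a
  proof -
    have "c ^ DIM('a) * norm (c *\<^sub>R x) powr - real DIM('a) = norm x powr - real DIM('a)"
      using c by (simp add: powr_mult powr_minus powr_realpow)
    then show ?thesis using c by (simp add: mult.assoc[symmetric] ennreal_mult[symmetric])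
  qed
  have "(\<integral>\<^sup>+x. f x \<partial>dilation_measure)
    = ennreal (\<bar>c\<bar> ^ DIM('a)) * (\<integral>\<^sup>+x. ennreal (norm (c *\<^sub>R x) powr - real DIM('a)) * f (c *\<^sub>R x) \<partial>lborel)"
    by (simp only: nn_integral_dilation_measure[OF assms(1)], subst nn_integral_dilate[where c=c]) (use c in auto)
  also have "\<dots> = (\<integral>\<^sup>+x. ennreal (norm x powr - real DIM('a)) * f (c *\<^sub>R x) \<partial>lborel)"
    using c by (subst nn_integral_cmult[symmetric]) (simp, simp only: eq abs_of_pos)
  finally show ?thesis by (simp add: nn_integral_dilation_measure)
qed

text \<open>
  The mass of the shell \<open>1 \<le> |x| < exp 1\<close>, which is the surface area of the unit sphere. The convention
  \<open>ln 0 = 0\<close> adds the origin to the shell, a null set.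
\<close>

definition radial_mass :: "'a::euclidean_space itself \<Rightarrow> ennreal" where
  "radial_mass _ = (\<integral>\<^sup>+x. indicator {0..<1} (ln (norm x)) \<partial>(dilation_measure :: 'a measure))"

text \<open>
  The integration formula for radial functions. For every \<open>x \<noteq> 0\<close> the numbers \<open>t\<close> for which \<open>exp (- t) x\<close> lies in
  the shell \<open>1 \<le> |x| < exp 1\<close> form an interval of length one; inserting this as a factor \<open>1\<close>, exchanging the
  integrals and dilating by \<open>exp t\<close> leaves a product.
\<close>

lemma nn_integral_radial:
  fixes K :: "real \<Rightarrow> ennreal"
  assumes [measurable]: "K \<in> borel_measurable borel"
  shows "(\<integral>\<^sup>+x. K (ln (norm x)) \<partial>(dilation_measure :: 'a::euclidean_space measure))
    = radial_mass TYPE('a) * (\<integral>\<^sup>+t. K t \<partial>lborel)"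
proof -
  let ?\<nu> = "dilation_measure :: 'a measure"
  have "(\<integral>\<^sup>+x. K (ln (norm x)) \<partial>?\<nu>)
      = (\<integral>\<^sup>+x. \<integral>\<^sup>+t. indicator {0..<1} (ln (norm x) - t) * K (ln (norm x)) \<partial>lborel \<partial>?\<nu>)"
  proof (rule nn_integral_cong)
    fix x :: 'a
    have "(\<integral>\<^sup>+t. indicator {0..<1} (ln (norm x) - t) \<partial>lborel) = (\<integral>\<^sup>+t. indicator {ln (norm x) - 1<..ln (norm x)} t \<partial>lborel)"
      by (intro nn_integral_cong) (auto simp: indicator_def)
    also have "\<dots> = 1" by simp
    finally show "K (ln (norm x)) = (\<integral>\<^sup>+t. indicator {0..<1} (ln (norm x) - t) * K (ln (norm x)) \<partial>lborel)"
      by (simp add: nn_integral_multc)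
  qed
  also have "\<dots> = (\<integral>\<^sup>+t. \<integral>\<^sup>+x. indicator {0..<1} (ln (norm x) - t) * K (ln (norm x)) \<partial>?\<nu> \<partial>lborel)"
    by (rule dilation_measure_Fubini) measurable
  also have "\<dots> = (\<integral>\<^sup>+t. \<integral>\<^sup>+x. indicator {0..<1} (ln (norm x)) * K (ln (norm x) + t) \<partial>?\<nu> \<partial>lborel)"
  proof (rule nn_integral_cong)
    fix t :: real
    have "(\<integral>\<^sup>+x. indicator {0..<1} (ln (norm x) - t) * K (ln (norm x)) \<partial>?\<nu>)
       = (\<integral>\<^sup>+x. indicator {0..<1} (ln (norm (exp t *\<^sub>R x)) - t) * K (ln (norm (exp t *\<^sub>R x))) \<partial>?\<nu>)"
      by (rule nn_integral_dilation_measure_dilate[symmetric]) auto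
    also have "\<dots> = (\<integral>\<^sup>+x. indicator {0..<1} (ln (norm x)) * K (ln (norm x) + t) \<partial>?\<nu>)"
    proof (rule nn_integral_cong_AE)
      show "AE x in ?\<nu>. indicator {0..<1} (ln (norm (exp t *\<^sub>R x)) - t) * K (ln (norm (exp t *\<^sub>R x)))
         = indicator {0..<1} (ln (norm x)) * K (ln (norm x) + t)"
        using AE_dilation_measure_nonzero
        by eventually_elim (simp add: ln_mult add.commute)
    qed
    finally show "(\<integral>\<^sup>+x. indicator {0..<1} (ln (norm x) - t) * K (ln (norm x)) \<partial>?\<nu>)
       = (\<integral>\<^sup>+x. indicator {0..<1} (ln (norm x)) * K (ln (norm x) + t) \<partial>?\<nu>)" .
  qed
  also have "\<dots> = (\<integral>\<^sup>+x. \<integral>\<^sup>+t. indicator {0..<1} (ln (norm x)) * K (ln (norm x) + t) \<partial>lborel \<partial>?\<nu>)"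
    by (rule dilation_measure_Fubini[symmetric]) measurable
  also have "\<dots> = (\<integral>\<^sup>+x. indicator {0..<1} (ln (norm x)) * (\<integral>\<^sup>+t. K t \<partial>lborel) \<partial>?\<nu>)"
  proof (rule nn_integral_cong)
    fix x :: 'a
    show "(\<integral>\<^sup>+t. indicator {0..<1} (ln (norm x)) * K (ln (norm x) + t) \<partial>lborel)
       = indicator {0..<1} (ln (norm x)) * (\<integral>\<^sup>+t. K t \<partial>lborel)"
      using nn_integral_real_affine[of K 1 "ln (norm x)"] by (simp add: nn_integral_cmult)
  qed
  also have "\<dots> = radial_mass TYPE('a) * (\<integral>\<^sup>+t. K t \<partial>lborel)"
    unfolding radial_mass_def by (rule nn_integral_multc) measurable
  finally show ?thesis .
qed

lemma radial_mass_finite: "radial_mass TYPE('a::euclidean_space) < \<infinity>"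
proof -
  have "radial_mass TYPE('a) = (\<integral>\<^sup>+x. ennreal (norm x powr - real DIM('a)) * indicator {0..<1} (ln (norm x)) \<partial>(lborel :: 'a measure))"
    unfolding radial_mass_def by (rule nn_integral_dilation_measure) measurable
  also have "\<dots> \<le> (\<integral>\<^sup>+x. indicator (cball 0 (exp 1)) x \<partial>(lborel :: 'a measure))"
  proof (rule nn_integral_mono)
    fix x :: 'a
    have "norm x powr - real DIM('a) \<le> 1 \<and> norm x \<le> exp 1" if "x \<noteq> 0" "0 \<le> ln (norm x)" "ln (norm x) < 1"
    proof -
      have "1 \<le> norm x" using that by (simp add: ln_ge_zero_iff)
      moreover have "norm x \<le> exp 1"
        using that by (metis exp_le_cancel_iff exp_ln less_imp_le zero_less_norm_iff)
      ultimately show ?thesis using powr_mono[of "- real DIM('a)" 0 "norm x"] that(1) by simp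
    qed
    then show "ennreal (norm x powr - real DIM('a)) * indicator {0..<1} (ln (norm x)) \<le> indicator (cball 0 (exp 1)) x"
      by (cases "x = 0") (auto simp: indicator_def)
  qed
  also have "\<dots> < \<infinity>" using emeasure_lborel_cbox_finite emeasure_bounded_finite[of "cball (0::'a) (exp 1)"] by simp
  finally show ?thesis .
qed

lemma radial_mass_pos: "radial_mass TYPE('a::euclidean_space) \<noteq> 0"
proof
  assume 0: "radial_mass TYPE('a) = 0"
  have "(\<integral>\<^sup>+x. 1 \<partial>(dilation_measure :: 'a measure)) = 0"
    using nn_integral_radial[of "\<lambda>_. 1", where 'a='a] 0 by simp
  then have "AE x in (lborel :: 'a measure). ennreal (norm x powr - real DIM('a)) * 1 = 0"
    by (subst (asm) nn_integral_dilation_measure) (auto simp: nn_integral_0_iff_AE)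
  with AE_lborel_singleton[of "0::'a"] have "AE x in (lborel :: 'a measure). False"
    by eventually_elim simp
  then show False using AE_iff_measurable[of UNIV "lborel :: 'a measure" "\<lambda>_. False"] by simp
qed

section \<open>Weighted integrals of the increments\<close>

lemma powr_tangent_le:
  fixes m y p :: real
  assumes "m > 0" "y \<ge> 0" "p \<ge> 1"
  shows "m powr p + p * m powr (p - 1) * (y - m) \<le> y powr p"
proof (cases "y = 0")
  case True
  have "m powr (p - 1) * m = m powr p" using assms(1) by (simp add: powr_diff)
  then have "m powr p + p * m powr (p - 1) * (y - m) = m powr p * (1 - p)"
    using True by (simp add: algebra_simps)
  then show ?thesis using assms True by (simp add: mult_nonneg_nonpos)
next
  case False
  have "y powr p - m powr p \<ge> (p * m powr (p - 1)) * (y - m)"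
  proof (rule convex_on_imp_above_tangent[where A="{0<..}" and f="\<lambda>x. x powr p"])
    have "((\<lambda>x. x powr p) has_real_derivative p * m powr (p - 1)) (at m)"
      using assms(1) by (rule has_real_derivative_powr)
    then show "((\<lambda>x. x powr p) has_real_derivative p * m powr (p - 1)) (at m within {0<..})"
      by (rule has_field_derivative_at_within)
  qed (use assms False in \<open>auto simp: powr_convex interior_open\<close>)
  then show ?thesis by linarith
qed

text \<open>
  Jensen's inequality on \<open>[1, 2]\<close>. No integrability is assumed: the right-hand side may be infinite, and it
  controls the integrability of \<open>G\<close> when it is finite.
\<close>

lemma powr_integral_le_nn_integral_powr:
  fixes G :: "real \<Rightarrow> real"
  assumes [measurable]: "G \<in> borel_measurable borel" and p: "p \<ge> 1"
  shows "ennreal (\<bar>\<integral>t. indicator {1..2} t * G t \<partial>lborel\<bar> powr p)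
     \<le> (\<integral>\<^sup>+t. indicator {1..2} t * ennreal (\<bar>G t\<bar> powr p) \<partial>lborel)"
proof (cases "(\<integral>\<^sup>+t. indicator {1..2} t * ennreal (\<bar>G t\<bar> powr p) \<partial>lborel) = \<infinity>")
  case True
  then show ?thesis by simp
next
  case False
  let ?I = "indicator {1..2::real} :: real \<Rightarrow> real"
  have nn: "(\<integral>\<^sup>+t. indicator {1..2} t * ennreal (\<bar>G t\<bar> powr p) \<partial>lborel) = (\<integral>\<^sup>+t. ennreal (?I t * \<bar>G t\<bar> powr p) \<partial>lborel)"
    by (intro nn_integral_cong) (auto simp: indicator_def)
  have ip: "integrable lborel (\<lambda>t. ?I t * \<bar>G t\<bar> powr p)"
    using False by (intro integrableI_nonneg) (auto simp: nn[symmetric] top.not_eq_extremum)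
  have i1: "integrable lborel ?I" by simp
  have iG: "integrable lborel (\<lambda>t. ?I t * \<bar>G t\<bar>)"
  proof (rule Bochner_Integration.integrable_bound)
    show "integrable lborel (\<lambda>t. ?I t + ?I t * \<bar>G t\<bar> powr p)" using i1 ip by (rule Bochner_Integration.integrable_add)
    have "\<bar>G t\<bar> \<le> 1 + \<bar>G t\<bar> powr p" for t
    proof (cases "\<bar>G t\<bar> \<le> 1")
      case False
      then have "\<bar>G t\<bar> powr 1 \<le> \<bar>G t\<bar> powr p" using p by (intro powr_mono) auto
      then show ?thesis by simp
    qed (simp add: add_increasing2)
    then show "AE t in lborel. norm (?I t * \<bar>G t\<bar>) \<le> norm (?I t + ?I t * \<bar>G t\<bar> powr p)"
      by (auto simp: indicator_def)
  qed simp
  define m where "m = (\<integral>t. ?I t * \<bar>G t\<bar> \<partial>lborel)"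
  have "m \<ge> 0" unfolding m_def by (simp add: integral_nonneg_AE)
  have le: "\<bar>\<integral>t. ?I t * G t \<partial>lborel\<bar> \<le> m"
    using integral_norm_bound[of lborel "\<lambda>t. ?I t * G t"] unfolding m_def by (simp add: abs_mult)
  have "m powr p \<le> (\<integral>t. ?I t * \<bar>G t\<bar> powr p \<partial>lborel)"
  proof (cases "m = 0")
    case True
    then show ?thesis by (simp add: integral_nonneg_AE)
  next
    case False
    then have "m > 0" using \<open>m \<ge> 0\<close> by simp
    have "m powr p = (\<integral>t. (m powr p - p * m powr (p - 1) * m) * ?I t + p * m powr (p - 1) * (?I t * \<bar>G t\<bar>) \<partial>lborel)"
      using iG i1 by (simp add: m_def[symmetric])
    also have "\<dots> \<le> (\<integral>t. ?I t * \<bar>G t\<bar> powr p \<partial>lborel)"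
    proof (rule integral_mono)
      show "(m powr p - p * m powr (p - 1) * m) * ?I t + p * m powr (p - 1) * (?I t * \<bar>G t\<bar>) \<le> ?I t * \<bar>G t\<bar> powr p" for t
        using powr_tangent_le[OF \<open>m > 0\<close> _ p, of "\<bar>G t\<bar>"] by (auto simp: indicator_def algebra_simps)
    qed (use iG i1 ip in auto)
    finally show ?thesis .
  qed
  moreover have "\<bar>\<integral>t. ?I t * G t \<partial>lborel\<bar> powr p \<le> m powr p" using le p by (intro powr_mono2) auto
  ultimately have "ennreal (\<bar>\<integral>t. ?I t * G t \<partial>lborel\<bar> powr p) \<le> ennreal (\<integral>t. ?I t * \<bar>G t\<bar> powr p \<partial>lborel)"
    by (intro ennreal_leI) linarith
  also have "\<dots> = (\<integral>\<^sup>+t. ennreal (?I t * \<bar>G t\<bar> powr p) \<partial>lborel)"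
    by (rule nn_integral_eq_integral[symmetric, OF ip]) simp
  finally show ?thesis by (simp add: nn)
qed

text \<open>
  A dilation by \<open>t \<in> [1, 2]\<close> changes the weight \<open>|x|\<^sup>d\<close> by a factor of at most \<open>2\<^bsup>|d|\<^esup>\<close>.
\<close>

lemma nn_integral_radial_mean_le:
  fixes g :: "'a::euclidean_space \<Rightarrow> real"
  assumes [measurable]: "g \<in> borel_measurable borel" and p: "p \<ge> 1"
  shows "(\<integral>\<^sup>+x. ennreal (norm x powr d * \<bar>radial_mean g x\<bar> powr p) \<partial>dilation_measure)
    \<le> ennreal (2 powr \<bar>d\<bar>) * (\<integral>\<^sup>+x. ennreal (norm x powr d * \<bar>g x\<bar> powr p) \<partial>dilation_measure)"
proof -
  let ?I = "\<integral>\<^sup>+x. ennreal (norm x powr d * \<bar>g x\<bar> powr p) \<partial>dilation_measure"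
  have "(\<integral>\<^sup>+x. ennreal (norm x powr d * \<bar>radial_mean g x\<bar> powr p) \<partial>dilation_measure)
      \<le> (\<integral>\<^sup>+x. \<integral>\<^sup>+t. ennreal (norm x powr d) * (indicator {1..2} t * ennreal (\<bar>g (t *\<^sub>R x)\<bar> powr p)) \<partial>lborel \<partial>dilation_measure)"
  proof (rule nn_integral_mono)
    fix x :: 'a
    have "ennreal (\<bar>radial_mean g x\<bar> powr p) \<le> (\<integral>\<^sup>+t. indicator {1..2} t * ennreal (\<bar>g (t *\<^sub>R x)\<bar> powr p) \<partial>lborel)"
      unfolding radial_mean_def by (rule powr_integral_le_nn_integral_powr[OF _ p]) measurable
    then show "ennreal (norm x powr d * \<bar>radial_mean g x\<bar> powr p) \<le>
        (\<integral>\<^sup>+t. ennreal (norm x powr d) * (indicator {1..2} t * ennreal (\<bar>g (t *\<^sub>R x)\<bar> powr p)) \<partial>lborel)"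
      by (simp add: nn_integral_cmult ennreal_mult mult_left_mono)
  qed
  also have "\<dots> = (\<integral>\<^sup>+t. \<integral>\<^sup>+x. ennreal (norm x powr d) * (indicator {1..2} t * ennreal (\<bar>g (t *\<^sub>R x)\<bar> powr p)) \<partial>dilation_measure \<partial>lborel)"
    by (rule dilation_measure_Fubini) measurable
  also have "\<dots> \<le> (\<integral>\<^sup>+t. indicator {1..2::real} t * (ennreal (2 powr \<bar>d\<bar>) * ?I) \<partial>lborel)"
  proof (rule nn_integral_mono)
    fix t :: real
    show "(\<integral>\<^sup>+x. ennreal (norm x powr d) * (indicator {1..2} t * ennreal (\<bar>g (t *\<^sub>R x)\<bar> powr p)) \<partial>dilation_measure)
        \<le> indicator {1..2::real} t * (ennreal (2 powr \<bar>d\<bar>) * ?I)"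
    proof (cases "t \<in> {1..2}")
      case True
      have "t powr - d \<le> 2 powr \<bar>d\<bar>"
      proof -
        have "t powr - d \<le> t powr \<bar>d\<bar>" using True by (intro powr_mono) auto
        also have "\<dots> \<le> 2 powr \<bar>d\<bar>" using True by (intro powr_mono2) auto
        finally show ?thesis .
      qed
      then have "norm x powr d \<le> 2 powr \<bar>d\<bar> * norm (t *\<^sub>R x) powr d" for x :: 'a
      proof -
        have "norm x powr d = t powr - d * norm (t *\<^sub>R x) powr d"
          using True by (simp add: powr_mult powr_minus)
        also have "\<dots> \<le> 2 powr \<bar>d\<bar> * norm (t *\<^sub>R x) powr d"
          using \<open>t powr - d \<le> 2 powr \<bar>d\<bar>\<close> by (rule mult_right_mono) simp
        finally show ?thesis .
      qed
      then have "(\<integral>\<^sup>+x. ennreal (norm x powr d) * (indicator {1..2} t * ennreal (\<bar>g (t *\<^sub>R x)\<bar> powr p)) \<partial>dilation_measure)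
         \<le> (\<integral>\<^sup>+x. ennreal (2 powr \<bar>d\<bar>) * ennreal (norm (t *\<^sub>R x) powr d * \<bar>g (t *\<^sub>R x)\<bar> powr p) \<partial>dilation_measure)"
        using True
        by (intro nn_integral_mono)
           (auto simp: ennreal_mult[symmetric] mult.assoc[symmetric] intro!: ennreal_leI mult_right_mono)
      also have "\<dots> = ennreal (2 powr \<bar>d\<bar>) * (\<integral>\<^sup>+x. ennreal (norm (t *\<^sub>R x) powr d * \<bar>g (t *\<^sub>R x)\<bar> powr p) \<partial>dilation_measure)"
        by (rule nn_integral_cmult) measurable
      also have "(\<integral>\<^sup>+x. ennreal (norm (t *\<^sub>R x) powr d * \<bar>g (t *\<^sub>R x)\<bar> powr p) \<partial>dilation_measure) = ?I"
        by (rule nn_integral_dilation_measure_dilate) (use True in auto)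
      finally show ?thesis using True by simp
    qed simp
  qed
  also have "\<dots> = ennreal (2 powr \<bar>d\<bar>) * ?I" by (simp add: nn_integral_multc)
  finally show ?thesis .
qed

section \<open>A Hardy type inequality\<close>

text \<open>
  A substitute for the triangle inequality that holds for all \<open>r > 0\<close>, with a factor of \<open>|x|\<^sup>r\<close> as close to
  \<open>1\<close> as desired.
\<close>

lemma powr_add_le:
  fixes x y r \<eta> :: real
  assumes "r > 0" "\<eta> > 0"
  shows "\<bar>x + y\<bar> powr r \<le> (1 + \<eta>) powr r * \<bar>x\<bar> powr r + (1 + 1 / \<eta>) powr r * \<bar>y\<bar> powr r"
proof (cases "\<bar>y\<bar> \<le> \<eta> * \<bar>x\<bar>")
  case True
  have "\<bar>x + y\<bar> \<le> \<bar>x\<bar> + \<bar>y\<bar>" by (rule abs_triangle_ineq)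
  also have "\<dots> \<le> (1 + \<eta>) * \<bar>x\<bar>" using True by (simp add: algebra_simps)
  finally have "\<bar>x + y\<bar> powr r \<le> ((1 + \<eta>) * \<bar>x\<bar>) powr r" using assms by (intro powr_mono2) auto
  then show ?thesis using assms by (simp add: powr_mult add_increasing2)
next
  case False
  have "\<bar>x\<bar> \<le> 1 / \<eta> * \<bar>y\<bar>" using False assms by (simp add: field_simps)
  then have "\<bar>x + y\<bar> \<le> (1 + 1 / \<eta>) * \<bar>y\<bar>" using abs_triangle_ineq[of x y] by (simp add: algebra_simps)
  then have "\<bar>x + y\<bar> powr r \<le> ((1 + 1 / \<eta>) * \<bar>y\<bar>) powr r" using assms by (intro powr_mono2) auto
  then show ?thesis using assms by (simp add: powr_mult add_increasing)
qed

text \<open>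
  Young's inequality: the left-hand side is a weighted geometric mean of the two terms on the right, with
  weights \<open>r/p\<close> and \<open>1 - r/p\<close>, hence at most their maximum.
\<close>

lemma powr_le_powr_add_exp:
  fixes D l \<beta> \<gamma> p r :: real
  assumes "0 < r" "r < p" "D \<ge> 0"
  shows "exp (- \<gamma> * r * l) * D powr r \<le> exp (- \<beta> * p * l) * D powr p + exp (- (r * p * (\<gamma> - \<beta>) / (p - r)) * l)"
proof (cases "D = 0")
  case False
  define e where "e = ln D"
  have D: "D powr a = exp (a * e)" for a using False assms(3) by (simp add: powr_def e_def)
  have "exp (- \<gamma> * r * l + r * e) \<le> exp (- \<beta> * p * l + p * e) \<or>
      exp (- \<gamma> * r * l + r * e) \<le> exp (- (r * p * (\<gamma> - \<beta>) / (p - r)) * l)"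
  proof (cases "(\<beta> * p - \<gamma> * r) * l \<le> (p - r) * e")
    case True
    then have "- \<gamma> * r * l + r * e \<le> - \<beta> * p * l + p * e" by (simp add: algebra_simps)
    then show ?thesis by simp
  next
    case False
    have "e \<le> (\<beta> * p - \<gamma> * r) * l / (p - r)" using False assms by (simp add: field_simps)
    then have "- \<gamma> * r * l + r * e \<le> - \<gamma> * r * l + r * ((\<beta> * p - \<gamma> * r) * l / (p - r))"
      using assms by (intro add_left_mono mult_left_mono) auto
    also have "\<dots> = - (r * p * (\<gamma> - \<beta>) / (p - r)) * l" using assms by (simp add: field_simps)
    finally show ?thesis by simp
  qed
  then show ?thesis unfolding D exp_add
    by (smt (verit) exp_gt_zero mult_pos_pos)
qed simp

lemma nn_integral_radial_sign:
  fixes K :: "real \<Rightarrow> ennreal"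
  assumes [measurable]: "K \<in> borel_measurable borel" and \<sigma>: "\<sigma> = 1 \<or> \<sigma> = -1"
  shows "(\<integral>\<^sup>+x. K (\<sigma> * ln (norm x)) \<partial>(dilation_measure :: 'a::euclidean_space measure))
    = radial_mass TYPE('a) * (\<integral>\<^sup>+t. K t \<partial>lborel)"
proof -
  have "(\<integral>\<^sup>+t. K t \<partial>lborel) = (\<integral>\<^sup>+t. K (\<sigma> * t) \<partial>lborel)"
    using nn_integral_real_affine[of K \<sigma> 0] \<sigma> by auto
  then show ?thesis using nn_integral_radial[of "\<lambda>t. K (\<sigma> * t)", where 'a='a] by simp
qed

lemma nn_integral_exp_decay_finite:
  fixes \<kappa> \<sigma> :: real
  assumes \<kappa>: "\<kappa> > 0" and \<sigma>: "\<sigma> = 1 \<or> \<sigma> = -1"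
  shows "(\<integral>\<^sup>+x. ennreal (exp (- \<kappa> * (\<sigma> * ln (norm x)))) * indicator {0..} (\<sigma> * ln (norm x))
     \<partial>(dilation_measure :: 'a::euclidean_space measure)) < \<infinity>"
proof -
  have "(\<integral>\<^sup>+t. ennreal (exp (- \<kappa> * t)) * indicator {0..} t \<partial>lborel) = ennreal (0 - (- exp (- \<kappa> * 0) / \<kappa>))"
  proof (rule nn_integral_FTC_atLeast)
    show "((\<lambda>t. - exp (- \<kappa> * t) / \<kappa>) has_real_derivative exp (- \<kappa> * t)) (at t)" for t
      using \<kappa> by (auto intro!: derivative_eq_intros)
    have "LIM t at_top. - \<kappa> * t :> at_bot"
      using \<kappa> by (intro filterlim_tendsto_neg_mult_at_bot[OF tendsto_const _ filterlim_ident]) auto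
    then have "((\<lambda>t. exp (- \<kappa> * t)) \<longlongrightarrow> 0) at_top"
      by (rule filterlim_compose[OF exp_at_bot])
    then show "((\<lambda>t. - exp (- \<kappa> * t) / \<kappa>) \<longlongrightarrow> 0) at_top"
      using tendsto_divide[OF tendsto_minus tendsto_const[of \<kappa>], of "\<lambda>t. exp (- \<kappa> * t)" 0 at_top] \<kappa> by simp
  qed auto
  then show ?thesis
    using nn_integral_radial_sign[of "\<lambda>t. ennreal (exp (- \<kappa> * t)) * indicator {0..} t" \<sigma>, where 'a='a]
      \<sigma> radial_mass_finite[where 'a='a]
    by (simp add: ennreal_mult_less_top)
qed

lemma ennreal_absorb:
  fixes X Z :: ennreal and \<tau> :: real
  assumes "Z < \<infinity>" "Z \<le> X + ennreal \<tau> * Z" "0 \<le> \<tau>" "\<tau> < 1"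
  shows "Z \<le> ennreal (1 / (1 - \<tau>)) * X"
proof (cases X)
  case (real x)
  obtain z where z: "Z = ennreal z" "z \<ge> 0" using assms(1) by (cases Z) auto
  have "z \<le> x + \<tau> * z"
    using assms(2,3) real z by (simp add: ennreal_mult[symmetric] ennreal_plus[symmetric] del: ennreal_plus)
  then have "z \<le> 1 / (1 - \<tau>) * x" using assms(4) by (simp add: field_simps)
  then show ?thesis using real z assms(4) by (simp add: ennreal_mult[symmetric])
next
  case top
  then show ?thesis using assms(4) by (simp add: ennreal_mult_top)
qed

text \<open>
  One step of the argument, on the side \<open>L \<ge> 0\<close> of the unit sphere selected by the sign \<open>\<sigma>\<close>; the dilation by
  \<open>2\<^sup>\<sigma>\<close> moves away from the sphere. If the weight \<open>\<omega>\<close> contracts in this direction, \<open>u (2\<^sup>\<sigma> x)\<close> is estimated by \<open>u x\<close>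
  and the increment \<open>D x\<close>; if it contracts in the opposite direction, \<open>u x\<close> is estimated by \<open>u (2\<^sup>\<sigma> x)\<close> and \<open>D x\<close>.
  Either way \<open>Z\<close> is bounded by a multiple of itself with a factor less than \<open>1\<close>, plus the contribution
  \<open>A\<close> near the sphere and the contribution \<open>Q\<close> of the increments, and being finite it can be absorbed.
\<close>

lemma hardy_absorption:
  fixes u :: "'a::euclidean_space \<Rightarrow> real" and \<omega> :: "real \<Rightarrow> real" and \<sigma> r \<theta> \<eta> :: real
  defines "L \<equiv> \<lambda>x::'a. \<sigma> * ln (norm x)" and "D \<equiv> \<lambda>x. u (2 powr \<sigma> *\<^sub>R x) - u x"
  defines "Z \<equiv> \<integral>\<^sup>+x. ennreal (\<omega> (L x) * \<bar>u x\<bar> powr r) * indicator {0..} (L x) \<partial>dilation_measure"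
    and "Q \<equiv> \<integral>\<^sup>+x. ennreal (\<omega> (L x) * \<bar>D x\<bar> powr r) * indicator {0..} (L x) \<partial>dilation_measure"
    and "A \<equiv> \<integral>\<^sup>+x. ennreal (\<omega> (L x) * \<bar>u x\<bar> powr r) * indicator {0..<ln 2} (L x) \<partial>dilation_measure"
  assumes \<sigma>: "\<sigma> = 1 \<or> \<sigma> = -1" and r: "r > 0" and \<eta>: "\<eta> > 0" and \<theta>: "0 < \<theta>" "\<theta> \<le> 1"
    and u[measurable]: "u \<in> borel_measurable borel" and \<omega>[measurable]: "\<omega> \<in> borel_measurable borel"
    and \<omega>0: "\<And>l. \<omega> l \<ge> 0"
    and contr: "(\<forall>l. \<omega> (l + ln 2) \<le> \<theta> * \<omega> l) \<or> (\<forall>l. \<omega> (l - ln 2) \<le> \<theta> * \<omega> l)"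
    and \<tau>: "(1 + \<eta>) powr r * \<theta> < 1" and fin: "Z < \<infinity>"
  shows "Z \<le> ennreal (1 / (1 - (1 + \<eta>) powr r * \<theta>)) * (A + ennreal ((1 + 1 / \<eta>) powr r) * Q)"
proof (rule ennreal_absorb[OF fin _ _ \<tau>])
  let ?\<nu> = "dilation_measure :: 'a measure"
  define \<mu> where "\<mu> = 2 powr \<sigma>"
  have \<mu>: "\<mu> > 0" by (simp add: \<mu>_def)
  define c1 where "c1 = (1 + \<eta>) powr r"
  define c2 where "c2 = (1 + 1 / \<eta>) powr r"
  have c: "c1 \<ge> 0" "c2 \<ge> 0" by (simp_all add: c1_def c2_def)
  have [measurable]: "L \<in> borel_measurable borel" "D \<in> borel_measurable borel"
    unfolding L_def D_def by measurable
  have L: "L (\<mu> *\<^sub>R x) = L x + ln 2" if "x \<noteq> 0" for x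
    using that \<sigma> by (auto simp: L_def \<mu>_def ln_mult ln_powr powr_minus algebra_simps)
  have dil: "(\<integral>\<^sup>+x. f x \<partial>?\<nu>) = (\<integral>\<^sup>+x. f (\<mu> *\<^sub>R x) \<partial>?\<nu>)" if "f \<in> borel_measurable borel" for f
    by (rule nn_integral_dilation_measure_dilate[OF that \<mu>, symmetric])
  have l0: "0 \<le> l" if "ln 2 \<le> l" for l :: real
    using that ln_ge_zero[of 2] by linarith
  show "0 \<le> (1 + \<eta>) powr r * \<theta>" using \<theta> by simp
  from contr show "Z \<le> A + ennreal ((1 + 1 / \<eta>) powr r) * Q + ennreal ((1 + \<eta>) powr r * \<theta>) * Z"
    unfolding c1_def[symmetric] c2_def[symmetric]
  proof
    assume *: "\<forall>l. \<omega> (l + ln 2) \<le> \<theta> * \<omega> l"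
    let ?B = "\<integral>\<^sup>+x. ennreal (\<omega> (L x) * \<bar>u x\<bar> powr r) * indicator {ln 2..} (L x) \<partial>?\<nu>"
    have ZAB: "Z = A + ?B"
      unfolding Z_def A_def by (subst nn_integral_add[symmetric])
        (auto intro!: nn_integral_cong simp: indicator_def dest: l0)
    have "?B = (\<integral>\<^sup>+x. ennreal (\<omega> (L (\<mu> *\<^sub>R x)) * \<bar>u (\<mu> *\<^sub>R x)\<bar> powr r) * indicator {ln 2..} (L (\<mu> *\<^sub>R x)) \<partial>?\<nu>)"
      by (rule dil) measurable
    also have "\<dots> \<le> (\<integral>\<^sup>+x. ennreal (c1 * \<theta>) * (ennreal (\<omega> (L x) * \<bar>u x\<bar> powr r) * indicator {0..} (L x)) +
        ennreal c2 * (ennreal (\<omega> (L x) * \<bar>D x\<bar> powr r) * indicator {0..} (L x)) \<partial>?\<nu>)"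
    proof (rule nn_integral_mono_AE)
      show "AE x in ?\<nu>. ennreal (\<omega> (L (\<mu> *\<^sub>R x)) * \<bar>u (\<mu> *\<^sub>R x)\<bar> powr r) * indicator {ln 2..} (L (\<mu> *\<^sub>R x))
        \<le> ennreal (c1 * \<theta>) * (ennreal (\<omega> (L x) * \<bar>u x\<bar> powr r) * indicator {0..} (L x)) +
        ennreal c2 * (ennreal (\<omega> (L x) * \<bar>D x\<bar> powr r) * indicator {0..} (L x))"
        using AE_dilation_measure_nonzero
      proof eventually_elim
        case (elim x)
        have "\<bar>u (\<mu> *\<^sub>R x)\<bar> powr r \<le> c1 * \<bar>u x\<bar> powr r + c2 * \<bar>D x\<bar> powr r"
          using powr_add_le[OF r \<eta>, of "u x" "D x"] by (simp add: D_def \<mu>_def c1_def c2_def)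
        then have "\<omega> (L x + ln 2) * \<bar>u (\<mu> *\<^sub>R x)\<bar> powr r \<le> (\<theta> * \<omega> (L x)) * (c1 * \<bar>u x\<bar> powr r + c2 * \<bar>D x\<bar> powr r)"
          using * \<omega>0 \<theta> by (intro mult_mono) auto
        also have "\<dots> \<le> c1 * \<theta> * (\<omega> (L x) * \<bar>u x\<bar> powr r) + c2 * (\<omega> (L x) * \<bar>D x\<bar> powr r)"
          using mult_right_mono[OF \<theta>(2), of "c2 * (\<omega> (L x) * \<bar>D x\<bar> powr r)"] c \<omega>0 by (simp add: algebra_simps)
        finally have "ennreal (\<omega> (L x + ln 2) * \<bar>u (\<mu> *\<^sub>R x)\<bar> powr r)
            \<le> ennreal (c1 * \<theta>) * ennreal (\<omega> (L x) * \<bar>u x\<bar> powr r) + ennreal c2 * ennreal (\<omega> (L x) * \<bar>D x\<bar> powr r)"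
          using c \<theta> \<omega>0 by (simp add: ennreal_mult[symmetric] ennreal_plus[symmetric] ennreal_leI del: ennreal_plus)
        then show ?case using elim by (auto simp: L indicator_def)
      qed
    qed
    also have "\<dots> = ennreal (c1 * \<theta>) * Z + ennreal c2 * Q"
      unfolding Z_def Q_def by (simp add: nn_integral_add nn_integral_cmult)
    finally have "A + ?B \<le> A + (ennreal (c1 * \<theta>) * Z + ennreal c2 * Q)" by (rule add_left_mono)
    then have "Z \<le> A + (ennreal (c1 * \<theta>) * Z + ennreal c2 * Q)" by (simp only: ZAB[symmetric])
    also have "\<dots> = A + ennreal c2 * Q + ennreal (c1 * \<theta>) * Z" by (simp only: ac_simps)
    finally show "Z \<le> A + ennreal c2 * Q + ennreal (c1 * \<theta>) * Z" .
  next
    assume *: "\<forall>l. \<omega> (l - ln 2) \<le> \<theta> * \<omega> l"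
    have "Z \<le> (\<integral>\<^sup>+x. ennreal c1 * (ennreal (\<omega> (L x) * \<bar>u (\<mu> *\<^sub>R x)\<bar> powr r) * indicator {0..} (L x)) +
        ennreal c2 * (ennreal (\<omega> (L x) * \<bar>D x\<bar> powr r) * indicator {0..} (L x)) \<partial>?\<nu>)"
      unfolding Z_def
    proof (rule nn_integral_mono)
      fix x
      have "\<bar>u x\<bar> powr r \<le> c1 * \<bar>u (\<mu> *\<^sub>R x)\<bar> powr r + c2 * \<bar>D x\<bar> powr r"
        using powr_add_le[OF r \<eta>, of "u (\<mu> *\<^sub>R x)" "- D x"] by (simp add: D_def \<mu>_def c1_def c2_def abs_minus_commute)
      then have "\<omega> (L x) * \<bar>u x\<bar> powr r \<le> \<omega> (L x) * (c1 * \<bar>u (\<mu> *\<^sub>R x)\<bar> powr r + c2 * \<bar>D x\<bar> powr r)"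
        using \<omega>0 by (intro mult_left_mono) auto
      then have "ennreal (\<omega> (L x) * \<bar>u x\<bar> powr r)
          \<le> ennreal c1 * ennreal (\<omega> (L x) * \<bar>u (\<mu> *\<^sub>R x)\<bar> powr r) + ennreal c2 * ennreal (\<omega> (L x) * \<bar>D x\<bar> powr r)"
        using c \<omega>0 by (simp add: ennreal_mult[symmetric] ennreal_plus[symmetric] ennreal_leI algebra_simps del: ennreal_plus)
      then show "ennreal (\<omega> (L x) * \<bar>u x\<bar> powr r) * indicator {0..} (L x)
          \<le> ennreal c1 * (ennreal (\<omega> (L x) * \<bar>u (\<mu> *\<^sub>R x)\<bar> powr r) * indicator {0..} (L x)) +
        ennreal c2 * (ennreal (\<omega> (L x) * \<bar>D x\<bar> powr r) * indicator {0..} (L x))"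
        by (auto simp: indicator_def)
    qed
    also have "\<dots> = ennreal c1 * (\<integral>\<^sup>+x. ennreal (\<omega> (L x) * \<bar>u (\<mu> *\<^sub>R x)\<bar> powr r) * indicator {0..} (L x) \<partial>?\<nu>) + ennreal c2 * Q"
      unfolding Q_def by (simp add: nn_integral_add nn_integral_cmult)
    also have "(\<integral>\<^sup>+x. ennreal (\<omega> (L x) * \<bar>u (\<mu> *\<^sub>R x)\<bar> powr r) * indicator {0..} (L x) \<partial>?\<nu>)
       = (\<integral>\<^sup>+x. ennreal (\<omega> (L (\<mu> *\<^sub>R x) - ln 2) * \<bar>u (\<mu> *\<^sub>R x)\<bar> powr r) * indicator {0..} (L (\<mu> *\<^sub>R x) - ln 2) \<partial>?\<nu>)"
      by (rule nn_integral_cong_AE) (use AE_dilation_measure_nonzero in eventually_elim, simp add: L)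
    also have "\<dots> = (\<integral>\<^sup>+x. ennreal (\<omega> (L x - ln 2) * \<bar>u x\<bar> powr r) * indicator {0..} (L x - ln 2) \<partial>?\<nu>)"
      by (rule dil[symmetric]) measurable
    also have "\<dots> \<le> (\<integral>\<^sup>+x. ennreal \<theta> * (ennreal (\<omega> (L x) * \<bar>u x\<bar> powr r) * indicator {0..} (L x)) \<partial>?\<nu>)"
    proof (rule nn_integral_mono)
      fix x
      have "\<omega> (L x - ln 2) * \<bar>u x\<bar> powr r \<le> \<theta> * (\<omega> (L x) * \<bar>u x\<bar> powr r)"
        using mult_right_mono[OF *[rule_format, of "L x"], of "\<bar>u x\<bar> powr r"] by (simp add: mult.assoc)
      then have "ennreal (\<omega> (L x - ln 2) * \<bar>u x\<bar> powr r) \<le> ennreal \<theta> * ennreal (\<omega> (L x) * \<bar>u x\<bar> powr r)"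
        using \<theta> \<omega>0 by (simp add: ennreal_mult[symmetric] ennreal_leI)
      then show "ennreal (\<omega> (L x - ln 2) * \<bar>u x\<bar> powr r) * indicator {0..} (L x - ln 2)
          \<le> ennreal \<theta> * (ennreal (\<omega> (L x) * \<bar>u x\<bar> powr r) * indicator {0..} (L x))"
        by (auto simp: indicator_def dest: l0)
    qed
    also have "\<dots> = ennreal \<theta> * Z" unfolding Z_def by (rule nn_integral_cmult) measurable
    finally have "Z \<le> ennreal c1 * (ennreal \<theta> * Z) + ennreal c2 * Q" by (simp add: mult_left_mono add_right_mono)
    also have "\<dots> \<le> A + ennreal c2 * Q + ennreal (c1 * \<theta>) * Z"
      using c \<theta> by (simp add: ennreal_mult mult.assoc add.commute add.assoc add_increasing)
    finally show "Z \<le> A + ennreal c2 * Q + ennreal (c1 * \<theta>) * Z" .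
  qed
qed

text \<open>
  The weight \<open>exp (- \<gamma> r L)\<close> contracts outward if \<open>\<gamma> > 0\<close> and inward if \<open>\<gamma> < 0\<close>. In the second case \<open>\<alpha> < 0\<close>, so
  that \<open>u\<close> tends to zero in the outward direction. The integral of \<open>|u|\<^sup>r\<close> is not known to be finite beforehand,
  because \<open>\<gamma> < \<alpha>\<close>; therefore the absorption is carried out with truncated weights, and the bound does not
  depend on the truncation.
\<close>

lemma one_sided_hardy:
  fixes \<sigma> \<alpha> \<beta> \<gamma> r p :: real and B :: ennreal
  assumes \<sigma>: "\<sigma> = 1 \<or> \<sigma> = -1" and r: "0 < r" "r < p" and \<beta>\<gamma>: "\<beta> < \<gamma>" and \<gamma>\<alpha>: "\<gamma> < \<alpha>"
    and cases: "0 < \<gamma> \<or> \<alpha> < 0" and B: "B < \<infinity>"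
  shows "\<exists>K<\<infinity>. \<forall>u \<in> borel_measurable borel.
    (AE x in dilation_measure. \<bar>u x\<bar> \<le> exp (\<alpha> * (\<sigma> * ln (norm (x::'a::euclidean_space))))) \<longrightarrow>
    (\<integral>\<^sup>+x. ennreal (exp (- \<beta> * p * (\<sigma> * ln (norm x))) * \<bar>u (2 powr \<sigma> *\<^sub>R x) - u x\<bar> powr p) \<partial>dilation_measure) \<le> B \<longrightarrow>
    (\<integral>\<^sup>+x. ennreal (exp (- \<gamma> * r * (\<sigma> * ln (norm x))) * \<bar>u x\<bar> powr r) * indicator {0..} (\<sigma> * ln (norm x)) \<partial>dilation_measure) \<le> K"
proof -
  let ?\<nu> = "dilation_measure :: 'a measure"
  define L where "L x = \<sigma> * ln (norm x)" for x :: 'a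
  have [measurable]: "L \<in> borel_measurable borel" unfolding L_def by measurable
  \<comment> \<open>Weights with exponent \<open>\<delta>\<close> make the integral finite, and contract in the same direction as those with \<open>\<gamma>\<close>.\<close>
  define \<delta> where "\<delta> = (if 0 < \<gamma> then \<alpha> + 1 else \<alpha> / 2)"
  have \<delta>: "\<delta> > \<alpha>" "\<delta> > \<gamma>" "\<gamma> > 0 \<and> \<delta> > 0 \<or> \<gamma> < 0 \<and> \<delta> < 0" using cases \<gamma>\<alpha> by (auto simp: \<delta>_def)
  define \<theta> where "\<theta> = exp (- min \<bar>\<gamma>\<bar> \<bar>\<delta>\<bar> * r * ln 2)"
  have ln2: "0 < ln (2::real)" by simp
  have \<theta>: "0 < \<theta>" "\<theta> < 1" using \<delta>(3) r ln2 by (auto simp: \<theta>_def)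
  \<comment> \<open>This \<open>\<eta>\<close> turns \<open>(1 + \<eta>)\<^sup>r \<theta>\<close> into the square root of \<open>\<theta>\<close>.\<close>
  define \<eta> where "\<eta> = \<theta> powr (- 1 / (2 * r)) - 1"
  have \<eta>: "\<eta> > 0"
    using \<theta> r powr_less_mono2_neg[of "- 1 / (2 * r)" \<theta> 1] by (simp add: \<eta>_def)
  have \<tau>: "(1 + \<eta>) powr r * \<theta> < 1"
  proof -
    have e: "- 1 / (2 * r) * r + 1 = 1 / 2" using r by (simp add: field_simps)
    have "(1 + \<eta>) powr r * \<theta> = \<theta> powr (- 1 / (2 * r) * r) * \<theta> powr 1"
      using \<theta> by (simp add: \<eta>_def powr_powr)
    also have "\<dots> = \<theta> powr (1 / 2)" by (simp only: powr_add[symmetric] e)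
    also have "\<dots> < 1" using \<theta> powr_less_mono2[of "1/2" \<theta> 1] by simp
    finally show ?thesis .
  qed
  define \<omega> where "\<omega> n l = min (exp (- \<gamma> * r * l)) (real n * exp (- \<delta> * r * l))" for n l
  have \<omega>_meas[measurable]: "\<omega> n \<in> borel_measurable borel" for n unfolding \<omega>_def[abs_def] by measurable
  have \<omega>0: "\<omega> n l \<ge> 0" for n l by (simp add: \<omega>_def)
  have shift: "\<omega> n (l + s) \<le> \<theta> * \<omega> n l" if s: "- \<gamma> * r * s \<le> ln \<theta>" "- \<delta> * r * s \<le> ln \<theta>" for n l s
  proof -
    have e: "exp (- a * r * (l + s)) \<le> \<theta> * exp (- a * r * l)" if "- a * r * s \<le> ln \<theta>" for a
    proof -
      have "exp (- a * r * (l + s)) = exp (- a * r * s) * exp (- a * r * l)"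
        by (simp add: exp_add[symmetric] algebra_simps)
      also have "exp (- a * r * s) \<le> \<theta>" using that \<theta> by (metis exp_le_cancel_iff exp_ln)
      finally show ?thesis by simp
    qed
    have "real n * exp (- \<delta> * r * (l + s)) \<le> \<theta> * (real n * exp (- \<delta> * r * l))"
      using mult_left_mono[OF e[OF s(2)], of "real n"] by (simp add: mult_ac)
    then show ?thesis using e[OF s(1)] \<theta>(1) by (auto simp: \<omega>_def min_def)
  qed
  have ln\<theta>: "ln \<theta> = - min \<bar>\<gamma>\<bar> \<bar>\<delta>\<bar> * r * ln 2" by (simp add: \<theta>_def)
  have contr: "(\<forall>l. \<omega> n (l + ln 2) \<le> \<theta> * \<omega> n l) \<or> (\<forall>l. \<omega> n (l - ln 2) \<le> \<theta> * \<omega> n l)" for n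
    using \<delta>(3)
  proof
    assume "\<gamma> > 0 \<and> \<delta> > 0"
    then have "\<omega> n (l + ln 2) \<le> \<theta> * \<omega> n l" for l
      using r by (intro shift) (auto simp: ln\<theta> min_def)
    then show ?thesis by blast
  next
    assume "\<gamma> < 0 \<and> \<delta> < 0"
    then have "\<omega> n (l + - ln 2) \<le> \<theta> * \<omega> n l" for l
      using r by (intro shift) (auto simp: ln\<theta> min_def)
    then show ?thesis by simp
  qed
  define I1 where "I1 = (\<integral>\<^sup>+x. ennreal (exp (- ((\<delta> - \<alpha>) * r) * L x)) * indicator {0..} (L x) \<partial>?\<nu>)"
  have I1: "I1 < \<infinity>" unfolding I1_def L_def
    by (rule nn_integral_exp_decay_finite[OF _ \<sigma>]) (use \<delta> r in simp)
  define \<kappa> where "\<kappa> = r * p * (\<gamma> - \<beta>) / (p - r)"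
  define I2 where "I2 = (\<integral>\<^sup>+x. ennreal (exp (- \<kappa> * L x)) * indicator {0..} (L x) \<partial>?\<nu>)"
  have I2: "I2 < \<infinity>" unfolding I2_def L_def
    by (rule nn_integral_exp_decay_finite[OF _ \<sigma>]) (use \<beta>\<gamma> r in \<open>simp add: \<kappa>_def\<close>)
  define K where "K = ennreal (1 / (1 - (1 + \<eta>) powr r * \<theta>)) *
     (ennreal (exp ((\<delta> - \<gamma>) * r * ln 2)) * I1 + ennreal ((1 + 1 / \<eta>) powr r) * (B + I2))"
  have "K < \<infinity>" unfolding K_def using I1 I2 B by (simp add: ennreal_mult_less_top)
  moreover have "(\<integral>\<^sup>+x. ennreal (exp (- \<gamma> * r * L x) * \<bar>u x\<bar> powr r) * indicator {0..} (L x) \<partial>?\<nu>) \<le> K"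
    if [measurable]: "u \<in> borel_measurable borel"
      and ub: "AE x in ?\<nu>. \<bar>u x\<bar> \<le> exp (\<alpha> * L x)"
      and Dp: "(\<integral>\<^sup>+x. ennreal (exp (- \<beta> * p * L x) * \<bar>u (2 powr \<sigma> *\<^sub>R x) - u x\<bar> powr p) \<partial>?\<nu>) \<le> B"
    for u
  proof -
    have ubr: "AE x in ?\<nu>. \<bar>u x\<bar> powr r \<le> exp (\<alpha> * r * L x)"
      using ub
    proof eventually_elim
      case (elim x)
      have "\<bar>u x\<bar> powr r \<le> exp (\<alpha> * L x) powr r" using elim r by (intro powr_mono2) auto
      then show ?case by (simp add: powr_def mult_ac)
    qed
    let ?Z = "\<lambda>n. \<integral>\<^sup>+x. ennreal (\<omega> n (L x) * \<bar>u x\<bar> powr r) * indicator {0..} (L x) \<partial>?\<nu>"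
    have Zn: "?Z n \<le> K" for n
    proof -
      have "?Z n \<le> (\<integral>\<^sup>+x. ennreal (real n) * (ennreal (exp (- ((\<delta> - \<alpha>) * r) * L x)) * indicator {0..} (L x)) \<partial>?\<nu>)"
      proof (rule nn_integral_mono_AE)
        show "AE x in ?\<nu>. ennreal (\<omega> n (L x) * \<bar>u x\<bar> powr r) * indicator {0..} (L x)
            \<le> ennreal (real n) * (ennreal (exp (- ((\<delta> - \<alpha>) * r) * L x)) * indicator {0..} (L x))"
          using ubr
        proof eventually_elim
          case (elim x)
          have "\<omega> n (L x) * \<bar>u x\<bar> powr r \<le> (real n * exp (- \<delta> * r * L x)) * exp (\<alpha> * r * L x)"
            using elim \<omega>0 by (intro mult_mono) (auto simp: \<omega>_def)
          also have "\<dots> = real n * exp (- ((\<delta> - \<alpha>) * r) * L x)"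
            by (simp add: exp_add[symmetric] algebra_simps)
          finally have "ennreal (\<omega> n (L x) * \<bar>u x\<bar> powr r) \<le> ennreal (real n) * ennreal (exp (- ((\<delta> - \<alpha>) * r) * L x))"
            by (subst ennreal_mult[symmetric]) (auto intro!: ennreal_leI)
          then show ?case by (auto simp: indicator_def)
        qed
      qed
      also have "\<dots> = ennreal (real n) * I1" unfolding I1_def by (rule nn_integral_cmult) measurable
      also have "\<dots> < \<infinity>" using I1 by (simp add: ennreal_mult_less_top)
      finally have fin: "?Z n < \<infinity>" .
      let ?A = "\<integral>\<^sup>+x. ennreal (\<omega> n (L x) * \<bar>u x\<bar> powr r) * indicator {0..<ln 2} (L x) \<partial>?\<nu>"
      have A: "?A \<le> ennreal (exp ((\<delta> - \<gamma>) * r * ln 2)) * I1"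
      proof -
        have "?A \<le> (\<integral>\<^sup>+x. ennreal (exp ((\<delta> - \<gamma>) * r * ln 2)) * (ennreal (exp (- ((\<delta> - \<alpha>) * r) * L x)) * indicator {0..} (L x)) \<partial>?\<nu>)"
        proof (rule nn_integral_mono_AE)
          show "AE x in ?\<nu>. ennreal (\<omega> n (L x) * \<bar>u x\<bar> powr r) * indicator {0..<ln 2} (L x)
              \<le> ennreal (exp ((\<delta> - \<gamma>) * r * ln 2)) * (ennreal (exp (- ((\<delta> - \<alpha>) * r) * L x)) * indicator {0..} (L x))"
            using ubr
          proof eventually_elim
            case (elim x)
            show ?case
            proof (cases "L x \<in> {0..<ln 2}")
              case True
              have "\<omega> n (L x) * \<bar>u x\<bar> powr r \<le> exp (- \<gamma> * r * L x) * exp (\<alpha> * r * L x)"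
                using elim \<omega>0 by (intro mult_mono) (auto simp: \<omega>_def)
              also have "\<dots> = exp ((\<delta> - \<gamma>) * r * L x) * exp (- ((\<delta> - \<alpha>) * r) * L x)"
                by (simp add: exp_add[symmetric] algebra_simps)
              also have "\<dots> \<le> exp ((\<delta> - \<gamma>) * r * ln 2) * exp (- ((\<delta> - \<alpha>) * r) * L x)"
                using True \<delta>(2) r by (intro mult_right_mono) auto
              finally have "ennreal (\<omega> n (L x) * \<bar>u x\<bar> powr r)
                  \<le> ennreal (exp ((\<delta> - \<gamma>) * r * ln 2)) * ennreal (exp (- ((\<delta> - \<alpha>) * r) * L x))"
                by (subst ennreal_mult[symmetric]) (auto intro!: ennreal_leI)
              then show ?thesis using True by simp
            qed simp
          qed
        qed
        also have "\<dots> = ennreal (exp ((\<delta> - \<gamma>) * r * ln 2)) * I1"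
          unfolding I1_def by (rule nn_integral_cmult) measurable
        finally show ?thesis .
      qed
      let ?D = "\<lambda>x. u (2 powr \<sigma> *\<^sub>R x) - u x"
      let ?Q = "\<integral>\<^sup>+x. ennreal (\<omega> n (L x) * \<bar>?D x\<bar> powr r) * indicator {0..} (L x) \<partial>?\<nu>"
      have Q: "?Q \<le> B + I2"
      proof -
        have "?Q \<le> (\<integral>\<^sup>+x. ennreal (exp (- \<beta> * p * L x) * \<bar>?D x\<bar> powr p) + ennreal (exp (- \<kappa> * L x)) * indicator {0..} (L x) \<partial>?\<nu>)"
        proof (rule nn_integral_mono)
          fix x
          have "\<omega> n (L x) * \<bar>?D x\<bar> powr r \<le> exp (- \<gamma> * r * L x) * \<bar>?D x\<bar> powr r"
            by (intro mult_right_mono) (auto simp: \<omega>_def)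
          also have "\<dots> \<le> exp (- \<beta> * p * L x) * \<bar>?D x\<bar> powr p + exp (- \<kappa> * L x)"
            unfolding \<kappa>_def by (rule powr_le_powr_add_exp) (use r in auto)
          finally have "ennreal (\<omega> n (L x) * \<bar>?D x\<bar> powr r)
              \<le> ennreal (exp (- \<beta> * p * L x) * \<bar>?D x\<bar> powr p) + ennreal (exp (- \<kappa> * L x))"
            by (simp add: ennreal_plus[symmetric] ennreal_leI del: ennreal_plus)
          then show "ennreal (\<omega> n (L x) * \<bar>?D x\<bar> powr r) * indicator {0..} (L x)
              \<le> ennreal (exp (- \<beta> * p * L x) * \<bar>?D x\<bar> powr p) + ennreal (exp (- \<kappa> * L x)) * indicator {0..} (L x)"
            by (auto simp: indicator_def)
        qed
        also have "\<dots> \<le> B + I2" unfolding I2_def using Dp by (simp add: nn_integral_add)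
        finally show ?thesis .
      qed
      have "?Z n \<le> ennreal (1 / (1 - (1 + \<eta>) powr r * \<theta>)) * (?A + ennreal ((1 + 1 / \<eta>) powr r) * ?Q)"
        using hardy_absorption[OF \<sigma> r(1) \<eta> \<theta>(1) less_imp_le[OF \<theta>(2)] that(1) \<omega>_meas \<omega>0 contr \<tau>] fin
        unfolding L_def by blast
      also have "\<dots> \<le> K" unfolding K_def by (intro mult_left_mono add_mono A Q) auto
      finally show ?thesis .
    qed
    have "(\<lambda>n. ?Z n) \<longlonglongrightarrow> (\<integral>\<^sup>+x. ennreal (exp (- \<gamma> * r * L x) * \<bar>u x\<bar> powr r) * indicator {0..} (L x) \<partial>?\<nu>)"
    proof (rule nn_integral_LIMSEQ)
      show "incseq (\<lambda>n x. ennreal (\<omega> n (L x) * \<bar>u x\<bar> powr r) * indicator {0..} (L x))"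
      proof (intro incseq_SucI le_funI mult_right_mono ennreal_leI)
        fix n x
        have "real n * exp (- \<delta> * r * L x) \<le> real (Suc n) * exp (- \<delta> * r * L x)" by (intro mult_right_mono) auto
        then show "\<omega> n (L x) \<le> \<omega> (Suc n) (L x)" unfolding \<omega>_def by (intro min.mono) auto
      qed auto
      fix x
      obtain k where k: "exp (- \<gamma> * r * L x) / exp (- \<delta> * r * L x) \<le> real k" using real_arch_simple by blast
      have "\<omega> n (L x) = exp (- \<gamma> * r * L x)" if "n \<ge> k" for n
      proof -
        have "exp (- \<gamma> * r * L x) \<le> real k * exp (- \<delta> * r * L x)" using k by (simp add: field_simps)
        also have "\<dots> \<le> real n * exp (- \<delta> * r * L x)" using that by (intro mult_right_mono) auto
        finally show ?thesis by (simp add: \<omega>_def)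
      qed
      then show "(\<lambda>n. ennreal (\<omega> n (L x) * \<bar>u x\<bar> powr r) * indicator {0..} (L x))
          \<longlonglongrightarrow> ennreal (exp (- \<gamma> * r * L x) * \<bar>u x\<bar> powr r) * indicator {0..} (L x)"
        by (intro tendsto_eventually eventually_at_top_linorderI[of k]) simp
    qed measurable
    then show ?thesis by (rule LIMSEQ_le_const2) (use Zn in blast)
  qed
  ultimately show ?thesis unfolding L_def by blast
qed

section \<open>Sufficiency\<close>

text \<open>
  The sign \<open>\<sigma>\<close> selects the side of the unit sphere on which the bound on \<open>u\<close> does not suffice: \<open>\<sigma> = 1\<close> stands for
  \<open>|x| \<ge> 1\<close>, and \<open>\<sigma> = - 1\<close> for \<open>|x| \<le> 1\<close>. The powers of \<open>s\<close> come from normalizing \<open>u\<close> and \<open>g\<close> to \<open>s = 1\<close>.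
\<close>

lemma embedding_estimate:
  fixes \<sigma> \<alpha> \<beta> \<gamma> r p :: real
  assumes \<sigma>: "\<sigma> = 1 \<or> \<sigma> = -1" and r: "0 < r" "r < p" and p: "1 \<le> p"
    and ord: "\<sigma> * \<beta> < \<sigma> * \<gamma>" "\<sigma> * \<gamma> < \<sigma> * \<alpha>" and sgn: "0 < \<sigma> * \<gamma> \<or> \<sigma> * \<alpha> < 0"
  shows "\<exists>K\<ge>0. \<forall>u \<in> borel_measurable borel. \<forall>g \<in> borel_measurable borel. \<forall>s>0.
     (AE x in lborel. \<bar>u x\<bar> \<le> s * norm (x::'a::euclidean_space) powr \<alpha>) \<longrightarrow>
     (\<integral>\<^sup>+x. ennreal (norm x powr (p - \<beta> * p) * \<bar>g x\<bar> powr p) \<partial>dilation_measure) \<le> ennreal (s powr p) \<longrightarrow>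
     (AE x in lborel. u (2 *\<^sub>R x) - u x = norm x * radial_mean g x) \<longrightarrow>
     (\<integral>\<^sup>+x. ennreal (norm x powr (- \<gamma> * r) * \<bar>u x\<bar> powr r) \<partial>dilation_measure) \<le> ennreal (K * s powr r)"
proof -
  let ?\<nu> = "dilation_measure :: 'a measure"
  define d where "d = p - \<beta> * p"
  define B where "B = ennreal (2 powr \<bar>\<beta> * p\<bar>) * ennreal (2 powr \<bar>d\<bar>)"
  have exp_eq: "exp (k * (\<sigma> * ln (norm x))) = norm x powr a" if "x \<noteq> 0" "k = \<sigma> * a" for k a and x :: 'a
    using that \<sigma> by (auto simp: powr_def)
  have "B < \<infinity>" by (simp add: B_def ennreal_mult_less_top)
  from one_sided_hardy[OF \<sigma> r ord sgn this, where 'a='a]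
  obtain K1 where K1: "K1 < \<infinity>" and hardy: "\<And>v. v \<in> borel_measurable borel \<Longrightarrow>
    AE x in ?\<nu>. \<bar>v x\<bar> \<le> exp (\<sigma> * \<alpha> * (\<sigma> * ln (norm x))) \<Longrightarrow>
    (\<integral>\<^sup>+x. ennreal (exp (- (\<sigma> * \<beta>) * p * (\<sigma> * ln (norm x))) * \<bar>v (2 powr \<sigma> *\<^sub>R x) - v x\<bar> powr p) \<partial>?\<nu>) \<le> B \<Longrightarrow>
    (\<integral>\<^sup>+x. ennreal (exp (- (\<sigma> * \<gamma>) * r * (\<sigma> * ln (norm x))) * \<bar>v x\<bar> powr r) * indicator {0..} (\<sigma> * ln (norm x)) \<partial>?\<nu>) \<le> K1"
    by blast
  define \<kappa> where "\<kappa> = (\<sigma> * \<alpha> - \<sigma> * \<gamma>) * r"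
  define K2 where "K2 = (\<integral>\<^sup>+x. ennreal (exp (- \<kappa> * (- \<sigma> * ln (norm x)))) * indicator {0..} (- \<sigma> * ln (norm x)) \<partial>?\<nu>)"
  have K2: "K2 < \<infinity>" unfolding K2_def
    by (rule nn_integral_exp_decay_finite) (use ord r \<sigma> in \<open>auto simp: \<kappa>_def\<close>)
  have K: "ennreal (enn2real (K1 + K2)) = K1 + K2" using K1 K2 by simp
  show ?thesis
  proof (intro exI[of _ "enn2real (K1 + K2)"] conjI ballI allI impI enn2real_nonneg)
    fix u g :: "'a \<Rightarrow> real" and s :: real
    assume [measurable]: "u \<in> borel_measurable borel" "g \<in> borel_measurable borel" and s: "s > 0"
      and ub: "AE x in lborel. \<bar>u x\<bar> \<le> s * norm x powr \<alpha>"
      and gb: "(\<integral>\<^sup>+x. ennreal (norm x powr (p - \<beta> * p) * \<bar>g x\<bar> powr p) \<partial>?\<nu>) \<le> ennreal (s powr p)"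
      and id: "AE x in lborel. u (2 *\<^sub>R x) - u x = norm x * radial_mean g x"
    define v where "v x = u x / s" for x
    have [measurable]: "v \<in> borel_measurable borel" unfolding v_def by measurable
    have vb: "AE x in ?\<nu>. \<bar>v x\<bar> \<le> exp (\<sigma> * \<alpha> * (\<sigma> * ln (norm x)))"
      using AE_dilation_measure[OF ub] AE_dilation_measure_nonzero
    proof eventually_elim
      case (elim x)
      have "exp (\<sigma> * \<alpha> * (\<sigma> * ln (norm x))) = norm x powr \<alpha>" by (rule exp_eq[OF elim(2)]) simp
      then show ?case using elim(1) s by (simp add: v_def field_simps)
    qed
    let ?F = "\<lambda>x. ennreal (norm x powr (- \<beta> * p) * \<bar>v (2 *\<^sub>R x) - v x\<bar> powr p)"
    have F: "(\<integral>\<^sup>+x. ?F x \<partial>?\<nu>) \<le> ennreal (2 powr \<bar>d\<bar>)"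
    proof -
      have "(\<integral>\<^sup>+x. ?F x \<partial>?\<nu>) = (\<integral>\<^sup>+x. ennreal (1 / s powr p) * ennreal (norm x powr d * \<bar>radial_mean g x\<bar> powr p) \<partial>?\<nu>)"
      proof (rule nn_integral_cong_AE)
        show "AE x in ?\<nu>. ?F x = ennreal (1 / s powr p) * ennreal (norm x powr d * \<bar>radial_mean g x\<bar> powr p)"
          using AE_dilation_measure[OF id] AE_dilation_measure_nonzero
        proof eventually_elim
          case (elim x)
          have "v (2 *\<^sub>R x) - v x = norm x * radial_mean g x / s"
            using elim(1) by (simp add: v_def diff_divide_distrib[symmetric])
          then have "\<bar>v (2 *\<^sub>R x) - v x\<bar> powr p = norm x powr p * \<bar>radial_mean g x\<bar> powr p / s powr p"
            using s by (simp add: abs_mult powr_mult powr_divide)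
          then have "norm x powr (- \<beta> * p) * \<bar>v (2 *\<^sub>R x) - v x\<bar> powr p
             = 1 / s powr p * (norm x powr d * \<bar>radial_mean g x\<bar> powr p)"
            by (simp add: d_def powr_diff powr_minus field_simps)
          then show ?case by (simp add: ennreal_mult[symmetric])
        qed
      qed
      also have "\<dots> = ennreal (1 / s powr p) * (\<integral>\<^sup>+x. ennreal (norm x powr d * \<bar>radial_mean g x\<bar> powr p) \<partial>?\<nu>)"
        by (rule nn_integral_cmult) measurable
      also have "\<dots> \<le> ennreal (1 / s powr p) * (ennreal (2 powr \<bar>d\<bar>) * ennreal (s powr p))"
        using nn_integral_radial_mean_le[OF _ p, of g d] gb unfolding d_def
        by (intro mult_left_mono order_trans[OF nn_integral_radial_mean_le[OF _ p, of g "p - \<beta> * p"]]) auto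
      also have "\<dots> = ennreal (2 powr \<bar>d\<bar>)"
        using s by (simp add: ennreal_mult[symmetric])
      finally show ?thesis .
    qed
    have exp\<beta>: "exp (- (\<sigma> * \<beta>) * p * (\<sigma> * ln (norm x))) = norm x powr (- \<beta> * p)" if "x \<noteq> 0" for x :: 'a
      by (rule exp_eq[OF that]) simp
    have "(\<integral>\<^sup>+x. ennreal (exp (- (\<sigma> * \<beta>) * p * (\<sigma> * ln (norm x))) * \<bar>v (2 powr \<sigma> *\<^sub>R x) - v x\<bar> powr p) \<partial>?\<nu>)
       = (\<integral>\<^sup>+x. ennreal (norm x powr (- \<beta> * p) * \<bar>v (2 powr \<sigma> *\<^sub>R x) - v x\<bar> powr p) \<partial>?\<nu>)"
    proof (rule nn_integral_cong_AE)
      show "AE x in ?\<nu>. ennreal (exp (- (\<sigma> * \<beta>) * p * (\<sigma> * ln (norm x))) * \<bar>v (2 powr \<sigma> *\<^sub>R x) - v x\<bar> powr p)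
         = ennreal (norm x powr (- \<beta> * p) * \<bar>v (2 powr \<sigma> *\<^sub>R x) - v x\<bar> powr p)"
        using AE_dilation_measure_nonzero
      proof eventually_elim
        case (elim x)
        show ?case by (subst exp\<beta>[OF elim]) (rule refl)
      qed
    qed
    also have "\<dots> \<le> B"
      using \<sigma>
    proof
      assume "\<sigma> = 1"
      then have "(\<integral>\<^sup>+x. ennreal (norm x powr (- \<beta> * p) * \<bar>v (2 powr \<sigma> *\<^sub>R x) - v x\<bar> powr p) \<partial>?\<nu>) \<le> 1 * ennreal (2 powr \<bar>d\<bar>)"
        using F by simp
      also have "\<dots> \<le> B" unfolding B_def
        by (intro mult_right_mono) (auto simp: ge_one_powr_ge_zero)
      finally show ?thesis .
    next
      \<comment> \<open>The increment from \<open>x\<close> to \<open>x/2\<close> becomes, after a dilation by two, minus the one from \<open>x\<close> to \<open>2 x\<close>.\<close>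
      assume \<sigma>1: "\<sigma> = -1"
      have "(\<integral>\<^sup>+x. ennreal (norm x powr (- \<beta> * p) * \<bar>v (2 powr \<sigma> *\<^sub>R x) - v x\<bar> powr p) \<partial>?\<nu>)
        = (\<integral>\<^sup>+x. ennreal (norm (2 *\<^sub>R x) powr (- \<beta> * p) * \<bar>v (2 powr \<sigma> *\<^sub>R (2 *\<^sub>R x)) - v (2 *\<^sub>R x)\<bar> powr p) \<partial>?\<nu>)"
        by (rule nn_integral_dilation_measure_dilate[symmetric]) auto
      also have "\<dots> = (\<integral>\<^sup>+x. ennreal (2 powr (- \<beta> * p)) * ?F x \<partial>?\<nu>)"
        using \<sigma>1 by (intro nn_integral_cong)
          (simp add: powr_mult ennreal_mult[symmetric] powr_minus mult.assoc abs_minus_commute)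
      also have "\<dots> = ennreal (2 powr (- \<beta> * p)) * (\<integral>\<^sup>+x. ?F x \<partial>?\<nu>)"
        by (rule nn_integral_cmult) measurable
      also have "\<dots> \<le> B" unfolding B_def
        by (intro mult_mono F ennreal_leI powr_mono) auto
      finally show ?thesis .
    qed
    finally have "(\<integral>\<^sup>+x. ennreal (exp (- (\<sigma> * \<gamma>) * r * (\<sigma> * ln (norm x))) * \<bar>v x\<bar> powr r) * indicator {0..} (\<sigma> * ln (norm x)) \<partial>?\<nu>) \<le> K1"
      by (intro hardy vb) measurable
    note far = this
    have near: "(\<integral>\<^sup>+x. ennreal (exp (- (\<sigma> * \<gamma>) * r * (\<sigma> * ln (norm x))) * \<bar>v x\<bar> powr r) * indicator {..<0} (\<sigma> * ln (norm x)) \<partial>?\<nu>) \<le> K2"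
      unfolding K2_def
    proof (rule nn_integral_mono_AE)
      show "AE x in ?\<nu>. ennreal (exp (- (\<sigma> * \<gamma>) * r * (\<sigma> * ln (norm x))) * \<bar>v x\<bar> powr r) * indicator {..<0} (\<sigma> * ln (norm x))
        \<le> ennreal (exp (- \<kappa> * (- \<sigma> * ln (norm x)))) * indicator {0..} (- \<sigma> * ln (norm x))"
        using vb
      proof eventually_elim
        case (elim x)
        define l where "l = \<sigma> * ln (norm x)"
        have "\<bar>v x\<bar> powr r \<le> exp (\<sigma> * \<alpha> * l) powr r" using elim r unfolding l_def by (intro powr_mono2) auto
        then have "exp (- (\<sigma> * \<gamma>) * r * l) * \<bar>v x\<bar> powr r \<le> exp (- (\<sigma> * \<gamma>) * r * l) * exp (\<sigma> * \<alpha> * l * r)"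
          by (intro mult_left_mono) (auto simp: powr_def mult_ac)
        also have "\<dots> = exp (- \<kappa> * (- l))" by (simp add: \<kappa>_def exp_add[symmetric] algebra_simps)
        finally have "ennreal (exp (- (\<sigma> * \<gamma>) * r * l) * \<bar>v x\<bar> powr r) * indicator {..<0} l \<le> ennreal (exp (- \<kappa> * (- l))) * indicator {0..} (- l)"
          by (auto simp: indicator_def intro!: ennreal_leI)
        then show ?case by (simp add: l_def)
      qed
    qed
    have "(\<integral>\<^sup>+x. ennreal (norm x powr (- \<gamma> * r) * \<bar>u x\<bar> powr r) \<partial>?\<nu>)
       = (\<integral>\<^sup>+x. ennreal (s powr r) * (ennreal (exp (- (\<sigma> * \<gamma>) * r * (\<sigma> * ln (norm x))) * \<bar>v x\<bar> powr r) * indicator {0..} (\<sigma> * ln (norm x))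
         + ennreal (exp (- (\<sigma> * \<gamma>) * r * (\<sigma> * ln (norm x))) * \<bar>v x\<bar> powr r) * indicator {..<0} (\<sigma> * ln (norm x))) \<partial>?\<nu>)"
    proof (rule nn_integral_cong_AE)
      show "AE x in ?\<nu>. ennreal (norm x powr (- \<gamma> * r) * \<bar>u x\<bar> powr r)
       = ennreal (s powr r) * (ennreal (exp (- (\<sigma> * \<gamma>) * r * (\<sigma> * ln (norm x))) * \<bar>v x\<bar> powr r) * indicator {0..} (\<sigma> * ln (norm x))
         + ennreal (exp (- (\<sigma> * \<gamma>) * r * (\<sigma> * ln (norm x))) * \<bar>v x\<bar> powr r) * indicator {..<0} (\<sigma> * ln (norm x)))"
        using AE_dilation_measure_nonzero
      proof eventually_elim
        case (elim x)
        have e: "exp (- (\<sigma> * \<gamma>) * r * (\<sigma> * ln (norm x))) = norm x powr (- \<gamma> * r)"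
          by (rule exp_eq[OF elim]) simp
        have "\<bar>u x\<bar> powr r = s powr r * \<bar>v x\<bar> powr r" using s by (simp add: v_def powr_divide)
        then have "ennreal (norm x powr (- \<gamma> * r) * \<bar>u x\<bar> powr r) = ennreal (s powr r) * ennreal (norm x powr (- \<gamma> * r) * \<bar>v x\<bar> powr r)"
          by (simp add: ennreal_mult[symmetric] mult_ac)
        then show ?case unfolding e by (auto simp: indicator_def)
      qed
    qed
    also have "\<dots> \<le> ennreal (s powr r) * (K1 + K2)"
      using add_mono[OF far near] by (simp add: nn_integral_cmult nn_integral_add mult_left_mono)
    also have "\<dots> = ennreal (enn2real (K1 + K2) * s powr r)"
      by (simp add: ennreal_mult K mult.commute del: enn2real_plus)
    finally show "(\<integral>\<^sup>+x. ennreal (norm x powr (- \<gamma> * r) * \<bar>u x\<bar> powr r) \<partial>?\<nu>) \<le> ennreal (enn2real (K1 + K2) * s powr r)" .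
  qed
qed

lemma weighted_powr_eq:
  fixes t :: real assumes "s > 0"
  shows "\<bar>norm x powr (d / s) * t\<bar> powr s = norm x powr d * \<bar>t\<bar> powr s"
  using assms by (simp add: abs_mult powr_mult powr_powr)

lemma weighted_Lp_space_iff:
  fixes f :: "'a::euclidean_space \<Rightarrow> real"
  assumes "s > 0"
  shows "f \<in> weighted_Lp_space d s \<longleftrightarrow> f \<in> borel_measurable lebesgue \<and>
     (\<integral>\<^sup>+x. ennreal (norm x powr d * \<bar>f x\<bar> powr s) \<partial>lborel) < \<infinity>"
proof -
  have m: "(\<lambda>x::'a. norm x powr q) \<in> borel_measurable lebesgue" for q
    by (intro measurable_completion) measurable
  show ?thesis
    unfolding weighted_Lp_space_def Lp_space_def mem_Collect_eq weighted_powr_eq[OF assms]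
    using borel_measurable_times[OF m]
    by (auto simp: integrable_iff_bounded nn_integral_completion intro!: borel_measurable_times m)
qed

lemma weighted_Lp_norm_eq:
  fixes f :: "'a::euclidean_space \<Rightarrow> real"
  assumes "s > 0" "f \<in> borel_measurable lebesgue"
  shows "weighted_Lp_norm d s f = enn2real (\<integral>\<^sup>+x. ennreal (norm x powr d * \<bar>f x\<bar> powr s) \<partial>lborel) powr (1 / s)"
proof -
  have m: "(\<lambda>x::'a. norm x powr q) \<in> borel_measurable lebesgue" for q
    by (intro measurable_completion) measurable
  show ?thesis
    unfolding weighted_Lp_norm_def Lp_norm_def weighted_powr_eq[OF assms(1)]
    using assms(2) by (subst integral_eq_nn_integral) (auto simp: nn_integral_completion intro!: borel_measurable_times m)
qed

lemma Linf_norm_nonneg: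
  fixes f :: "'a::euclidean_space \<Rightarrow> real"
  assumes "f \<in> borel_measurable lebesgue"
  shows "0 \<le> Linf_norm f"
proof -
  have "esssup lebesgue (\<lambda>x::'a. 0 :: ereal) = 0"
    by (rule esssup_const) simp
  moreover have "esssup lebesgue (\<lambda>x::'a. 0 :: ereal) \<le> esssup lebesgue (\<lambda>x. ereal \<bar>f x\<bar>)"
    by (rule esssup_mono) auto
  ultimately show ?thesis unfolding Linf_norm_def by (simp add: real_of_ereal_pos)
qed

lemma Linf_space_AE_le:
  fixes f :: "'a::euclidean_space \<Rightarrow> real"
  assumes "f \<in> Linf_space"
  shows "AE x in lborel. \<bar>f x\<bar> \<le> Linf_norm f"
proof -
  let ?E = "esssup lebesgue (\<lambda>x. ereal \<bar>f x\<bar>)"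
  have f: "f \<in> borel_measurable lebesgue" "?E < \<infinity>" using assms by (auto simp: Linf_space_def)
  have "esssup lebesgue (\<lambda>x::'a. 0 :: ereal) \<le> ?E" by (rule esssup_mono) auto
  then have "0 \<le> ?E" using esssup_const[of "lebesgue :: 'a measure" "0::ereal"] by simp
  then have "?E = ereal (Linf_norm f)" using f(2) unfolding Linf_norm_def by (cases ?E) auto
  moreover have "AE x in lebesgue. ereal \<bar>f x\<bar> \<le> ?E" by (rule esssup_AE)
  ultimately have "AE x in lebesgue. \<bar>f x\<bar> \<le> Linf_norm f" by simp
  then show ?thesis by (simp only: AE_completion_iff)
qed

lemma has_radial_deriv_unique:
  fixes u g h :: "'a::euclidean_space \<Rightarrow> real"
  assumes g: "has_radial_deriv u g" and h: "has_radial_deriv u h"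
  shows "AE x in lborel. g x = h x"
proof -
  have loc: "u \<in> L1loc_punctured" "g \<in> L1loc_punctured" "h \<in> L1loc_punctured"
    using g h by (auto simp: has_radial_deriv_def)
  obtain u' where u': "u' \<in> borel_measurable borel" "AE x in lborel. u x = u' x"
    "\<And>m M. m > 0 \<Longrightarrow> set_integrable lborel (shell m M) u'"
    by (rule L1loc_punctured_borel_version[OF loc(1)]) (rule that; assumption)
  obtain g' where g': "g' \<in> borel_measurable borel" "AE x in lborel. g x = g' x"
    "\<And>m M. m > 0 \<Longrightarrow> set_integrable lborel (shell m M) g'"
    by (rule L1loc_punctured_borel_version[OF loc(2)]) (rule that; assumption)
  obtain h' where h': "h' \<in> borel_measurable borel" "AE x in lborel. h x = h' x"
    "\<And>m M. m > 0 \<Longrightarrow> set_integrable lborel (shell m M) h'"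
    by (rule L1loc_punctured_borel_version[OF loc(3)]) (rule that; assumption)
  have "AE x in lborel. g' x - h' x = 0"
  proof (rule punctured_fundamental_lemma)
    show "set_integrable lborel (shell m M) (\<lambda>x. g' x - h' x)" if "m > 0" for m M
      using g'(3)[OF that] h'(3)[OF that] by (rule set_integral_diff)
    fix \<theta> :: "'a \<Rightarrow> real" assume \<theta>: "test_function_punctured \<theta>"
    have int: "integrable lborel (\<lambda>x. w x * \<theta> x)"
      if w: "w \<in> borel_measurable borel" "\<And>m M. m > 0 \<Longrightarrow> set_integrable lborel (shell m M) w" for w
      by (rule test_functionE[OF \<theta>])
         (rule set_integrable_mult_bounded[OF w(1) test_function_measurable[OF \<theta>] w(2)]; blast)
    have "(\<integral>x. g' x * \<theta> x \<partial>lborel) = (\<integral>x. h' x * \<theta> x \<partial>lborel)"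
      using has_radial_derivD[OF g u'(1) g'(1) u'(2) g'(2) u'(3) \<theta>]
        has_radial_derivD[OF h u'(1) h'(1) u'(2) h'(2) u'(3) \<theta>] by simp
    then show "(\<integral>x. (g' x - h' x) * \<theta> x \<partial>lborel) = 0"
      using int[OF g'(1,3)] int[OF h'(1,3)] by (simp add: left_diff_distrib)
  qed (use g'(1) h'(1) in measurable)
  with g'(2) h'(2) show ?thesis by eventually_elim simp
qed

lemma embedding_sufficient:
  fixes a b c p r \<sigma> :: real
  defines "\<alpha> \<equiv> - a" and "\<beta> \<equiv> - (b - p + real DIM('a::euclidean_space)) / p"
    and "\<gamma> \<equiv> - (c + real DIM('a)) / r"
  assumes \<sigma>: "\<sigma> = 1 \<or> \<sigma> = -1" and r: "0 < r" "r < p" and p: "1 \<le> p"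
    and ord: "\<sigma> * \<beta> < \<sigma> * \<gamma>" "\<sigma> * \<gamma> < \<sigma> * \<alpha>" and sgn: "0 < \<sigma> * \<gamma> \<or> \<sigma> * \<alpha> < 0"
  shows "continuously_embedded
           (W_space a b p :: ('a \<Rightarrow> real) set) (W_norm a b p)
           (weighted_Lp_space c r) (weighted_Lp_norm c r)"
proof -
  from embedding_estimate[OF \<sigma> r p ord sgn, where 'a='a]
  obtain K where K: "K \<ge> 0" and est: "\<And>u g s. u \<in> borel_measurable borel \<Longrightarrow> g \<in> borel_measurable borel \<Longrightarrow> s > 0 \<Longrightarrow>
     AE x in lborel. \<bar>u x\<bar> \<le> s * norm (x::'a) powr \<alpha> \<Longrightarrow>
     (\<integral>\<^sup>+x. ennreal (norm x powr (p - \<beta> * p) * \<bar>g x\<bar> powr p) \<partial>dilation_measure) \<le> ennreal (s powr p) \<Longrightarrow>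
     AE x in lborel. u (2 *\<^sub>R x) - u x = norm x * radial_mean g x \<Longrightarrow>
     (\<integral>\<^sup>+x. ennreal (norm x powr (- \<gamma> * r) * \<bar>u x\<bar> powr r) \<partial>dilation_measure) \<le> ennreal (K * s powr r)"
    by blast
  have lb: "(\<integral>\<^sup>+x. ennreal (norm x powr e * \<bar>f x\<bar> powr q) \<partial>dilation_measure)
      = (\<integral>\<^sup>+x. ennreal (norm x powr (e - real DIM('a)) * \<bar>f x\<bar> powr q) \<partial>lborel)"
    if [measurable]: "f \<in> borel_measurable borel" for f :: "'a \<Rightarrow> real" and e q
    by (subst nn_integral_dilation_measure)
       (auto simp: ennreal_mult[symmetric] powr_diff powr_minus field_simps intro!: nn_integral_cong)
  have e1: "p - \<beta> * p - real DIM('a) = b" using p by (simp add: \<beta>_def field_simps)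
  have e2: "- \<gamma> * r - real DIM('a) = c" using r by (simp add: \<gamma>_def field_simps)
  have main: "u \<in> weighted_Lp_space c r \<and> weighted_Lp_norm c r u \<le> K powr (1 / r) * W_norm a b p u"
    if uW: "u \<in> W_space a b p" for u :: "'a \<Rightarrow> real"
  proof -
    obtain g1 where u: "u \<in> L1loc_punctured" "(\<lambda>x. norm x powr a * u x) \<in> Linf_space"
      and g1: "g1 \<in> weighted_Lp_space b p" "has_radial_deriv u g1"
      using uW by (auto simp: W_space_def)
    define g where "g = radial_deriv u"
    have g: "has_radial_deriv u g" unfolding g_def radial_deriv_def by (rule someI[of "has_radial_deriv u" g1]) (rule g1(2))
    have gloc: "g \<in> L1loc_punctured" using g by (simp add: has_radial_deriv_def)
    obtain u' where um: "u \<in> borel_measurable lebesgue" and u': "u' \<in> borel_measurable borel" "AE x in lborel. u x = u' x"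
      "\<And>m M. m > 0 \<Longrightarrow> set_integrable lborel (shell m M) u'"
      by (rule L1loc_punctured_borel_version[OF u(1)]) (rule that; assumption)
    obtain g' where gm: "g \<in> borel_measurable lebesgue" and g': "g' \<in> borel_measurable borel" "AE x in lborel. g x = g' x"
      "\<And>m M. m > 0 \<Longrightarrow> set_integrable lborel (shell m M) g'"
      by (rule L1loc_punctured_borel_version[OF gloc]) (rule that; assumption)
    let ?G = "\<integral>\<^sup>+x. ennreal (norm x powr b * \<bar>g' x\<bar> powr p) \<partial>lborel"
    have p0: "p > 0" using p by simp
    have Geq: "?G = (\<integral>\<^sup>+x. ennreal (norm x powr b * \<bar>g x\<bar> powr p) \<partial>lborel)"
      by (rule nn_integral_cong_AE) (use g'(2) in \<open>eventually_elim, simp\<close>)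
    also have "\<dots> = (\<integral>\<^sup>+x. ennreal (norm x powr b * \<bar>g1 x\<bar> powr p) \<partial>lborel)"
      by (rule nn_integral_cong_AE) (use has_radial_deriv_unique[OF g g1(2)] in \<open>eventually_elim, simp\<close>)
    also have "\<dots> < \<infinity>" using g1(1) by (simp add: weighted_Lp_space_iff[OF p0])
    finally have Gfin: "?G < \<infinity>" .
    let ?g = "weighted_Lp_norm b p g"
    have gn: "?g = enn2real ?G powr (1 / p)" unfolding Geq by (rule weighted_Lp_norm_eq[OF p0 gm])
    have g0: "?g \<ge> 0" by (simp add: gn)
    have Gs: "?G = ennreal (?g powr p)"
      using Gfin p0 by (simp add: gn powr_powr)
    let ?M = "Linf_norm (\<lambda>x. norm x powr a * u x)"
    have M0: "?M \<ge> 0" using u(2) by (intro Linf_norm_nonneg) (simp add: Linf_space_def)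
    have uM: "AE x in lborel. \<bar>u' x\<bar> \<le> ?M * norm x powr \<alpha>"
      using Linf_space_AE_le[OF u(2)] u'(2) AE_lborel_singleton[of "0::'a"]
    proof eventually_elim
      case (elim x)
      then have "norm x powr a * \<bar>u' x\<bar> \<le> ?M" by (simp add: abs_mult)
      then show ?case using elim(3) by (simp add: \<alpha>_def powr_minus field_simps)
    qed
    have id: "AE x in lborel. u' (2 *\<^sub>R x) - u' x = norm x * radial_mean g' x"
      by (rule dyadic_difference_eq_radial_mean[OF u'(1) g'(1) u'(3) g'(3)])
         (use has_radial_derivD[OF g u'(1) g'(1) u'(2) g'(2) u'(3)] in auto)
    let ?Y = "\<integral>\<^sup>+x. ennreal (norm x powr c * \<bar>u x\<bar> powr r) \<partial>lborel"
    have bound: "?Y \<le> ennreal (K * s powr r)" if s: "s > 0" "?M \<le> s" "?g \<le> s" for s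
    proof -
      have "?Y = (\<integral>\<^sup>+x. ennreal (norm x powr c * \<bar>u' x\<bar> powr r) \<partial>lborel)"
        by (rule nn_integral_cong_AE) (use u'(2) in \<open>eventually_elim, simp\<close>)
      also have "\<dots> = (\<integral>\<^sup>+x. ennreal (norm x powr (- \<gamma> * r) * \<bar>u' x\<bar> powr r) \<partial>dilation_measure)"
        by (simp only: lb[OF u'(1)] e2)
      also have "\<dots> \<le> ennreal (K * s powr r)"
      proof (rule est[OF u'(1) g'(1) s(1) _ _ id])
        show "AE x in lborel. \<bar>u' x\<bar> \<le> s * norm x powr \<alpha>"
          using uM by eventually_elim (use s(2) in \<open>meson mult_right_mono order_trans powr_ge_zero\<close>)
        have "?G \<le> ennreal (s powr p)" unfolding Gs using g0 s(3) p0 by (intro ennreal_leI powr_mono2) auto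
        then show "(\<integral>\<^sup>+x. ennreal (norm x powr (p - \<beta> * p) * \<bar>g' x\<bar> powr p) \<partial>dilation_measure) \<le> ennreal (s powr p)"
          by (simp only: lb[OF g'(1)] e1)
      qed
      finally show ?thesis .
    qed
    have W: "W_norm a b p u = ?M + ?g" by (simp add: W_norm_def g_def)
    have "?Y < \<infinity>"
      using bound[of "?M + ?g + 1"] M0 g0 by (simp add: order_le_less_trans)
    then have "u \<in> weighted_Lp_space c r" using um by (simp add: weighted_Lp_space_iff[OF r(1)])
    moreover have yb: "weighted_Lp_norm c r u \<le> K powr (1 / r) * s" if s: "s > 0" "?M \<le> s" "?g \<le> s" for s
    proof -
      have "enn2real ?Y \<le> K * s powr r" using bound[OF s] K by (simp add: enn2real_leI)
      then have "enn2real ?Y powr (1 / r) \<le> (K * s powr r) powr (1 / r)"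
        using r by (intro powr_mono2) auto
      also have "\<dots> = K powr (1 / r) * s" using r s K by (simp add: powr_mult powr_powr)
      finally show ?thesis by (simp add: weighted_Lp_norm_eq[OF r(1) um])
    qed
    \<comment> \<open>The estimate needs \<open>s > 0\<close>, but the norm of \<open>u\<close> may be zero; so \<open>s\<close> decreases to the norm.\<close>
    have "weighted_Lp_norm c r u \<le> K powr (1 / r) * W_norm a b p u"
    proof (rule field_le_epsilon)
      fix e :: real assume e: "e > 0"
      let ?k = "K powr (1 / r)"
      have k: "?k \<ge> 0" by simp
      have le1: "t / (t + 1) \<le> 1" if "t \<ge> 0" for t :: real using that by (simp add: divide_le_eq_1)
      have "weighted_Lp_norm c r u \<le> ?k * (?M + ?g + e / (?k + 1))"
        using M0 g0 e k by (intro yb) (auto simp: add_nonneg_pos)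
      also have "\<dots> = ?k * (?M + ?g) + ?k / (?k + 1) * e" by (simp add: field_simps)
      also have "\<dots> \<le> ?k * (?M + ?g) + 1 * e" using k e by (intro add_left_mono mult_right_mono le1) auto
      finally show "weighted_Lp_norm c r u \<le> ?k * W_norm a b p u + e" by (simp add: W)
    qed
    ultimately show ?thesis by blast
  qed
  show ?thesis unfolding continuously_embedded_def
  proof (intro conjI subsetI exI ballI)
    show "u \<in> weighted_Lp_space c r" if "u \<in> W_space a b p" for u :: "'a \<Rightarrow> real" using main[OF that] by blast
    show "weighted_Lp_norm c r u \<le> K powr (1 / r) * W_norm a b p u" if "u \<in> W_space a b p" for u :: "'a \<Rightarrow> real" using main[OF that] by blast
  qed
qed

section \<open>Radial functions\<close>

text \<open>
  The difference quotients of \<open>F\<close> have integral zero by translation invariance. They are bounded by the mean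
  value theorem, so dominated convergence applies.
\<close>

lemma integral_partial_derivative_eq_0:
  fixes F :: "'a::euclidean_space \<Rightarrow> real"
  assumes d: "\<And>x. (F has_derivative F' x) (at x)" and i: "i \<in> Basis"
    and F'_meas: "(\<lambda>x. F' x i) \<in> borel_measurable borel" and C: "\<And>x. \<bar>F' x i\<bar> \<le> C"
    and supp: "\<And>x. norm x > M \<Longrightarrow> F x = 0"
  shows "(\<integral>x. F' x i \<partial>lborel) = 0"
proof -
  define h where "h n = inverse (real (Suc n))" for n
  have h: "0 < h n" "h n \<le> 1" "h n \<noteq> 0" for n by (auto simp: h_def inverse_eq_divide)
  have hlim: "h \<longlonglongrightarrow> 0" unfolding h_def by (rule LIMSEQ_inverse_real_of_nat)
  have cont: "continuous_on UNIV F"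
    using d by (meson continuous_at_imp_continuous_on has_derivative_continuous)
  then have Fm[measurable]: "F \<in> borel_measurable borel" by (rule borel_measurable_continuous_onI)
  have Fi: "integrable lborel F"
  proof -
    have "integrable lborel (\<lambda>x. indicator (cball 0 M) x *\<^sub>R F x)"
      by (rule borel_integrable_compact) (auto intro: continuous_on_subset[OF cont])
    also have "(\<lambda>x. indicator (cball 0 M) x *\<^sub>R F x) = F"
      using supp by (auto simp: fun_eq_iff indicator_def not_le)
    finally show ?thesis .
  qed
  have tr: "integrable lborel (\<lambda>x. F (v + x))" "(\<integral>x. F (v + x) \<partial>lborel) = (\<integral>x. F x \<partial>lborel)" for v
  proof -
    have "integrable (distr lborel borel ((+) v)) F" using Fi by (simp only: lborel_distr_plus)
    then show "integrable lborel (\<lambda>x. F (v + x))" by (subst (asm) integrable_distr_eq) auto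
    have "(\<integral>x. F x \<partial>distr lborel borel ((+) v)) = (\<integral>x. F (v + x) \<partial>lborel)" by (rule integral_distr) auto
    then show "(\<integral>x. F (v + x) \<partial>lborel) = (\<integral>x. F x \<partial>lborel)" by (simp only: lborel_distr_plus)
  qed
  define q where "q n x = (F (h n *\<^sub>R i + x) - F x) / h n" for n x
  have C0: "C \<ge> 0" using C[of 0] by linarith
  have line: "((\<lambda>t. F (t *\<^sub>R i + x)) has_real_derivative F' (t *\<^sub>R i + x) i) (at t)" for t x
  proof -
    have "((\<lambda>t. F (t *\<^sub>R i + x)) has_derivative (\<lambda>k. F' (t *\<^sub>R i + x) (k *\<^sub>R i))) (at t)"
      by (rule has_derivative_compose[of "\<lambda>t. t *\<^sub>R i + x" _ t UNIV, OF _ d]) (auto intro!: derivative_eq_intros)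
    then show ?thesis
      using linear_cmul[OF has_derivative_linear[OF d]]
      by (simp add: has_field_derivative_def mult.commute[of _ "F' _ i"] fun_eq_iff)
  qed
  have qb: "\<bar>q n x\<bar> \<le> C" for n x
  proof -
    obtain z where "F (h n *\<^sub>R i + x) - F (0 *\<^sub>R i + x) = (h n - 0) * F' (z *\<^sub>R i + x) i"
      using MVT2[of 0 "h n" "\<lambda>t. F (t *\<^sub>R i + x)" "\<lambda>t. F' (t *\<^sub>R i + x) i"] line h(1) by auto
    then have "q n x = F' (z *\<^sub>R i + x) i" using h(3) by (simp add: q_def)
    then show ?thesis using C by simp
  qed
  have "(\<lambda>n. \<integral>x. q n x \<partial>lborel) \<longlonglongrightarrow> (\<integral>x. F' x i \<partial>lborel)"
  proof (rule integral_dominated_convergence[where w="\<lambda>x. C * indicator (cball 0 (M + 1)) x"])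
    have "emeasure lborel (cball (0::'a) (M + 1)) < \<infinity>" using emeasure_bounded_finite[of "cball (0::'a) (M + 1)"] by simp
    then show "integrable lborel (\<lambda>x. C * indicator (cball (0::'a) (M + 1)) x)" by simp
    show "AE x in lborel. (\<lambda>n. q n x) \<longlonglongrightarrow> F' x i"
    proof (rule AE_I2)
      fix x
      have "((\<lambda>k. (F ((0 + k) *\<^sub>R i + x) - F (0 *\<^sub>R i + x)) / k) \<longlongrightarrow> F' (0 *\<^sub>R i + x) i) (at 0)"
        using line[of x 0] by (simp only: DERIV_def)
      then have "((\<lambda>k. (F (k *\<^sub>R i + x) - F x) / k) \<longlongrightarrow> F' x i) (at 0)" by simp
      then show "(\<lambda>n. q n x) \<longlonglongrightarrow> F' x i" unfolding q_def
        by (rule filterlim_compose) (use hlim h(3) in \<open>auto simp: filterlim_at\<close>)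
    qed
    show "AE x in lborel. norm (q n x) \<le> C * indicator (cball 0 (M + 1)) x" for n
    proof (rule AE_I2)
      fix x
      have "q n x = 0" if "norm x > M + 1"
      proof -
        have "norm (h n *\<^sub>R i) \<le> 1" using h[of n] i by simp
        then have "norm (h n *\<^sub>R i + x) > M" using that norm_triangle_ineq2[of x "- (h n *\<^sub>R i)"] by (simp add: add.commute)
        then show ?thesis using supp that by (simp add: q_def)
      qed
      then show "norm (q n x) \<le> C * indicator (cball 0 (M + 1)) x"
        using qb[of n x] by (auto simp: indicator_def not_le)
    qed
  qed (use F'_meas in \<open>auto simp: q_def\<close>)
  moreover have "(\<integral>x. q n x \<partial>lborel) = 0" for n
    unfolding q_def using tr[of "h n *\<^sub>R i"] Fi by simp
  ultimately show ?thesis using LIMSEQ_unique[OF _ tendsto_const] by simp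
qed

lemma continuous_on_L1loc_punctured:
  fixes u :: "'a::euclidean_space \<Rightarrow> real"
  assumes "continuous_on (- {0}) u"
  shows "u \<in> L1loc_punctured" "m > 0 \<Longrightarrow> set_integrable lborel (shell m M) u"
proof -
  have i: "integrable lborel (\<lambda>x. indicator K x *\<^sub>R u x)" if "compact K" "0 \<notin> K" for K
    by (rule borel_integrable_compact) (use that assms in \<open>auto intro: continuous_on_subset\<close>)
  show "u \<in> L1loc_punctured" unfolding L1loc_punctured_def set_integrable_def
    using i by (auto simp: integrable_completion borel_measurable_integrable)
  show "set_integrable lborel (shell m M) u" if "m > 0"
    unfolding set_integrable_def by (rule i[OF compact_shell]) (use that in \<open>auto simp: shell_def\<close>)
qed

lemma has_radial_deriv_radial:
  fixes H H' :: "real \<Rightarrow> real"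
  assumes d: "\<And>t. (H has_real_derivative H' t) (at t)" and H': "continuous_on UNIV H'"
  shows "has_radial_deriv (\<lambda>x::'a::euclidean_space. H (ln (norm x))) (\<lambda>x. H' (ln (norm x)) / norm x)"
proof -
  define u where "u x = H (ln (norm x))" for x :: 'a
  define g where "g x = H' (ln (norm x)) / norm x" for x :: 'a
  have H: "continuous_on UNIV H" using d by (meson DERIV_continuous continuous_at_imp_continuous_on)
  have cu: "continuous_on (- {0}) u" unfolding u_def
    by (intro continuous_on_compose2[OF H] continuous_intros) auto
  have cg: "continuous_on (- {0}) g" unfolding g_def
    by (intro continuous_on_compose2[OF H'] continuous_intros) auto
  have [measurable]: "H \<in> borel_measurable borel" "H' \<in> borel_measurable borel"
    using H H' by (auto intro: borel_measurable_continuous_onI)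
  have [measurable]: "u \<in> borel_measurable borel" "g \<in> borel_measurable borel"
    unfolding u_def g_def by measurable
  have bdd: "\<exists>B. \<forall>x\<in>shell m M. \<bar>f x\<bar> \<le> B" if f: "continuous_on (- {0}) f" and m: "m > 0" for f :: "'a \<Rightarrow> real" and m M
  proof -
    have "compact (f ` shell m M)"
      by (rule compact_continuous_image[OF continuous_on_subset[OF f] compact_shell]) (use m in \<open>auto simp: shell_def\<close>)
    then show ?thesis using compact_imp_bounded[of "f ` shell m M"] unfolding bounded_iff by auto
  qed
  have "radial_deriv_distr u \<theta> = (\<integral>x. g x * \<theta> x \<partial>lebesgue)" if \<theta>: "test_function_punctured \<theta>" for \<theta>
  proof -
    note [measurable] = test_function_measurable[OF \<theta>]
    let ?V = "\<lambda>i y. \<theta> y * ((y \<bullet> i) / norm y)"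
    let ?DV = "radial_partial \<theta>"
    obtain m M C where m: "m > 0" and th: "\<And>x. x \<notin> shell m M \<Longrightarrow> \<theta> x = 0" "\<And>x. \<bar>\<theta> x\<bar> \<le> C"
      and D: "\<And>i x. i \<in> Basis \<Longrightarrow> x \<notin> shell m M \<Longrightarrow> ?DV i x = 0"
        "\<And>i x. i \<in> Basis \<Longrightarrow> \<bar>?DV i x\<bar> \<le> C"
      by (rule radial_partial_bounds[OF \<theta>]) (rule that; assumption)
    note Dm[measurable] = radial_partial_measurable[OF \<theta>]
    have C: "C \<ge> 0" using th(2)[of 0] by linarith
    obtain Bu where Bu: "\<And>x. x \<in> shell m M \<Longrightarrow> \<bar>u x\<bar> \<le> Bu" using bdd[OF cu m] by blast
    obtain Bg where Bg: "\<And>x. x \<in> shell m M \<Longrightarrow> \<bar>g x\<bar> \<le> Bg" using bdd[OF cg m] by blast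
    define e where "e i x = \<theta> x * ((x \<bullet> i) / norm x * ((x \<bullet> i) / norm x))" for i x
    have eC: "\<bar>e i x\<bar> \<le> C" if i: "i \<in> Basis" for i x
    proof -
      have "\<bar>(x \<bullet> i) / norm x\<bar> \<le> 1" using Basis_le_norm[OF i, of x] by (simp add: abs_divide divide_le_eq_1)
      then have "\<bar>(x \<bullet> i) / norm x * ((x \<bullet> i) / norm x)\<bar> \<le> 1" unfolding abs_mult by (intro mult_le_one) auto
      then have "\<bar>e i x\<bar> \<le> C * 1" unfolding e_def abs_mult[of "\<theta> x"] by (intro mult_mono th C) auto
      then show ?thesis by simp
    qed
    have int_e: "integrable lborel (\<lambda>x. g x * e i x)" if i: "i \<in> Basis" for i
      by (rule set_integrable_mult_bounded[OF _ _ continuous_on_L1loc_punctured(2)[OF cg m, of M], where C=C])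
         (use eC[OF i] th(1) in \<open>auto simp: e_def[abs_def]\<close>)
    have part: "- (\<integral>x. u x * ?DV i x \<partial>lborel) = (\<integral>x. g x * e i x \<partial>lborel)" if i: "i \<in> Basis" for i
    proof -
      \<comment> \<open>The derivative of the \<open>i\<close>-th component of \<open>u \<theta> x/|x|\<close>; all functions involved vanish near the origin.\<close>
      define F' where "F' x k = (if x = 0 then 0 else u x * frechet_derivative (?V i) (at x) k
         + (H' (ln (norm x)) * ((x \<bullet> k) / (norm x * norm x))) * ?V i x)" for x k
      have F'i: "F' x i = u x * ?DV i x + g x * e i x" for x
      proof (cases "x = 0")
        case True
        then show ?thesis using D(1)[OF i, of 0] th(1)[of 0] m by (simp add: F'_def e_def shell_def)
      next
        case False
        then show ?thesis by (simp add: F'_def g_def e_def field_simps)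
      qed
      have "(\<integral>x. F' x i \<partial>lborel) = 0"
      proof (rule integral_partial_derivative_eq_0[where F="\<lambda>x. u x * ?V i x" and C="\<bar>Bu\<bar> * C + \<bar>Bg\<bar> * C" and M=M])
        show "((\<lambda>x. u x * ?V i x) has_derivative F' x) (at x)" for x
        proof (cases "x = 0")
          case True
          have "((\<lambda>x. u x * ?V i x) has_derivative (\<lambda>_. 0)) (at x)"
            by (rule has_derivative_transform_within_open[of "\<lambda>_. 0" _ _ _ "ball 0 m"])
               (use True m th(1) in \<open>auto simp: shell_def\<close>)
          then show ?thesis using True by (simp add: F'_def[abs_def])
        next
          case False
          have "((\<lambda>x. ln (norm x)) has_derivative (\<lambda>k. (x \<bullet> k) / (norm x * norm x))) (at x)"
            by (rule has_derivative_eq_rhs[OF has_derivative_ln[OF _ has_derivative_norm[OF False]]])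
               (use False in \<open>auto simp: sgn_div_norm fun_eq_iff field_simps inner_commute\<close>)
          then have "(u has_derivative (\<lambda>k. H' (ln (norm x)) * ((x \<bullet> k) / (norm x * norm x)))) (at x)"
            unfolding u_def
            by (rule has_derivative_compose[of "\<lambda>x. ln (norm x)" _ x UNIV, OF _ d[unfolded has_field_derivative_def]])
          from has_derivative_mult[OF this frechet_derivative_works[THEN iffD1, OF differentiableI[OF has_derivative_radial_component[OF \<theta>, of i x]]]]
          show ?thesis by (rule has_derivative_eq_rhs) (use False in \<open>simp add: F'_def fun_eq_iff\<close>)
        qed
        show "\<bar>F' x i\<bar> \<le> \<bar>Bu\<bar> * C + \<bar>Bg\<bar> * C" for x
        proof (cases "x \<in> shell m M")
          case True
          have "\<bar>u x\<bar> \<le> \<bar>Bu\<bar>" "\<bar>g x\<bar> \<le> \<bar>Bg\<bar>" using Bu[OF True] Bg[OF True] by linarith+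
          then have "\<bar>u x * ?DV i x\<bar> \<le> \<bar>Bu\<bar> * C" "\<bar>g x * e i x\<bar> \<le> \<bar>Bg\<bar> * C"
            unfolding abs_mult by (intro mult_mono D eC i; simp)+
          then show ?thesis unfolding F'i by linarith
        next
          case False
          then show ?thesis unfolding F'i using D(1)[OF i False] th(1)[OF False] C by (simp add: e_def)
        qed
        show "(\<lambda>x. F' x i) \<in> borel_measurable borel"
          using Dm[OF i] unfolding F'i e_def by measurable
        show "u x * ?V i x = 0" if "norm x > M" for x using that th(1)[of x] by (simp add: shell_def)
      qed (rule i)
      then have "(\<integral>x. u x * ?DV i x + g x * e i x \<partial>lborel) = 0" by (simp only: F'i)
      moreover have "integrable lborel (\<lambda>x. u x * ?DV i x)"
        by (rule set_integrable_mult_bounded[OF _ _ continuous_on_L1loc_punctured(2)[OF cu m]]) (use i D Dm in auto)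
      ultimately show ?thesis using int_e[OF i] by simp
    qed
    have "(\<integral>x. u x * ?DV i x \<partial>lebesgue) = (\<integral>x. u x * ?DV i x \<partial>lborel)" if i: "i \<in> Basis" for i
    proof (rule integral_completion)
      note [measurable] = Dm[OF i]
      show "(\<lambda>x. u x * ?DV i x) \<in> borel_measurable lborel" by measurable
    qed
    then have "radial_deriv_distr u \<theta> = (\<Sum>i\<in>Basis. - (\<integral>x. u x * ?DV i x \<partial>lborel))"
      unfolding radial_deriv_distr_def by (intro sum.cong refl arg_cong[where f=uminus])
    also have "\<dots> = (\<Sum>i\<in>Basis. \<integral>x. g x * e i x \<partial>lborel)" by (intro sum.cong refl part)
    also have "\<dots> = (\<integral>x. (\<Sum>i\<in>Basis. g x * e i x) \<partial>lborel)"
      by (rule Bochner_Integration.integral_sum[symmetric]) (rule int_e)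
    also have "\<dots> = (\<integral>x. g x * \<theta> x \<partial>lborel)"
    proof (rule Bochner_Integration.integral_cong[OF refl])
      fix x :: 'a
      show "(\<Sum>i\<in>Basis. g x * e i x) = g x * \<theta> x"
      proof (cases "x = 0")
        case True
        then show ?thesis by (simp add: g_def)
      next
        case False
        have "(\<Sum>i\<in>Basis. (x \<bullet> i) / norm x * ((x \<bullet> i) / norm x)) = (\<Sum>i\<in>Basis. (x \<bullet> i) * (x \<bullet> i)) / (norm x * norm x)"
          by (simp add: sum_divide_distrib)
        also have "\<dots> = 1" using False
          by (metis euclidean_inner dot_square_norm power2_eq_square divide_self mult_eq_0_iff norm_eq_zero)
        finally show ?thesis by (simp add: e_def sum_distrib_left[symmetric] del: times_divide_eq_left times_divide_eq_right)
      qed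
    qed
    also have "\<dots> = (\<integral>x. g x * \<theta> x \<partial>lebesgue)" by (rule integral_completion[symmetric]) simp
    finally show ?thesis .
  qed
  then show ?thesis using continuous_on_L1loc_punctured(1)[OF cu] continuous_on_L1loc_punctured(1)[OF cg]
    unfolding has_radial_deriv_def u_def g_def by auto
qed

section \<open>Necessity\<close>

text \<open>
  In the variable \<open>t = ln |x|\<close> the weights become exponentials, and the three conditions on \<open>u = H (ln |x|)\<close>
  become conditions on \<open>H\<close> alone.
\<close>

lemma radial_counterexample:
  fixes a b c p r :: real and H H' :: "real \<Rightarrow> real"
  defines "\<alpha> \<equiv> - a" and "\<beta> \<equiv> - (b - p + real DIM('a::euclidean_space)) / p"
    and "\<gamma> \<equiv> - (c + real DIM('a)) / r"
  assumes p: "p > 0" and r: "r > 0"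
    and d: "\<And>t. (H has_real_derivative H' t) (at t)" and H': "continuous_on UNIV H'"
    and bound: "\<And>t. \<bar>H t\<bar> \<le> exp (\<alpha> * t)"
    and fin: "(\<integral>\<^sup>+t. ennreal (exp (- \<beta> * p * t) * \<bar>H' t\<bar> powr p) \<partial>lborel) < \<infinity>"
    and inf: "(\<integral>\<^sup>+t. ennreal (exp (- \<gamma> * r * t) * \<bar>H t\<bar> powr r) \<partial>lborel) = \<infinity>"
  shows "\<not> (W_space a b p :: ('a \<Rightarrow> real) set) \<subseteq> weighted_Lp_space c r"
proof -
  define u where "u x = H (ln (norm x))" for x :: 'a
  define g where "g x = H' (ln (norm x)) / norm x" for x :: 'a
  have H: "continuous_on UNIV H" using d by (meson DERIV_continuous continuous_at_imp_continuous_on)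
  have [measurable]: "H \<in> borel_measurable borel" "H' \<in> borel_measurable borel"
    using H H' by (auto intro: borel_measurable_continuous_onI)
  have [measurable]: "u \<in> borel_measurable borel" "g \<in> borel_measurable borel"
    unfolding u_def g_def by measurable
  have leb: "u \<in> borel_measurable lebesgue" "g \<in> borel_measurable lebesgue"
    by (auto intro!: measurable_completion)
  have rad: "has_radial_deriv u g" unfolding u_def g_def by (rule has_radial_deriv_radial[OF d H'])
  have conv: "(\<integral>\<^sup>+x. ennreal (norm x powr e * f (ln (norm x))) \<partial>(lborel :: 'a measure))
     = radial_mass TYPE('a) * (\<integral>\<^sup>+t. ennreal (exp ((e + real DIM('a)) * t) * f t) \<partial>lborel)"
    if [measurable]: "f \<in> borel_measurable borel" and f0: "\<And>t. f t \<ge> 0" for f :: "real \<Rightarrow> real" and e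
  proof -
    have "(\<integral>\<^sup>+x. ennreal (norm x powr e * f (ln (norm x))) \<partial>(lborel :: 'a measure))
       = (\<integral>\<^sup>+x. ennreal (norm x powr - real DIM('a)) * ennreal (exp ((e + real DIM('a)) * ln (norm x)) * f (ln (norm x))) \<partial>(lborel :: 'a measure))"
    proof (intro nn_integral_cong)
      fix x :: 'a
      have "norm x powr e = norm x powr - real DIM('a) * exp ((e + real DIM('a)) * ln (norm x))"
        by (simp add: powr_def exp_add[symmetric] algebra_simps)
      then show "ennreal (norm x powr e * f (ln (norm x)))
        = ennreal (norm x powr - real DIM('a)) * ennreal (exp ((e + real DIM('a)) * ln (norm x)) * f (ln (norm x)))"
        using f0 by (simp add: ennreal_mult[symmetric] mult.assoc)
    qed
    also have "\<dots> = (\<integral>\<^sup>+x. ennreal (exp ((e + real DIM('a)) * ln (norm x)) * f (ln (norm x))) \<partial>(dilation_measure :: 'a measure))"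
      by (rule nn_integral_dilation_measure[symmetric]) measurable
    also have "\<dots> = radial_mass TYPE('a) * (\<integral>\<^sup>+t. ennreal (exp ((e + real DIM('a)) * t) * f t) \<partial>lborel)"
      by (rule nn_integral_radial) measurable
    finally show ?thesis .
  qed
  have e1: "b - p + real DIM('a) = - \<beta> * p" using p by (simp add: \<beta>_def)
  have e2: "c + real DIM('a) = - \<gamma> * r" using r by (simp add: \<gamma>_def)
  have "(\<lambda>x. norm x powr a * u x) \<in> Linf_space"
  proof -
    have m: "(\<lambda>x. norm x powr a * u x) \<in> borel_measurable lebesgue"
      by (intro measurable_completion) measurable
    have "AE x in lebesgue. ereal \<bar>norm x powr a * u x\<bar> \<le> 1"
    proof (intro AE_completion, rule AE_I2)
      fix x :: 'a
      show "ereal \<bar>norm x powr a * u x\<bar> \<le> 1"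
      proof (cases "x = 0")
        case False
        have "\<bar>u x\<bar> \<le> norm x powr \<alpha>" using bound[of "ln (norm x)"] False by (simp add: u_def powr_def)
        then have "norm x powr a * \<bar>u x\<bar> \<le> norm x powr a * norm x powr \<alpha>" by (intro mult_left_mono) auto
        also have "\<dots> = 1" using False by (simp add: powr_add[symmetric] \<alpha>_def)
        finally show ?thesis by (simp add: abs_mult)
      qed simp
    qed
    then have "esssup lebesgue (\<lambda>x. ereal \<bar>norm x powr a * u x\<bar>) \<le> 1"
      using m by (intro esssup_I) auto
    then have "esssup lebesgue (\<lambda>x. ereal \<bar>norm x powr a * u x\<bar>) < \<infinity>" by (rule le_less_trans) simp
    then show ?thesis using m by (simp add: Linf_space_def)
  qed
  moreover have "g \<in> weighted_Lp_space b p"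
  proof -
    have "(\<integral>\<^sup>+x. ennreal (norm x powr b * \<bar>g x\<bar> powr p) \<partial>lborel)
        = (\<integral>\<^sup>+x. ennreal (norm x powr (b - p) * \<bar>H' (ln (norm x))\<bar> powr p) \<partial>(lborel :: 'a measure))"
      by (intro nn_integral_cong) (simp add: g_def powr_divide powr_diff)
    also have "\<dots> = radial_mass TYPE('a) * (\<integral>\<^sup>+t. ennreal (exp (- \<beta> * p * t) * \<bar>H' t\<bar> powr p) \<partial>lborel)"
      using conv[of "\<lambda>t. \<bar>H' t\<bar> powr p" "b - p"] by (simp only: e1) simp
    also have "\<dots> < \<infinity>" using fin radial_mass_finite[where 'a='a] by (simp add: ennreal_mult_less_top)
    finally show ?thesis using leb by (simp add: weighted_Lp_space_iff[OF p])
  qed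
  ultimately have "u \<in> W_space a b p"
    using rad by (auto simp: W_space_def has_radial_deriv_def)
  moreover have "u \<notin> weighted_Lp_space c r"
  proof -
    have "(\<integral>\<^sup>+x. ennreal (norm x powr c * \<bar>u x\<bar> powr r) \<partial>lborel)
        = radial_mass TYPE('a) * (\<integral>\<^sup>+t. ennreal (exp (- \<gamma> * r * t) * \<bar>H t\<bar> powr r) \<partial>lborel)"
      using conv[of "\<lambda>t. \<bar>H t\<bar> powr r" c] unfolding u_def by (simp only: e2) simp
    also have "\<dots> = \<infinity>" using radial_mass_pos[where 'a='a] unfolding inf by (simp add: ennreal_mult_top)
    finally show ?thesis by (simp add: weighted_Lp_space_iff[OF r])
  qed
  ultimately show ?thesis by blast
qed

text \<open>
  Functions \<open>H t = exp (\<delta> t) k (\<sigma> t)\<close> with \<open>k\<close> supported in \<open>[0, \<infinity>)\<close>, which live on \<open>|x| \<ge> 1\<close> if \<open>\<sigma> = 1\<close>, and on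
  \<open>|x| \<le> 1\<close> if \<open>\<sigma> = - 1\<close>.
\<close>

lemma one_sided_counterexample:
  fixes a b c p r \<sigma> \<delta> :: real and k k' :: "real \<Rightarrow> real"
  defines "\<alpha> \<equiv> - a" and "\<beta> \<equiv> - (b - p + real DIM('a::euclidean_space)) / p"
    and "\<gamma> \<equiv> - (c + real DIM('a)) / r"
  assumes p: "p > 0" and r: "r > 0" and \<sigma>: "\<sigma> = 1 \<or> \<sigma> = -1"
    and d: "\<And>t. (k has_real_derivative k' t) (at t)" and k': "continuous_on UNIV k'"
    and zero: "\<And>t. t \<le> 0 \<Longrightarrow> k t = 0" "\<And>t. t \<le> 0 \<Longrightarrow> k' t = 0" and k1: "\<And>t. \<bar>k t\<bar> \<le> 1"
    and \<delta>\<alpha>: "\<sigma> * (\<delta> - \<alpha>) \<le> 0"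
    and fin: "(\<integral>\<^sup>+t. ennreal (exp (\<sigma> * (\<delta> - \<beta>) * p * t) * \<bar>\<delta> * k t + \<sigma> * k' t\<bar> powr p) * indicator {0..} t \<partial>lborel) < \<infinity>"
    and inf: "(\<integral>\<^sup>+t. ennreal (exp (\<sigma> * (\<delta> - \<gamma>) * r * t) * \<bar>k t\<bar> powr r) \<partial>lborel) = \<infinity>"
  shows "\<not> (W_space a b p :: ('a \<Rightarrow> real) set) \<subseteq> weighted_Lp_space c r"
proof (rule radial_counterexample[OF p r])
  have k: "continuous_on UNIV k" using d by (meson DERIV_continuous continuous_at_imp_continuous_on)
  have [measurable]: "k \<in> borel_measurable borel" "k' \<in> borel_measurable borel"
    using k k' by (auto intro: borel_measurable_continuous_onI)
  have \<sigma>\<sigma>: "\<sigma> * \<sigma> = 1" "\<sigma> * (\<sigma> * t) = t" for t using \<sigma> by auto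
  define H where "H t = exp (\<delta> * t) * k (\<sigma> * t)" for t
  define H' where "H' t = exp (\<delta> * t) * (\<delta> * k (\<sigma> * t) + \<sigma> * k' (\<sigma> * t))" for t
  show "(H has_real_derivative H' t) (at t)" for t
  proof -
    have "((\<lambda>t. k (\<sigma> * t)) has_real_derivative (k' (\<sigma> * t) * \<sigma>)) (at t)"
      by (rule DERIV_chain2[OF d]) (auto intro!: derivative_eq_intros)
    then show ?thesis unfolding H_def H'_def
      by (auto intro!: derivative_eq_intros simp: algebra_simps)
  qed
  show "continuous_on UNIV H'" unfolding H'_def
    by (intro continuous_intros continuous_on_compose2[OF k] continuous_on_compose2[OF k']) auto
  have refl_int: "(\<integral>\<^sup>+t. f t \<partial>lborel) = (\<integral>\<^sup>+t. f (\<sigma> * t) \<partial>lborel)" if "f \<in> borel_measurable borel" for f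
    using nn_integral_real_affine[OF that, of \<sigma> 0] \<sigma> by auto
  show "\<bar>H t\<bar> \<le> exp (- a * t)" for t
  proof (cases "\<sigma> * t \<le> 0")
    case True
    then show ?thesis by (simp add: H_def zero)
  next
    case False
    have "(\<sigma> * (\<delta> - \<alpha>)) * (\<sigma> * t) \<le> 0" using False by (intro mult_nonpos_nonneg[OF \<delta>\<alpha>]) linarith
    also have "(\<sigma> * (\<delta> - \<alpha>)) * (\<sigma> * t) = \<delta> * t - \<alpha> * t" using \<sigma> by (auto simp: algebra_simps)
    finally have "\<delta> * t \<le> \<alpha> * t" by simp
    then have "exp (\<delta> * t) * \<bar>k (\<sigma> * t)\<bar> \<le> exp (\<alpha> * t) * 1" by (intro mult_mono k1) auto
    then show ?thesis by (simp add: H_def abs_mult \<alpha>_def)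
  qed
  have "(\<integral>\<^sup>+t. ennreal (exp (- \<beta> * p * t) * \<bar>H' t\<bar> powr p) \<partial>lborel)
     = (\<integral>\<^sup>+t. ennreal (exp (- \<beta> * p * (\<sigma> * t)) * \<bar>H' (\<sigma> * t)\<bar> powr p) \<partial>lborel)"
    by (rule refl_int) (simp add: H'_def)
  also have "\<dots> = (\<integral>\<^sup>+t. ennreal (exp (\<sigma> * (\<delta> - \<beta>) * p * t) * \<bar>\<delta> * k t + \<sigma> * k' t\<bar> powr p) * indicator {0..} t \<partial>lborel)"
  proof (rule nn_integral_cong)
    fix t
    have "exp (- \<beta> * p * (\<sigma> * t)) * \<bar>H' (\<sigma> * t)\<bar> powr p
       = exp (- \<beta> * p * (\<sigma> * t)) * (exp (\<delta> * (\<sigma> * t)) powr p * \<bar>\<delta> * k t + \<sigma> * k' t\<bar> powr p)"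
      unfolding H'_def \<sigma>\<sigma>(2) by (simp add: abs_mult powr_mult)
    also have "\<dots> = exp (\<sigma> * (\<delta> - \<beta>) * p * t) * \<bar>\<delta> * k t + \<sigma> * k' t\<bar> powr p"
      unfolding mult.assoc[symmetric] by (simp add: powr_def exp_add[symmetric] algebra_simps)
    finally show "ennreal (exp (- \<beta> * p * (\<sigma> * t)) * \<bar>H' (\<sigma> * t)\<bar> powr p)
       = ennreal (exp (\<sigma> * (\<delta> - \<beta>) * p * t) * \<bar>\<delta> * k t + \<sigma> * k' t\<bar> powr p) * indicator {0..} t"
      using zero[of t] by (cases "t \<ge> 0") auto
  qed
  also have "\<dots> < \<infinity>" by (rule fin)
  finally show "(\<integral>\<^sup>+t. ennreal (exp (- (- (b - p + real DIM('a)) / p) * p * t) * \<bar>H' t\<bar> powr p) \<partial>lborel) < \<infinity>"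
    by (simp only: \<beta>_def)
  have "(\<integral>\<^sup>+t. ennreal (exp (- \<gamma> * r * t) * \<bar>H t\<bar> powr r) \<partial>lborel)
     = (\<integral>\<^sup>+t. ennreal (exp (- \<gamma> * r * (\<sigma> * t)) * \<bar>H (\<sigma> * t)\<bar> powr r) \<partial>lborel)"
    by (rule refl_int) (simp add: H_def)
  also have "\<dots> = (\<integral>\<^sup>+t. ennreal (exp (\<sigma> * (\<delta> - \<gamma>) * r * t) * \<bar>k t\<bar> powr r) \<partial>lborel)"
  proof (rule nn_integral_cong)
    fix t
    have "exp (- \<gamma> * r * (\<sigma> * t)) * \<bar>H (\<sigma> * t)\<bar> powr r = exp (- \<gamma> * r * (\<sigma> * t)) * (exp (\<delta> * (\<sigma> * t)) powr r * \<bar>k t\<bar> powr r)"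
      unfolding H_def \<sigma>\<sigma>(2) by (simp add: abs_mult powr_mult)
    also have "\<dots> = exp (\<sigma> * (\<delta> - \<gamma>) * r * t) * \<bar>k t\<bar> powr r"
      unfolding mult.assoc[symmetric] by (simp add: powr_def exp_add[symmetric] algebra_simps)
    finally show "ennreal (exp (- \<gamma> * r * (\<sigma> * t)) * \<bar>H (\<sigma> * t)\<bar> powr r) = ennreal (exp (\<sigma> * (\<delta> - \<gamma>) * r * t) * \<bar>k t\<bar> powr r)"
      by simp
  qed
  also have "\<dots> = \<infinity>" by (rule inf)
  finally show "(\<integral>\<^sup>+t. ennreal (exp (- (- (c + real DIM('a)) / r) * r * t) * \<bar>H t\<bar> powr r) \<partial>lborel) = \<infinity>"
    by (simp only: \<gamma>_def)
qed

lemma has_real_derivative_pos_part_square: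
  "((\<lambda>t. (max 0 t)\<^sup>2) has_real_derivative (2 * max 0 t)) (at (t::real))"
proof -
  consider "t > 0" | "t < 0" | "t = 0" by linarith
  then show ?thesis
  proof cases
    case 1
    have "((\<lambda>t. t\<^sup>2) has_real_derivative (2 * max 0 t)) (at t)"
      using 1 by (auto intro!: derivative_eq_intros)
    then show ?thesis
      by (rule DERIV_cong_ev[THEN iffD1, rotated -1])
         (use 1 in \<open>auto intro!: eventually_nhds_in_open[of "{0<..}" t, THEN eventually_mono]\<close>)
  next
    case 2
    have "((\<lambda>t. 0) has_real_derivative (2 * max 0 t)) (at t)" using 2 by simp
    then show ?thesis
      by (rule DERIV_cong_ev[THEN iffD1, rotated -1])
         (use 2 in \<open>auto intro!: eventually_nhds_in_open[of "{..<0}" t, THEN eventually_mono]\<close>)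
  next
    case 3
    have "((\<lambda>h. (max 0 h)\<^sup>2 / h) \<longlongrightarrow> 0) (at (0::real))"
    proof (rule Lim_null_comparison)
      have "\<bar>(max 0 h)\<^sup>2 / h\<bar> \<le> \<bar>h\<bar>" for h :: real
        by (cases "h \<le> 0") (auto simp: max_def power2_eq_square)
      then show "eventually (\<lambda>h. norm ((max 0 h)\<^sup>2 / h) \<le> \<bar>h\<bar>) (at (0::real))" by simp
      show "((\<lambda>h::real. \<bar>h\<bar>) \<longlongrightarrow> 0) (at 0)" using tendsto_rabs_zero[OF tendsto_ident_at[of "0::real" UNIV]] by simp
    qed
    then show ?thesis using 3 by (simp add: DERIV_def)
  qed
qed

lemma nn_integral_inverse_at_top: "(\<integral>\<^sup>+t. ennreal (1 / (1 + t)) * indicator {1..} t \<partial>(lborel :: real measure)) = \<infinity>"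
proof -
  have "ennreal (ln (2 + real n) - ln 2) \<le> (\<integral>\<^sup>+t. ennreal (1 / (1 + t)) * indicator {1..} t \<partial>(lborel :: real measure))" for n
  proof -
    have "ennreal (ln (1 + (1 + real n)) - ln (1 + 1)) = (\<integral>\<^sup>+t. ennreal (1 / (1 + t)) * indicator {1..1 + real n} t \<partial>lborel)"
    proof (rule nn_integral_FTC_Icc[symmetric])
      show "((\<lambda>t. ln (1 + t)) has_real_derivative 1 / (1 + t)) (at t)" if "t \<in> {1..1 + real n}" for t
        using that by (auto intro!: derivative_eq_intros)
    qed auto
    also have "\<dots> \<le> (\<integral>\<^sup>+t. ennreal (1 / (1 + t)) * indicator {1..} t \<partial>(lborel :: real measure))"
      by (intro nn_integral_mono) (auto simp: indicator_def)
    finally show ?thesis by (simp add: add.assoc[symmetric])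
  qed
  note le = this
  have lim: "(\<lambda>n. ennreal (ln (2 + real n) - ln 2)) \<longlonglongrightarrow> \<infinity>"
  proof -
    have "LIM n sequentially. 2 + real n :> at_top"
      by (rule filterlim_tendsto_add_at_top[OF tendsto_const filterlim_real_sequentially])
    then have "LIM n sequentially. ln (2 + real n) :> at_top" by (rule filterlim_compose[OF ln_at_top])
    then have "LIM n sequentially. - ln 2 + ln (2 + real n) :> at_top"
      by (rule filterlim_tendsto_add_at_top[OF tendsto_const])
    then show ?thesis by (simp add: ennreal_tendsto_top_eq_at_top)
  qed
  have "\<infinity> \<le> (\<integral>\<^sup>+t. ennreal (1 / (1 + t)) * indicator {1..} t \<partial>(lborel :: real measure))"
    by (rule LIMSEQ_le_const2[OF lim]) (use le in blast)
  then show ?thesis by (simp add: top_unique)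
qed

text \<open>
  Here \<open>\<delta> = 0\<close>, and \<open>k\<close> is the quadratic spline that rises from \<open>0\<close> to \<open>1\<close> on \<open>[0, 1]\<close>. Its derivative has
  compact support, so that \<open>b\<close> does not matter.
\<close>

lemma plateau_counterexample:
  fixes a b c p r \<sigma> :: real
  assumes p: "p > 0" and r: "r > 0" and \<sigma>: "\<sigma> = 1 \<or> \<sigma> = -1"
    and \<alpha>: "\<sigma> * - a \<ge> 0" and \<gamma>: "\<sigma> * (- (c + real DIM('a::euclidean_space)) / r) \<le> 0"
  shows "\<not> (W_space a b p :: ('a \<Rightarrow> real) set) \<subseteq> weighted_Lp_space c r"
proof -
  define \<beta> where "\<beta> = - (b - p + real DIM('a)) / p"
  define \<gamma>' where "\<gamma>' = - (c + real DIM('a)) / r"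
  define m where "m s = max 0 s" for s :: real
  define k where "k s = 2 * (m s)\<^sup>2 - 4 * (m (s - 1 / 2))\<^sup>2 + 2 * (m (s - 1))\<^sup>2" for s
  define k' where "k' s = 2 * (2 * m s) - 4 * (2 * m (s - 1 / 2)) + 2 * (2 * m (s - 1))" for s
  have md: "((\<lambda>s. (m (s - e))\<^sup>2) has_real_derivative 2 * m (s - e)) (at s)" for s e
  proof -
    have "((\<lambda>s. s - e) has_real_derivative 1) (at s)" by (auto intro!: derivative_eq_intros)
    from DERIV_chain2[of "\<lambda>t. (max 0 t)\<^sup>2" "2 * max 0 (s - e)" "\<lambda>s. s - e" s 1 UNIV,
        OF has_real_derivative_pos_part_square this]
    show ?thesis by (simp add: m_def)
  qed
  have kd: "(k has_real_derivative k' s) (at s)" for s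
    unfolding k_def k'_def using md[of 0 s]
    by (intro DERIV_add DERIV_diff DERIV_cmult md) simp
  have k'c: "continuous_on UNIV k'" unfolding k'_def m_def by (intro continuous_intros)
  have k1: "k s = 1" "k' s = 0" if "s \<ge> 1" for s
    using that by (auto simp: k_def k'_def m_def max_def power2_eq_square algebra_simps)
  have k0: "k s = 0" "k' s = 0" if "s \<le> 0" for s
    using that by (auto simp: k_def k'_def m_def max_def)
  have kb: "\<bar>k s\<bar> \<le> 1" for s
  proof -
    consider "s \<le> 0" | "0 < s" "s \<le> 1 / 2" | "1 / 2 < s" "s < 1" | "1 \<le> s" by linarith
    then show ?thesis
    proof cases
      case 2
      then have "k s = 2 * s\<^sup>2" by (simp add: k_def m_def)
      moreover have "s\<^sup>2 \<le> (1 / 2)\<^sup>2" using 2 by (intro power_mono) auto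
      ultimately show ?thesis by (simp add: power2_eq_square)
    next
      case 3
      then have "k s = 1 - 2 * (1 - s)\<^sup>2" by (simp add: k_def m_def power2_eq_square algebra_simps)
      moreover have "(1 - s)\<^sup>2 \<le> 1\<^sup>2" using 3 by (intro power_mono) auto
      ultimately show ?thesis by (simp add: abs_le_iff)
    qed (simp_all add: k0 k1)
  qed
  have k'b: "\<bar>k' s\<bar> \<le> 20" if "s \<in> {0..1}" for s
    using that by (auto simp: k'_def m_def max_def abs_if)
  show ?thesis
  proof (rule one_sided_counterexample[OF p r \<sigma> kd k'c k0 kb, where \<delta>=0])
    show "\<sigma> * (0 - - a) \<le> 0" using \<alpha> by simp
    have "(\<integral>\<^sup>+t. ennreal (exp (\<sigma> * (0 - \<beta>) * p * t) * \<bar>0 * k t + \<sigma> * k' t\<bar> powr p) * indicator {0..} t \<partial>lborel)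
      \<le> (\<integral>\<^sup>+t. ennreal (exp (\<bar>\<beta>\<bar> * p) * 20 powr p) * indicator {0..1::real} t \<partial>lborel)"
    proof (rule nn_integral_mono)
      fix t :: real
      consider "t < 0" | "t > 1" | "t \<in> {0..1}" by fastforce
      then show "ennreal (exp (\<sigma> * (0 - \<beta>) * p * t) * \<bar>0 * k t + \<sigma> * k' t\<bar> powr p) * indicator {0..} t
          \<le> ennreal (exp (\<bar>\<beta>\<bar> * p) * 20 powr p) * indicator {0..1} t"
      proof cases
        case 2
        then show ?thesis using k1(2)[of t] by simp
      next
        case 3
        have "\<sigma> * (0 - \<beta>) * p * t \<le> \<bar>\<beta>\<bar> * p * 1"
          using 3 \<sigma> p by (intro mult_mono mult_right_mono) auto
        moreover have "\<bar>\<sigma> * k' t\<bar> powr p \<le> 20 powr p"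
          using k'b[OF 3] \<sigma> p by (intro powr_mono2) (auto simp: abs_mult)
        ultimately have "exp (\<sigma> * (0 - \<beta>) * p * t) * \<bar>0 * k t + \<sigma> * k' t\<bar> powr p \<le> exp (\<bar>\<beta>\<bar> * p) * 20 powr p"
          by (intro mult_mono) auto
        then show ?thesis using 3 by (auto intro!: ennreal_leI)
      qed simp
    qed
    also have "\<dots> < \<infinity>" by (simp add: nn_integral_cmult ennreal_mult_less_top)
    finally show "(\<integral>\<^sup>+t. ennreal (exp (\<sigma> * (0 - - (b - p + real DIM('a)) / p) * p * t) * \<bar>0 * k t + \<sigma> * k' t\<bar> powr p) * indicator {0..} t \<partial>lborel) < \<infinity>"
      by (simp only: \<beta>_def)
    have "\<infinity> = (\<integral>\<^sup>+t. ennreal (1 / (1 + t)) * indicator {1..} t \<partial>lborel)"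
      by (rule nn_integral_inverse_at_top[symmetric])
    also have "\<dots> \<le> (\<integral>\<^sup>+t. ennreal (exp (\<sigma> * (0 - \<gamma>') * r * t) * \<bar>k t\<bar> powr r) \<partial>lborel)"
    proof (rule nn_integral_mono)
      fix t :: real
      have "1 \<le> exp (\<sigma> * (0 - \<gamma>') * r * t)" if "t \<ge> 1"
      proof -
        have "0 \<le> \<sigma> * (0 - \<gamma>')" using \<gamma> by (simp add: \<gamma>'_def)
        then have "0 \<le> \<sigma> * (0 - \<gamma>') * r * t"
          by (rule mult_nonneg_nonneg[OF mult_nonneg_nonneg]) (use that r in auto)
        then show ?thesis by simp
      qed
      moreover have "1 / (1 + t) \<le> 1" if "t \<ge> 1" using that by simp
      ultimately have "1 / (1 + t) \<le> exp (\<sigma> * (0 - \<gamma>') * r * t)" if "t \<ge> 1"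
        using that by (meson order_trans)
      then show "ennreal (1 / (1 + t)) * indicator {1..} t \<le> ennreal (exp (\<sigma> * (0 - \<gamma>') * r * t) * \<bar>k t\<bar> powr r)"
        using k1(1)[of t] by (cases "t \<ge> 1") (simp_all add: ennreal_leI)
    qed
    finally show "(\<integral>\<^sup>+t. ennreal (exp (\<sigma> * (0 - - (c + real DIM('a)) / r) * r * t) * \<bar>k t\<bar> powr r) \<partial>lborel) = \<infinity>"
      by (simp add: \<gamma>'_def top_unique)
  qed
qed

text \<open>
  Here \<open>\<delta> = \<gamma>\<close>, and \<open>k s = s\<^sup>2 (1 + s\<^sup>2)\<^bsup>-1-1/(2r)\<^esup>\<close> for \<open>s \<ge> 0\<close>. It decays like \<open>s\<^bsup>-1/r\<^esup>\<close>, as does the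
  bound on its derivative; the power \<open>r\<close> of this is not integrable at infinity, but the power \<open>p > r\<close> is.
\<close>

lemma critical_counterexample:
  fixes a b c p r \<sigma> :: real
  defines "\<alpha> \<equiv> - a" and "\<beta> \<equiv> - (b - p + real DIM('a::euclidean_space)) / p"
    and "\<gamma> \<equiv> - (c + real DIM('a)) / r"
  assumes r: "0 < r" "r < p" and \<sigma>: "\<sigma> = 1 \<or> \<sigma> = -1"
    and \<gamma>\<alpha>: "\<sigma> * (\<gamma> - \<alpha>) \<le> 0" and \<gamma>\<beta>: "\<sigma> * (\<gamma> - \<beta>) \<le> 0"
  shows "\<not> (W_space a b p :: ('a \<Rightarrow> real) set) \<subseteq> weighted_Lp_space c r"
proof -
  have p: "p > 0" using r by simp
  define \<kappa> where "\<kappa> = 1 / (2 * r)"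
  have \<kappa>: "\<kappa> > 0" using r by (simp add: \<kappa>_def)
  define A where "A s = 1 + s\<^sup>2" for s :: real
  have A: "A s \<ge> 1" "A s > 0" for s by (auto simp: A_def add_pos_nonneg)
  define m where "m s = max 0 s" for s :: real
  define k where "k s = (m s)\<^sup>2 * A s powr (- 1 - \<kappa>)" for s
  define k' where "k' s = 2 * m s * A s powr (- 1 - \<kappa>) + (m s)\<^sup>2 * ((- 1 - \<kappa>) * A s powr (- 2 - \<kappa>) * (2 * s))" for s
  have kd: "(k has_real_derivative k' s) (at s)" for s
  proof -
    have "((\<lambda>s. (m s)\<^sup>2) has_real_derivative 2 * m s) (at s)"
      unfolding m_def by (rule has_real_derivative_pos_part_square)
    moreover have "((\<lambda>s. A s powr (- 1 - \<kappa>)) has_real_derivative ((- 1 - \<kappa>) * A s powr (- 1 - \<kappa> - 1) * (2 * s))) (at s)"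
    proof (rule DERIV_chain2[OF has_real_derivative_powr])
      show "(A has_real_derivative 2 * s) (at s)" unfolding A_def by (auto intro!: derivative_eq_intros)
    qed (rule A)
    ultimately have "(k has_real_derivative (2 * m s * A s powr (- 1 - \<kappa>)
        + ((- 1 - \<kappa>) * A s powr (- 1 - \<kappa> - 1) * (2 * s)) * (m s)\<^sup>2)) (at s)"
      unfolding k_def by (rule DERIV_mult)
    then show ?thesis by (simp add: k'_def mult.commute)
  qed
  have k'c: "continuous_on UNIV k'" unfolding k'_def m_def A_def
    by (intro continuous_intros) (auto simp: add_nonneg_eq_0_iff)
  have k0: "k s = 0" "k' s = 0" if "s \<le> 0" for s using that by (auto simp: k_def k'_def m_def)
  have mA: "(m s)\<^sup>2 \<le> A s" for s by (simp add: m_def A_def max_def)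
  have sA: "\<bar>s\<bar> \<le> A s" for s
  proof -
    have "0 \<le> (\<bar>s\<bar> - 1)\<^sup>2 + \<bar>s\<bar>" by (intro add_nonneg_nonneg) auto
    then show ?thesis by (simp add: A_def power2_eq_square algebra_simps)
  qed
  have powA: "A s powr (- 1 - \<kappa>) = A s powr - \<kappa> / A s" "A s powr (- 2 - \<kappa>) = A s powr - \<kappa> / (A s)\<^sup>2" for s
    using A(2)[of s] by (simp_all add: powr_diff powr_minus field_simps)
  have kA: "0 \<le> k s" "k s \<le> A s powr - \<kappa>" for s
  proof -
    show "0 \<le> k s" by (simp add: k_def)
    have "(m s)\<^sup>2 * A s powr - \<kappa> \<le> A s * A s powr - \<kappa>" using mA by (intro mult_right_mono) auto
    then show "k s \<le> A s powr - \<kappa>" using A(2)[of s] by (simp add: k_def powA field_simps)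
  qed
  have kb: "\<bar>k s\<bar> \<le> 1" for s
  proof -
    have "A s powr - \<kappa> \<le> A s powr 0" using A(1)[of s] \<kappa> by (intro powr_mono) auto
    then show ?thesis using kA[of s] A(2)[of s] by simp
  qed
  have k'A: "\<bar>k' s\<bar> \<le> (4 + 2 * \<kappa>) * A s powr - \<kappa>" for s
  proof -
    have "\<bar>2 * m s * A s powr (- 1 - \<kappa>)\<bar> \<le> 2 * A s powr - \<kappa>"
    proof -
      have "\<bar>m s\<bar> \<le> A s" using sA[of s] A(2)[of s] by (auto simp: m_def max_def)
      then have "\<bar>m s\<bar> * A s powr - \<kappa> \<le> A s * A s powr - \<kappa>" by (intro mult_right_mono) auto
      then show ?thesis using A(2)[of s] by (simp add: powA abs_mult field_simps)
    qed
    moreover have "\<bar>(m s)\<^sup>2 * ((- 1 - \<kappa>) * A s powr (- 2 - \<kappa>) * (2 * s))\<bar> \<le> (2 + 2 * \<kappa>) * A s powr - \<kappa>"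
    proof -
      have "(m s)\<^sup>2 * \<bar>s\<bar> \<le> A s * A s" using mA sA A(2)[of s] by (intro mult_mono) auto
      then have "((m s)\<^sup>2 * \<bar>s\<bar> / (A s)\<^sup>2) * ((2 + 2 * \<kappa>) * A s powr - \<kappa>) \<le> 1 * ((2 + 2 * \<kappa>) * A s powr - \<kappa>)"
        using A(2)[of s] \<kappa> by (intro mult_right_mono) (auto simp: power2_eq_square divide_le_eq_1)
      moreover have "\<bar>(m s)\<^sup>2 * ((- 1 - \<kappa>) * A s powr (- 2 - \<kappa>) * (2 * s))\<bar>
          = ((m s)\<^sup>2 * \<bar>s\<bar> / (A s)\<^sup>2) * ((2 + 2 * \<kappa>) * A s powr - \<kappa>)"
      proof -
        have "\<bar>- 1 - \<kappa>\<bar> = 1 + \<kappa>" using \<kappa> by simp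
        then show ?thesis unfolding powA abs_mult by (simp add: abs_divide algebra_simps add_divide_distrib)
      qed
      ultimately show ?thesis by simp
    qed
    moreover have "(4 + 2 * \<kappa>) * A s powr - \<kappa> = 2 * A s powr - \<kappa> + (2 + 2 * \<kappa>) * A s powr - \<kappa>"
      by (simp add: algebra_simps)
    ultimately show ?thesis unfolding k'_def
      using abs_triangle_ineq[of "2 * m s * A s powr (- 1 - \<kappa>)" "(m s)\<^sup>2 * ((- 1 - \<kappa>) * A s powr (- 2 - \<kappa>) * (2 * s))"]
      by linarith
  qed
  define q where "q = p / r"
  have q: "q > 1" using r by (simp add: q_def)
  define C where "C = \<bar>\<gamma>\<bar> + (4 + 2 * \<kappa>)"
  have C: "C \<ge> 0" using \<kappa> by (simp add: C_def)
  have comb: "\<bar>\<gamma> * k s + \<sigma> * k' s\<bar> powr p \<le> C powr p * (2 powr (q / 2) * (1 + s) powr - q)" if s: "s \<ge> 0" for s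
  proof -
    have "\<bar>\<gamma> * k s + \<sigma> * k' s\<bar> \<le> \<bar>\<gamma>\<bar> * \<bar>k s\<bar> + \<bar>k' s\<bar>"
      using abs_triangle_ineq[of "\<gamma> * k s" "\<sigma> * k' s"] \<sigma> by (auto simp: abs_mult)
    also have "\<dots> \<le> \<bar>\<gamma>\<bar> * A s powr - \<kappa> + (4 + 2 * \<kappa>) * A s powr - \<kappa>"
      using kA[of s] by (intro add_mono mult_left_mono k'A) auto
    also have "\<dots> = C * A s powr - \<kappa>" by (simp add: C_def algebra_simps)
    finally have "\<bar>\<gamma> * k s + \<sigma> * k' s\<bar> powr p \<le> (C * A s powr - \<kappa>) powr p"
      using p by (intro powr_mono2) auto
    also have "\<dots> = C powr p * A s powr (- (q / 2))"
      using C by (simp add: powr_mult powr_powr \<kappa>_def q_def mult.commute)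
    also have "A s powr (- (q / 2)) \<le> ((1 + s)\<^sup>2 / 2) powr (- (q / 2))"
    proof (rule powr_mono2')
      have "0 \<le> (1 - s)\<^sup>2" by simp
      then show "(1 + s)\<^sup>2 / 2 \<le> A s" by (simp add: A_def power2_eq_square algebra_simps)
    qed (use q s in auto)
    also have "((1 + s)\<^sup>2 / 2) powr (- (q / 2)) = 2 powr (q / 2) * (1 + s) powr - q"
    proof -
      have "(1 + s)\<^sup>2 = (1 + s) powr 2" using s by simp
      then have "((1 + s)\<^sup>2) powr (q / 2) = (1 + s) powr q" by (simp only: powr_powr) simp
      then show ?thesis using s by (simp add: powr_divide powr_minus field_simps)
    qed
    finally show ?thesis by (simp add: mult_left_mono)
  qed
  show ?thesis
  proof (rule one_sided_counterexample[OF p r(1) \<sigma> kd k'c k0 kb, where \<delta>=\<gamma>])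
    show "\<sigma> * (\<gamma> - - a) \<le> 0" using \<gamma>\<alpha> by (simp add: \<alpha>_def)
    let ?c = "C powr p * 2 powr (q / 2)"
    have "(\<integral>\<^sup>+t. ennreal (exp (\<sigma> * (\<gamma> - \<beta>) * p * t) * \<bar>\<gamma> * k t + \<sigma> * k' t\<bar> powr p) * indicator {0..} t \<partial>lborel)
      \<le> (\<integral>\<^sup>+t. ennreal ?c * (ennreal ((1 + t) powr - q) * indicator {0..} (t::real)) \<partial>lborel)"
    proof (rule nn_integral_mono)
      fix t :: real
      show "ennreal (exp (\<sigma> * (\<gamma> - \<beta>) * p * t) * \<bar>\<gamma> * k t + \<sigma> * k' t\<bar> powr p) * indicator {0..} t
        \<le> ennreal ?c * (ennreal ((1 + t) powr - q) * indicator {0..} t)"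
      proof (cases "t \<ge> 0")
        case True
        have "\<sigma> * (\<gamma> - \<beta>) * (p * t) \<le> 0" using p True by (intro mult_nonpos_nonneg[OF \<gamma>\<beta>]) simp
        then have "exp (\<sigma> * (\<gamma> - \<beta>) * p * t) \<le> 1" by (simp add: mult.assoc)
        then have "exp (\<sigma> * (\<gamma> - \<beta>) * p * t) * \<bar>\<gamma> * k t + \<sigma> * k' t\<bar> powr p \<le> 1 * (C powr p * (2 powr (q / 2) * (1 + t) powr - q))"
          using comb[OF True] by (intro mult_mono) auto
        then show ?thesis using True by (simp add: ennreal_mult[symmetric] mult.assoc ennreal_leI)
      qed simp
    qed
    also have "\<dots> = ennreal ?c * (\<integral>\<^sup>+t. ennreal ((1 + t) powr - q) * indicator {0..} t \<partial>lborel)"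
      by (rule nn_integral_cmult) measurable
    also have "(\<integral>\<^sup>+t. ennreal ((1 + t) powr - q) * indicator {0..} t \<partial>lborel) = ennreal (0 - (1 + 0) powr (1 - q) / (1 - q))"
    proof (rule nn_integral_FTC_atLeast)
      show "((\<lambda>t. (1 + t) powr (1 - q) / (1 - q)) has_real_derivative (1 + t) powr - q) (at t)" if "0 \<le> t" for t
      proof -
        have "((\<lambda>t. (1 + t) powr (1 - q)) has_real_derivative ((1 - q) * (1 + t) powr (1 - q - 1) * 1)) (at t)"
          by (rule DERIV_chain2[OF has_real_derivative_powr]) (use that in \<open>auto intro!: derivative_eq_intros\<close>)
        from DERIV_cdivide[OF this, of "1 - q"] show ?thesis using q by simp
      qed
      have "LIM t at_top. 1 + t :> (at_top :: real filter)"
        by (rule filterlim_tendsto_add_at_top[OF tendsto_const filterlim_ident])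
      then have "((\<lambda>t. (1 + t) powr (1 - q)) \<longlongrightarrow> 0) at_top"
        using q by (intro tendsto_neg_powr) auto
      then show "((\<lambda>t. (1 + t) powr (1 - q) / (1 - q)) \<longlongrightarrow> 0) at_top"
        using tendsto_divide_zero by blast
    qed auto
    also have "ennreal ?c * \<dots> < \<infinity>" by (simp add: ennreal_mult_less_top)
    finally show "(\<integral>\<^sup>+t. ennreal (exp (\<sigma> * (\<gamma> - - (b - p + real DIM('a)) / p) * p * t) * \<bar>\<gamma> * k t + \<sigma> * k' t\<bar> powr p) * indicator {0..} t \<partial>lborel) < \<infinity>"
      by (simp only: \<beta>_def)
    have "\<infinity> = ennreal ((1 / 2) powr r) * (\<integral>\<^sup>+t. ennreal (1 / (1 + t)) * indicator {1..} t \<partial>lborel)"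
      unfolding nn_integral_inverse_at_top by (simp add: ennreal_mult_top)
    also have "\<dots> = (\<integral>\<^sup>+t. ennreal ((1 / 2) powr r) * (ennreal (1 / (1 + t)) * indicator {1..} t) \<partial>lborel)"
      by (rule nn_integral_cmult[symmetric]) measurable
    also have "\<dots> \<le> (\<integral>\<^sup>+t. ennreal (exp (\<sigma> * (\<gamma> - \<gamma>) * r * t) * \<bar>k t\<bar> powr r) \<partial>lborel)"
    proof (rule nn_integral_mono)
      fix t :: real
      have "(1 / 2) powr r * (1 / (1 + t)) \<le> \<bar>k t\<bar> powr r" if t: "t \<ge> 1"
      proof -
        have t2: "1 \<le> t\<^sup>2" using t by (simp add: one_le_power)
        have "1 / 2 * A t \<le> (m t)\<^sup>2" using t t2 by (simp add: A_def m_def)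
        then have "1 / 2 * A t powr - \<kappa> \<le> k t"
          using mult_right_mono[of "1 / 2 * A t" "(m t)\<^sup>2" "A t powr - \<kappa>"] A(2)[of t]
          by (simp add: k_def powA field_simps)
        then have "(1 / 2 * A t powr - \<kappa>) powr r \<le> \<bar>k t\<bar> powr r"
          using r kA(1)[of t] by (intro powr_mono2) auto
        moreover have "(1 / 2 * A t powr - \<kappa>) powr r = (1 / 2) powr r * A t powr (- (1 / 2))"
        proof -
          have "(1 / 2 * A t powr - \<kappa>) powr r = (1 / 2) powr r * (A t powr - \<kappa>) powr r"
            by (rule powr_mult)
          also have "(A t powr - \<kappa>) powr r = A t powr (- (1 / 2))"
            unfolding powr_powr using r by (simp add: \<kappa>_def)
          finally show ?thesis .
        qed
        moreover have "1 / (1 + t) \<le> A t powr (- (1 / 2))"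
        proof -
          have "A t \<le> (1 + t)\<^sup>2" using t by (simp add: A_def power2_eq_square algebra_simps)
          then have "((1 + t)\<^sup>2) powr (- (1 / 2)) \<le> A t powr (- (1 / 2))" using A(2)[of t] by (intro powr_mono2') auto
          moreover have "((1 + t)\<^sup>2) powr (- (1 / 2)) = 1 / (1 + t)"
          proof -
            have "(1 + t)\<^sup>2 = (1 + t) powr 2" using t by simp
            then show ?thesis using t by (simp only: powr_powr) (simp add: powr_minus_divide)
          qed
          ultimately show ?thesis by simp
        qed
        ultimately show ?thesis using mult_left_mono[of "1 / (1 + t)" "A t powr (- (1 / 2))" "(1 / 2) powr r"] by simp
      qed
      then show "ennreal ((1 / 2) powr r) * (ennreal (1 / (1 + t)) * indicator {1..} t)
         \<le> ennreal (exp (\<sigma> * (\<gamma> - \<gamma>) * r * t) * \<bar>k t\<bar> powr r)"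
        by (cases "t \<ge> 1") (simp_all add: ennreal_mult[symmetric] ennreal_leI)
    qed
    finally show "(\<integral>\<^sup>+t. ennreal (exp (\<sigma> * (\<gamma> - - (c + real DIM('a)) / r) * r * t) * \<bar>k t\<bar> powr r) \<partial>lborel) = \<infinity>"
      by (simp add: \<gamma>_def top_unique)
  qed
qed

section \<open>The characterization of the embedding\<close>

theorem theorem5p2:
  fixes a b c p r :: real
  defines "N \<equiv> real CARD('n::finite)"
  defines "c0 \<equiv> a * r - N"
    and "c1 \<equiv> r * (b - p + N) / p - N"
  assumes "1 \<le> p" and "0 < r" and "r < p"
    and "CARD('n) \<noteq> 1 \<Longrightarrow> 1 \<le> r"
  shows "continuously_embedded
           (W_space a b p :: (real ^ 'n \<Rightarrow> real) set) (W_norm a b p)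
           (weighted_Lp_space c r) (weighted_Lp_norm c r)
         \<longleftrightarrow>
         a \<noteq> 0 \<and>
         ((a * p - N \<noteq> b - p \<and> same_side (- N) (a * p - N) (b - p)
             \<and> c \<in> open_interval_between c0 c1) \<or>
          (strictly_opposite_sides (- N) (a * p - N) (b - p)
             \<and> c \<in> open_interval_between c0 (- N)))"
proof -
  have p: "p > 0" using assms(4) by simp
  have N: "real DIM(real ^ 'n) = N" by (simp add: N_def)
  define \<alpha> where "\<alpha> = - a"
  define \<beta> where "\<beta> = - (b - p + N) / p"
  define \<gamma> where "\<gamma> = - (c + N) / r"
  have a: "a = - \<alpha>" by (simp add: \<alpha>_def)
  have b: "b - p = - (\<beta> * p) - N" using p by (simp add: \<beta>_def field_simps)
  have c: "c = - (\<gamma> * r) - N" using assms(5) by (simp add: \<gamma>_def)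
  have c0: "c0 = - (\<alpha> * r) - N" by (simp add: c0_def a)
  have c1: "c1 = - (\<beta> * r) - N" using p by (simp add: c1_def \<beta>_def field_simps)
  have ap: "a * p - N = - (\<alpha> * p) - N" by (simp add: a)
  have cmp: "x * t < y * t \<longleftrightarrow> x < y" "x * t \<le> y * t \<longleftrightarrow> x \<le> y" "x * t = y * t \<longleftrightarrow> x = y" if "t > 0" for x y t :: real
    using that by auto
  have sgn: "0 < x * t \<longleftrightarrow> 0 < x" "x * t < 0 \<longleftrightarrow> x < 0" "0 \<le> x * t \<longleftrightarrow> 0 \<le> x" "x * t \<le> 0 \<longleftrightarrow> x \<le> 0" if "t > 0" for x t :: real
    using that by (auto simp: zero_less_mult_iff mult_less_0_iff zero_le_mult_iff mult_le_0_iff)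
  have between: "c \<in> open_interval_between c0 (- (x * r) - N) \<longleftrightarrow> min \<alpha> x < \<gamma> \<and> \<gamma> < max \<alpha> x" for x
    using cmp[OF assms(5)] by (auto simp: open_interval_between_def c c0 min_def max_def)
  have ne: "a * p - N \<noteq> b - p \<longleftrightarrow> \<alpha> \<noteq> \<beta>"
    unfolding ap b using cmp(3)[OF p] by simp
  have same: "same_side (- N) (a * p - N) (b - p) \<longleftrightarrow> (\<alpha> \<le> 0 \<and> \<beta> \<le> 0) \<or> (0 \<le> \<alpha> \<and> 0 \<le> \<beta>)"
    unfolding ap b same_side_def using sgn[OF p] by auto
  have opp: "strictly_opposite_sides (- N) (a * p - N) (b - p) \<longleftrightarrow> (0 < \<alpha> \<and> \<beta> < 0) \<or> (\<alpha> < 0 \<and> 0 < \<beta>)"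
    unfolding ap b strictly_opposite_sides_def using sgn[OF p] by auto
  have i1: "c \<in> open_interval_between c0 c1 \<longleftrightarrow> min \<alpha> \<beta> < \<gamma> \<and> \<gamma> < max \<alpha> \<beta>"
    unfolding c1 by (rule between)
  have i2: "c \<in> open_interval_between c0 (- N) \<longleftrightarrow> min \<alpha> 0 < \<gamma> \<and> \<gamma> < max \<alpha> 0"
    using between[of 0] by simp
  let ?E = "continuously_embedded (W_space a b p :: (real ^ 'n \<Rightarrow> real) set) (W_norm a b p)
           (weighted_Lp_space c r) (weighted_Lp_norm c r)"
  let ?R = "\<alpha> \<noteq> 0 \<and> (\<alpha> \<noteq> \<beta> \<and> ((\<alpha> \<le> 0 \<and> \<beta> \<le> 0) \<or> (0 \<le> \<alpha> \<and> 0 \<le> \<beta>)) \<and> min \<alpha> \<beta> < \<gamma> \<and> \<gamma> < max \<alpha> \<beta> \<or>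
      ((0 < \<alpha> \<and> \<beta> < 0) \<or> (\<alpha> < 0 \<and> 0 < \<beta>)) \<and> min \<alpha> 0 < \<gamma> \<and> \<gamma> < max \<alpha> 0)"
  have "?E \<longleftrightarrow> ?R"
  proof
    assume R: ?R
    \<comment> \<open>The sign \<open>\<sigma>\<close> is that of \<open>\<alpha> - \<gamma>\<close>.\<close>
    have suff: ?E if "\<sigma> = 1 \<or> \<sigma> = -1" "\<sigma> * \<beta> < \<sigma> * \<gamma>" "\<sigma> * \<gamma> < \<sigma> * \<alpha>" "0 < \<sigma> * \<gamma> \<or> \<sigma> * \<alpha> < 0" for \<sigma>
      using embedding_sufficient[where 'a="real ^ 'n", OF that(1) assms(5,6,4), of b c a] that(2-4)
      unfolding N \<alpha>_def \<beta>_def \<gamma>_def by blast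
    show ?E
    proof (cases "\<gamma> < \<alpha>")
      case True
      then show ?thesis using R by (intro suff[of 1]) (auto simp: min_def max_def split: if_splits)
    next
      case False
      then show ?thesis using R by (intro suff[of "-1"]) (auto simp: min_def max_def split: if_splits)
    qed
  next
    assume E: ?E
    then have sub: "(W_space a b p :: (real ^ 'n \<Rightarrow> real) set) \<subseteq> weighted_Lp_space c r"
      by (simp add: continuously_embedded_def)
    have crit: "\<not> (\<sigma> * (\<gamma> - \<alpha>) \<le> 0 \<and> \<sigma> * (\<gamma> - \<beta>) \<le> 0)" if "\<sigma> = 1 \<or> \<sigma> = -1" for \<sigma>
      using critical_counterexample[where 'a="real ^ 'n", OF assms(5,6) that, of c a b] sub
      unfolding N \<alpha>_def \<beta>_def \<gamma>_def by blast
    have plat: "\<not> (\<sigma> * \<alpha> \<ge> 0 \<and> \<sigma> * \<gamma> \<le> 0)" if "\<sigma> = 1 \<or> \<sigma> = -1" for \<sigma>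
      using plateau_counterexample[where 'a="real ^ 'n", OF p assms(5) that, of a c b] sub
      unfolding N \<alpha>_def \<gamma>_def by blast
    show ?R
      using crit[of 1] crit[of "-1"] plat[of 1] plat[of "-1"] by (auto simp: min_def max_def)
  qed
  moreover have "a \<noteq> 0 \<longleftrightarrow> \<alpha> \<noteq> 0" by (simp add: \<alpha>_def)
  ultimately show ?thesis unfolding ne same opp i1 i2 by simp
qed

end
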